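(* Let $\rho: \pi_1(\Sigma_{0,n})\to \operatorname{SL}_2(\mathbb{C})$ be a representation with Zariski-dense image and non-scalar local monodromy at each puncture. Suppose the local monodromy at one or more punctures has infinite order, and that $[\rho]\in X_n$ has finite orbit under the action of $\operatorname{Mod}_{0,n}$. Then $n\leq 6$.
   Context: $\Sigma_{0,n}$ is the $2$-sphere with $n$ punctures, with $\pi_1(\Sigma_{0,n})=\langle\gamma_1,\dots,\gamma_n\mid\prod\gamma_i=\mathrm{id}\rangle$, $\gamma_i$ a loop around the $i$-th puncture. A representation $\rho$ corresponds to the tuple $(A_1,\dots,A_n)$ with $A_i=\rho(\gamma_i)$ (the local monodromy at the $i$-th puncture) and $\prod A_i=\operatorname{Id}$. The set $$X_n=\{(A_1,\dots,A_n)\in\operatorname{SL}_2(\mathbb{C})^n\mid \textstyle\prod A_i=\operatorname{Id},\ \text{the } A_i \text{ generate a Zariski-dense subgroup of } \operatorname{SL}_2(\mathbb{C})\}/\operatorname{SL}_2(\mathbb{C})$$ is the set of such tuples up to simultaneous conjugation. $\operatorname{Mod}_{0,n}=\pi_0(\operatorname{Homeo}^+(\Sigma_{0,n}))$ is the mapping class group, acting on $X_n$ through its outer action on $\pi_1(\Sigma_{0,n})$; it is generated by $\sigma_1,\dots,\sigma_{n-1}$ acting by $$\sigma_i:(A_1,\dots,A_n)\mapsto(A_1,\dots,A_{i-1},A_iA_{i+1}A_i^{-1},A_i,A_{i+2},\dots,A_n).$$ *)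

theory Defs
  imports "HOL-Analysis.Determinants" "HOL-Algebra.Generated_Groups" "HOL-Algebra.Group_Action"
begin

section \<open>Groups given by generators and relators\<close>

text \<open>A word over \<open>S\<close> is a list of signed letters: \<open>(s, True)\<close> stands for the generator \<open>s\<close>
  and \<open>(s, False)\<close> for its inverse. The relation \<open>pres_eq S R\<close> is equality in the group
  \<open>\<langle>S | R\<rangle>\<close>.\<close>

type_synonym 'a word = "('a \<times> bool) list"

inductive pres_eq :: "'a set \<Rightarrow> 'a word set \<Rightarrow> 'a word \<Rightarrow> 'a word \<Rightarrow> bool"
  for S :: "'a set" and R :: "'a word set" where
  refl: "w \<in> lists (S \<times> UNIV) \<Longrightarrow> pres_eq S R w w"
| sym: "pres_eq S R v w \<Longrightarrow> pres_eq S R w v"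
| trans: "pres_eq S R u v \<Longrightarrow> pres_eq S R v w \<Longrightarrow> pres_eq S R u w"
| cancel: "u \<in> lists (S \<times> UNIV) \<Longrightarrow> v \<in> lists (S \<times> UNIV) \<Longrightarrow> s \<in> S \<Longrightarrow>
    pres_eq S R (u @ [(s, b), (s, \<not> b)] @ v) (u @ v)"
| relator: "u \<in> lists (S \<times> UNIV) \<Longrightarrow> v \<in> lists (S \<times> UNIV) \<Longrightarrow>
    r \<in> R \<Longrightarrow> r \<in> lists (S \<times> UNIV) \<Longrightarrow> pres_eq S R (u @ r @ v) (u @ v)"

definition pres_class :: "'a set \<Rightarrow> 'a word set \<Rightarrow> 'a word \<Rightarrow> 'a word set" where
  "pres_class S R w = {v. pres_eq S R w v}"

definition presented_group :: "'a set \<Rightarrow> 'a word set \<Rightarrow> 'a word set monoid" where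
  "presented_group S R =
    \<lparr>carrier = pres_class S R ` lists (S \<times> UNIV),
     mult = (\<lambda>U V. \<Union>u\<in>U. \<Union>v\<in>V. pres_class S R (u @ v)),
     one = pres_class S R []\<rparr>"

lemma pres_eq_words:
  "pres_eq S R v w \<Longrightarrow> v \<in> lists (S \<times> UNIV) \<and> w \<in> lists (S \<times> UNIV)"
  by (induction rule: pres_eq.induct) auto

lemma pres_eq_context:
  assumes "pres_eq S R v w" "a \<in> lists (S \<times> UNIV)" "b \<in> lists (S \<times> UNIV)"
  shows "pres_eq S R (a @ v @ b) (a @ w @ b)"
  using assms(1)
proof (induction rule: pres_eq.induct)
  case (refl w)
  then show ?case using assms by (intro pres_eq.refl) auto
next
  case (cancel u v s c)
  then show ?case
    using pres_eq.cancel[of "a @ u" S "v @ b" s R c] assms by simp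
next
  case (relator u v r)
  then show ?case
    using pres_eq.relator[of "a @ u" S "v @ b" r R] assms by simp
qed (blast intro: pres_eq.sym pres_eq.trans)+

lemma pres_eq_append:
  assumes "pres_eq S R v v'" "pres_eq S R w w'"
  shows "pres_eq S R (v @ w) (v' @ w')"
proof -
  have "pres_eq S R ([] @ v @ w) ([] @ v' @ w)"
    using pres_eq_context[OF assms(1), of "[]" w] pres_eq_words[OF assms(2)] by simp
  moreover have "pres_eq S R (v' @ w @ []) (v' @ w' @ [])"
    using pres_eq_context[OF assms(2), of v' "[]"] pres_eq_words[OF assms(1)] by simp
  ultimately show ?thesis using pres_eq.trans by fastforce
qed

lemma pres_class_eqI: "pres_eq S R v w \<Longrightarrow> pres_class S R v = pres_class S R w"
  unfolding pres_class_def by (blast intro: pres_eq.sym pres_eq.trans)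

lemma presented_group_mult:
  assumes "v \<in> lists (S \<times> UNIV)" "w \<in> lists (S \<times> UNIV)"
  shows "pres_class S R v \<otimes>\<^bsub>presented_group S R\<^esub> pres_class S R w = pres_class S R (v @ w)"
proof -
  have "pres_class S R (a @ b) = pres_class S R (v @ w)"
    if "a \<in> pres_class S R v" "b \<in> pres_class S R w" for a b
    using that pres_eq_append[of S R v a w b] pres_class_eqI unfolding pres_class_def by blast
  moreover have "v \<in> pres_class S R v" "w \<in> pres_class S R w"
    using assms by (auto simp: pres_class_def intro: pres_eq.refl)
  ultimately have "(\<Union>a\<in>pres_class S R v. \<Union>b\<in>pres_class S R w. pres_class S R (a @ b))
      = pres_class S R (v @ w)"
    by blast
  then show ?thesis by (simp add: presented_group_def)
qed

lemma group_presented_group: "group (presented_group S R)"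
proof (rule groupI)
  let ?G = "presented_group S R"
  have car: "carrier ?G = pres_class S R ` lists (S \<times> UNIV)"
    and one: "\<one>\<^bsub>?G\<^esub> = pres_class S R []" by (auto simp: presented_group_def)
  show "x \<otimes>\<^bsub>?G\<^esub> y \<in> carrier ?G" if xy: "x \<in> carrier ?G" "y \<in> carrier ?G" for x y
  proof -
    obtain v w where "v \<in> lists (S \<times> UNIV)" "w \<in> lists (S \<times> UNIV)"
      "x = pres_class S R v" "y = pres_class S R w"
      using xy unfolding car by blast
    then have "x \<otimes>\<^bsub>?G\<^esub> y = pres_class S R (v @ w)" "v @ w \<in> lists (S \<times> UNIV)"
      by (simp_all add: presented_group_mult)
    then show ?thesis unfolding car by blast
  qed
  show "\<one>\<^bsub>?G\<^esub> \<in> carrier ?G" by (auto simp: car one)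
  show "x \<otimes>\<^bsub>?G\<^esub> y \<otimes>\<^bsub>?G\<^esub> z = x \<otimes>\<^bsub>?G\<^esub> (y \<otimes>\<^bsub>?G\<^esub> z)"
    if xyz: "x \<in> carrier ?G" "y \<in> carrier ?G" "z \<in> carrier ?G" for x y z
  proof -
    obtain u v w where "u \<in> lists (S \<times> UNIV)" "v \<in> lists (S \<times> UNIV)" "w \<in> lists (S \<times> UNIV)"
      "x = pres_class S R u" "y = pres_class S R v" "z = pres_class S R w"
      using xyz unfolding car by blast
    then show ?thesis by (simp add: presented_group_mult)
  qed
  show "\<one>\<^bsub>?G\<^esub> \<otimes>\<^bsub>?G\<^esub> x = x" if x: "x \<in> carrier ?G" for x
  proof -
    obtain w where "w \<in> lists (S \<times> UNIV)" "x = pres_class S R w"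
      using x unfolding car by blast
    then show ?thesis using presented_group_mult[of "[]" S w R] by (simp add: one)
  qed
  show "\<exists>y\<in>carrier ?G. y \<otimes>\<^bsub>?G\<^esub> x = \<one>\<^bsub>?G\<^esub>" if x: "x \<in> carrier ?G" for x
  proof -
    obtain w where w: "w \<in> lists (S \<times> UNIV)" "x = pres_class S R w"
      using x unfolding car by blast
    define inv_w where "inv_w w = rev (map (\<lambda>(s :: 'a, b). (s, \<not> b)) w)" for w
    have "inv_w w \<in> lists (S \<times> UNIV) \<and> pres_eq S R (inv_w w @ w) []"
      using w(1)
    proof (induction w)
      case Nil
      then show ?case by (auto simp: inv_w_def intro: pres_eq.refl)
    next
      case (Cons p w)
      obtain s b where p: "p = (s, b)" by force
      have IH: "inv_w w \<in> lists (S \<times> UNIV)" "pres_eq S R (inv_w w @ w) []"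
        using Cons by auto
      have "inv_w (p # w) @ p # w = inv_w w @ [(s, \<not> b), (s, \<not> \<not> b)] @ w"
        by (simp add: inv_w_def p)
      moreover have "pres_eq S R (inv_w w @ [(s, \<not> b), (s, \<not> \<not> b)] @ w) (inv_w w @ w)"
        using IH Cons p by (intro pres_eq.cancel) auto
      ultimately have "pres_eq S R (inv_w (p # w) @ p # w) []"
        using IH(2) pres_eq.trans by metis
      moreover have "inv_w (p # w) = inv_w w @ [(s, \<not> b)]" by (simp add: inv_w_def p)
      ultimately show ?case using IH(1) Cons p by auto
    qed
    then have "inv_w w \<in> lists (S \<times> UNIV)"
      and "pres_class S R (inv_w w @ w) = pres_class S R []"
      using pres_class_eqI[of S R "inv_w w @ w" "[]"] by simp_all
    then have "pres_class S R (inv_w w) \<otimes>\<^bsub>?G\<^esub> x = \<one>\<^bsub>?G\<^esub>" "pres_class S R (inv_w w) \<in> carrier ?G"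
      using presented_group_mult[OF _ w(1)] w(2) by (simp_all add: one car)
    then show ?thesis by blast
  qed
qed


section \<open>The fundamental group of the punctured sphere\<close>

text \<open>The generators \<open>\<gamma>\<^sub>1, \<dots>, \<gamma>\<^sub>n\<close> are indexed by \<open>0, \<dots>, n - 1\<close>, to match the indexing of lists.\<close>

definition sphere_relator :: "nat \<Rightarrow> nat word" where
  "sphere_relator n = map (\<lambda>i. (i, True)) [0..<n]"

definition pi1_sphere :: "nat \<Rightarrow> nat word set monoid" where
  "pi1_sphere n = presented_group {..<n} {sphere_relator n}"

definition loop :: "nat \<Rightarrow> nat \<Rightarrow> nat word set" where
  "loop n i = pres_class {..<n} {sphere_relator n} [(i, True)]"


section \<open>The group of complex 2 by 2 matrices of determinant 1 and its Zariski topology\<close>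

definition SL2C :: "(complex^2^2) monoid" where
  "SL2C = \<lparr>carrier = {A. det A = 1}, mult = (**), one = mat 1\<rparr>"

lemma SL2C_simps:
  "A \<in> carrier SL2C \<longleftrightarrow> det A = 1" "A \<otimes>\<^bsub>SL2C\<^esub> B = A ** B" "\<one>\<^bsub>SL2C\<^esub> = mat 1"
  by (auto simp: SL2C_def)

lemma group_SL2C: "group SL2C"
proof (rule groupI)
  show "\<exists>B\<in>carrier SL2C. B \<otimes>\<^bsub>SL2C\<^esub> A = \<one>\<^bsub>SL2C\<^esub>" if "A \<in> carrier SL2C" for A
  proof -
    have "invertible A" using that by (simp add: invertible_det_nz SL2C_simps)
    then obtain B where B: "B ** A = mat 1" unfolding invertible_def by blast
    then have "det B * det A = 1" by (metis det_I det_mul)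
    with B that show ?thesis by (auto simp: SL2C_simps)
  qed
qed (auto simp: SL2C_simps det_mul matrix_mul_assoc)

inductive_set matrix_polynomials :: "(complex^2^2 \<Rightarrow> complex) set" where
  const: "(\<lambda>A. c) \<in> matrix_polynomials"
| entry: "(\<lambda>A. A $ i $ j) \<in> matrix_polynomials"
| add: "p \<in> matrix_polynomials \<Longrightarrow> q \<in> matrix_polynomials \<Longrightarrow>
    (\<lambda>A. p A + q A) \<in> matrix_polynomials"
| mult: "p \<in> matrix_polynomials \<Longrightarrow> q \<in> matrix_polynomials \<Longrightarrow>
    (\<lambda>A. p A * q A) \<in> matrix_polynomials"

definition zariski_closed :: "(complex^2^2) set \<Rightarrow> bool" where
  "zariski_closed Z \<longleftrightarrow>
    (\<exists>P \<subseteq> matrix_polynomials. Z = {A \<in> carrier SL2C. \<forall>p\<in>P. p A = 0})"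

definition zariski_closure :: "(complex^2^2) set \<Rightarrow> (complex^2^2) set" where
  "zariski_closure H = \<Inter> {Z. zariski_closed Z \<and> H \<subseteq> Z}"

definition zariski_dense :: "(complex^2^2) set \<Rightarrow> bool" where
  "zariski_dense H \<longleftrightarrow> H \<subseteq> carrier SL2C \<and> zariski_closure H = carrier SL2C"


section \<open>The set \<open>X\<^sub>n\<close> and the action of the mapping class group\<close>

definition tuple_prod :: "('a, 'b) monoid_scheme \<Rightarrow> 'a list \<Rightarrow> 'a" where
  "tuple_prod G As = foldr (\<otimes>\<^bsub>G\<^esub>) As \<one>\<^bsub>G\<^esub>"

definition dense_tuples :: "nat \<Rightarrow> (complex^2^2) list set" where
  "dense_tuples n = {As. length As = n \<and> set As \<subseteq> carrier SL2C \<and>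
     tuple_prod SL2C As = \<one>\<^bsub>SL2C\<^esub> \<and> zariski_dense (generate SL2C (set As))}"

definition conj_tuple :: "('a, 'b) monoid_scheme \<Rightarrow> 'a \<Rightarrow> 'a list \<Rightarrow> 'a list" where
  "conj_tuple G g As = map (\<lambda>A. g \<otimes>\<^bsub>G\<^esub> A \<otimes>\<^bsub>G\<^esub> inv\<^bsub>G\<^esub> g) As"

definition conj_rel :: "nat \<Rightarrow> ((complex^2^2) list \<times> (complex^2^2) list) set" where
  "conj_rel n = {(As, Bs). As \<in> dense_tuples n \<and> Bs \<in> dense_tuples n \<and>
     (\<exists>g\<in>carrier SL2C. Bs = conj_tuple SL2C g As)}"

definition X_space :: "nat \<Rightarrow> (complex^2^2) list set set" where
  "X_space n = dense_tuples n // conj_rel n"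

definition braid_move :: "('a, 'b) monoid_scheme \<Rightarrow> nat \<Rightarrow> 'a list \<Rightarrow> 'a list" where
  "braid_move G i As =
    As[i := As ! i \<otimes>\<^bsub>G\<^esub> As ! Suc i \<otimes>\<^bsub>G\<^esub> inv\<^bsub>G\<^esub> (As ! i), Suc i := As ! i]"

text \<open>The move commutes with simultaneous conjugation and is invertible, so the image of a
  conjugacy class of tuples under it is again one (lemma \<open>sigma_in_BijGroup\<close> below).\<close>

definition sigma :: "nat \<Rightarrow> nat \<Rightarrow> (complex^2^2) list set \<Rightarrow> (complex^2^2) list set" where
  "sigma n i = (\<lambda>c\<in>X_space n. braid_move SL2C i ` c)"

text \<open>The group of permutations of \<open>X_space n\<close> through which the mapping class group of the \<open>n\<close>-punctured
  sphere acts: the mapping class group is generated by the half-twists \<open>\<sigma>\<^sub>1, \<dots>, \<sigma>\<^sub>n\<^sub>-\<^sub>1\<close>, so this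
  is the subgroup generated by the permutations that they induce.\<close>

definition mcg_perms :: "nat \<Rightarrow> ((complex^2^2) list set \<Rightarrow> (complex^2^2) list set) monoid" where
  "mcg_perms n = subgroup_generated (BijGroup (X_space n)) (sigma n ` {i. Suc i < n})"

definition mcg_orbit :: "nat \<Rightarrow> (complex^2^2) list set \<Rightarrow> (complex^2^2) list set set" where
  "mcg_orbit n x = orbit (mcg_perms n) (\<lambda>\<phi>. \<phi>) x"

definition monodromy_tuple :: "nat \<Rightarrow> (nat word set \<Rightarrow> complex^2^2) \<Rightarrow> (complex^2^2) list" where
  "monodromy_tuple n \<rho> = map (\<lambda>i. \<rho> (loop n i)) [0..<n]"

definition rep_class :: "nat \<Rightarrow> (nat word set \<Rightarrow> complex^2^2) \<Rightarrow> (complex^2^2) list set" where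
  "rep_class n \<rho> = conj_rel n `` {monodromy_tuple n \<rho>}"


section \<open>Well-definedness\<close>

context group
begin

lemma tuple_prod_closed: "set As \<subseteq> carrier G \<Longrightarrow> tuple_prod G As \<in> carrier G"
  by (induction As) (auto simp: tuple_prod_def)

lemma tuple_prod_append:
  "set As \<subseteq> carrier G \<Longrightarrow> set Bs \<subseteq> carrier G \<Longrightarrow>
    tuple_prod G (As @ Bs) = tuple_prod G As \<otimes> tuple_prod G Bs"
proof (induction As)
  case Nil
  then show ?case using tuple_prod_closed[of Bs] by (simp add: tuple_prod_def)
next
  case (Cons A As)
  then show ?case
    using tuple_prod_closed[of As] tuple_prod_closed[of Bs] by (simp add: tuple_prod_def m_assoc)
qed

lemma braid_move_append:
  "length xs = i \<Longrightarrow> braid_move G i (xs @ a # b # ys) = xs @ (a \<otimes> b \<otimes> inv a) # a # ys"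
  by (simp add: braid_move_def nth_append list_update_append)

definition unbraid_move :: "nat \<Rightarrow> 'a list \<Rightarrow> 'a list" where
  "unbraid_move i As = As[i := As ! Suc i, Suc i := inv (As ! Suc i) \<otimes> As ! i \<otimes> As ! Suc i]"

lemma unbraid_move_append:
  "length xs = i \<Longrightarrow> unbraid_move i (xs @ a # b # ys) = xs @ b # (inv b \<otimes> a \<otimes> b) # ys"
  by (simp add: unbraid_move_def nth_append list_update_append)

lemma split_tuple:
  assumes "Suc i < length As"
  obtains xs a b ys where "As = xs @ a # b # ys" "length xs = i"
proof
  show "As = take i As @ As ! i # As ! Suc i # drop (Suc (Suc i)) As"
    using assms by (metis Cons_nth_drop_Suc Suc_lessD append_take_drop_id)
  show "length (take i As) = i" using assms by simp
qed

lemma inv_cancels: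
  assumes "a \<in> carrier G" "b \<in> carrier G"
  shows "a \<otimes> (inv a \<otimes> b) = b" "inv a \<otimes> (a \<otimes> b) = b"
  using assms by (simp_all add: m_assoc[symmetric])

lemma unbraid_braid:
  assumes "Suc i < length As" "set As \<subseteq> carrier G"
  shows "unbraid_move i (braid_move G i As) = As"
    and "braid_move G i (unbraid_move i As) = As"
proof -
  obtain xs a b ys where As: "As = xs @ a # b # ys" and l: "length xs = i"
    using split_tuple[OF assms(1)] .
  show "unbraid_move i (braid_move G i As) = As" "braid_move G i (unbraid_move i As) = As"
    using assms(2) l by (simp_all add: As braid_move_append unbraid_move_append m_assoc inv_cancels)
qed

lemma generate_eqI:
  "A \<subseteq> generate G B \<Longrightarrow> B \<subseteq> generate G A \<Longrightarrow> A \<subseteq> carrier G \<Longrightarrow> B \<subseteq> carrier G \<Longrightarrow>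
    generate G A = generate G B"
  by (simp add: generate_subgroup_incl generate_is_subgroup subset_antisym)

lemma braid_move_invariants:
  assumes "Suc i < length As" "set As \<subseteq> carrier G"
  shows "set (braid_move G i As) \<subseteq> carrier G"
    and "tuple_prod G (braid_move G i As) = tuple_prod G As"
    and "generate G (set (braid_move G i As)) = generate G (set As)"
proof -
  obtain xs a b ys where As: "As = xs @ a # b # ys" and l: "length xs = i"
    using split_tuple[OF assms(1)] .
  have car: "set xs \<subseteq> carrier G" "a \<in> carrier G" "b \<in> carrier G" "set ys \<subseteq> carrier G"
    using assms(2) As by auto
  have B: "braid_move G i As = xs @ (a \<otimes> b \<otimes> inv a) # a # ys"
    using l by (simp add: As braid_move_append)
  show c: "set (braid_move G i As) \<subseteq> carrier G" using car unfolding B by auto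
  have "tuple_prod G ((a \<otimes> b \<otimes> inv a) # a # ys) = tuple_prod G (a # b # ys)"
    using car tuple_prod_closed[of ys] unfolding tuple_prod_def
    by (simp add: m_assoc inv_cancels)
  moreover have "tuple_prod G (xs @ (a \<otimes> b \<otimes> inv a) # a # ys)
      = tuple_prod G xs \<otimes> tuple_prod G ((a \<otimes> b \<otimes> inv a) # a # ys)"
    using car by (intro tuple_prod_append) auto
  moreover have "tuple_prod G (xs @ a # b # ys) = tuple_prod G xs \<otimes> tuple_prod G (a # b # ys)"
    using car by (intro tuple_prod_append) auto
  ultimately show "tuple_prod G (braid_move G i As) = tuple_prod G As"
    unfolding B by (simp add: As)
  let ?B = "insert a (insert (a \<otimes> b \<otimes> inv a) (set xs \<union> set ys))"
  show "generate G (set (braid_move G i As)) = generate G (set As)"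
  proof (rule generate_eqI[OF _ _ c assms(2)])
    have "a \<otimes> b \<otimes> inv a \<in> generate G (set As)"
      by (intro generate.eng generate.incl generate.inv) (auto simp: As)
    then show "set (braid_move G i As) \<subseteq> generate G (set As)"
      unfolding B by (auto simp: As intro: generate.incl)
    have "inv a \<otimes> (a \<otimes> b \<otimes> inv a) \<otimes> a \<in> generate G ?B"
      by (intro generate.eng generate.incl generate.inv) auto
    moreover have "inv a \<otimes> (a \<otimes> b \<otimes> inv a) \<otimes> a = b"
      using car by (simp add: m_assoc inv_cancels)
    moreover have "set (braid_move G i As) = ?B" unfolding B by auto
    ultimately show "set As \<subseteq> generate G (set (braid_move G i As))"
      unfolding As by (auto intro: generate.incl)
  qed
qed

lemma unbraid_move_invariants:
  assumes "Suc i < length As" "set As \<subseteq> carrier G"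
  shows "set (unbraid_move i As) \<subseteq> carrier G"
    and "tuple_prod G (unbraid_move i As) = tuple_prod G As"
    and "generate G (set (unbraid_move i As)) = generate G (set As)"
proof -
  obtain xs a b ys where As: "As = xs @ a # b # ys" and l: "length xs = i"
    using split_tuple[OF assms(1)] .
  show c: "set (unbraid_move i As) \<subseteq> carrier G"
    using assms(2) l by (auto simp: As unbraid_move_append)
  have "Suc i < length (unbraid_move i As)" using assms(1) by (simp add: unbraid_move_def)
  from braid_move_invariants(2,3)[OF this c] unbraid_braid(2)[OF assms]
  show "tuple_prod G (unbraid_move i As) = tuple_prod G As"
    "generate G (set (unbraid_move i As)) = generate G (set As)" by simp_all
qed

lemma braid_move_conj:
  assumes "Suc i < length As" "set As \<subseteq> carrier G" "g \<in> carrier G"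
  shows "braid_move G i (conj_tuple G g As) = conj_tuple G g (braid_move G i As)"
    and "unbraid_move i (conj_tuple G g As) = conj_tuple G g (unbraid_move i As)"
proof -
  obtain xs a b ys where As: "As = xs @ a # b # ys" and l: "length xs = i"
    using split_tuple[OF assms(1)] .
  show "braid_move G i (conj_tuple G g As) = conj_tuple G g (braid_move G i As)"
    "unbraid_move i (conj_tuple G g As) = conj_tuple G g (unbraid_move i As)"
    using assms(2,3) l
    by (simp_all add: As conj_tuple_def braid_move_append unbraid_move_append m_assoc inv_cancels
        inv_mult_group del: map_map)
qed

lemma conj_tuple_one: "set As \<subseteq> carrier G \<Longrightarrow> conj_tuple G \<one> As = As"
  by (induction As) (auto simp: conj_tuple_def)

lemma conj_tuple_mult:
  "set As \<subseteq> carrier G \<Longrightarrow> g \<in> carrier G \<Longrightarrow> h \<in> carrier G \<Longrightarrow>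
    conj_tuple G g (conj_tuple G h As) = conj_tuple G (g \<otimes> h) As"
  by (induction As) (auto simp: conj_tuple_def inv_mult_group m_assoc)

end

interpretation SL2C: group SL2C by (rule group_SL2C)

lemma equiv_conj_rel: "equiv (dense_tuples n) (conj_rel n)"
proof (rule equivI)
  show "conj_rel n \<subseteq> dense_tuples n \<times> dense_tuples n" by (auto simp: conj_rel_def)
  show "refl_on (dense_tuples n) (conj_rel n)"
  proof (rule refl_onI)
    fix As assume "As \<in> dense_tuples n"
    then show "(As, As) \<in> conj_rel n"
      using SL2C.conj_tuple_one[of As]
      by (auto simp: conj_rel_def dense_tuples_def intro!: bexI[of _ "\<one>\<^bsub>SL2C\<^esub>"])
  qed
  show "sym (conj_rel n)"
  proof (rule symI)
    fix As Bs assume *: "(As, Bs) \<in> conj_rel n"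
    then obtain g where g: "g \<in> carrier SL2C" "Bs = conj_tuple SL2C g As"
      and As: "set As \<subseteq> carrier SL2C" by (auto simp: conj_rel_def dense_tuples_def)
    then have "As = conj_tuple SL2C (inv\<^bsub>SL2C\<^esub> g) Bs"
      using SL2C.conj_tuple_mult[of As "inv\<^bsub>SL2C\<^esub> g" g] SL2C.conj_tuple_one[of As] by simp
    moreover have "inv\<^bsub>SL2C\<^esub> g \<in> carrier SL2C" using g by simp
    moreover have "As \<in> dense_tuples n" "Bs \<in> dense_tuples n" using * by (auto simp: conj_rel_def)
    ultimately show "(Bs, As) \<in> conj_rel n" unfolding conj_rel_def by blast
  qed
  show "trans (conj_rel n)"
  proof (rule transI)
    fix As Bs Cs assume *: "(As, Bs) \<in> conj_rel n" "(Bs, Cs) \<in> conj_rel n"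
    then obtain g h where gh: "g \<in> carrier SL2C" "Bs = conj_tuple SL2C g As"
       "h \<in> carrier SL2C" "Cs = conj_tuple SL2C h Bs"
      and As: "set As \<subseteq> carrier SL2C" by (auto simp: conj_rel_def dense_tuples_def)
    then have "Cs = conj_tuple SL2C (h \<otimes>\<^bsub>SL2C\<^esub> g) As"
      using SL2C.conj_tuple_mult[OF As, of h g] by simp
    moreover have "h \<otimes>\<^bsub>SL2C\<^esub> g \<in> carrier SL2C" using gh by simp
    moreover have "As \<in> dense_tuples n" "Cs \<in> dense_tuples n" using * by (auto simp: conj_rel_def)
    ultimately show "(As, Cs) \<in> conj_rel n" unfolding conj_rel_def by blast
  qed
qed

lemma
  assumes "Suc i < n" "As \<in> dense_tuples n"
  shows braid_move_dense_tuples: "braid_move SL2C i As \<in> dense_tuples n"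
    and unbraid_move_dense_tuples: "SL2C.unbraid_move i As \<in> dense_tuples n"
proof -
  have "length As = n" "Suc i < length As" "set As \<subseteq> carrier SL2C"
    using assms by (auto simp: dense_tuples_def)
  note inv = SL2C.braid_move_invariants[OF this(2,3)] SL2C.unbraid_move_invariants[OF this(2,3)]
  have "length (braid_move SL2C i As) = n" "length (SL2C.unbraid_move i As) = n"
    using \<open>length As = n\<close> by (simp_all add: braid_move_def SL2C.unbraid_move_def)
  with inv assms(2) show "braid_move SL2C i As \<in> dense_tuples n" "SL2C.unbraid_move i As \<in> dense_tuples n"
    unfolding dense_tuples_def mem_Collect_eq by metis+
qed

lemma conj_rel_braid_move:
  assumes "Suc i < n" "(As, Bs) \<in> conj_rel n"
  shows "(braid_move SL2C i As, braid_move SL2C i Bs) \<in> conj_rel n"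
    and "(SL2C.unbraid_move i As, SL2C.unbraid_move i Bs) \<in> conj_rel n"
proof -
  from assms(2) obtain g where g: "g \<in> carrier SL2C" "Bs = conj_tuple SL2C g As"
    and T: "As \<in> dense_tuples n" "Bs \<in> dense_tuples n" by (auto simp: conj_rel_def)
  from T have As: "set As \<subseteq> carrier SL2C" "Suc i < length As"
    using assms(1) by (auto simp: dense_tuples_def)
  show "(braid_move SL2C i As, braid_move SL2C i Bs) \<in> conj_rel n"
    using SL2C.braid_move_conj(1)[OF As(2,1) g(1)] g T assms(1) braid_move_dense_tuples
    unfolding conj_rel_def by blast
  show "(SL2C.unbraid_move i As, SL2C.unbraid_move i Bs) \<in> conj_rel n"
    using SL2C.braid_move_conj(2)[OF As(2,1) g(1)] g T assms(1) unbraid_move_dense_tuples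
    unfolding conj_rel_def by blast
qed

lemma braid_move_class:
  assumes "Suc i < n" "As \<in> dense_tuples n"
  shows "braid_move SL2C i ` (conj_rel n `` {As}) = conj_rel n `` {braid_move SL2C i As}"
proof (intro equalityI subsetI)
  fix Bs assume "Bs \<in> braid_move SL2C i ` (conj_rel n `` {As})"
  then show "Bs \<in> conj_rel n `` {braid_move SL2C i As}"
    using conj_rel_braid_move(1)[OF assms(1)] by auto
next
  fix Bs assume "Bs \<in> conj_rel n `` {braid_move SL2C i As}"
  then have *: "(braid_move SL2C i As, Bs) \<in> conj_rel n" by simp
  then have Bs: "Suc i < length Bs" "set Bs \<subseteq> carrier SL2C"
    using assms by (auto simp: conj_rel_def dense_tuples_def)
  have "SL2C.unbraid_move i (braid_move SL2C i As) = As"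
    using assms by (intro SL2C.unbraid_braid) (auto simp: dense_tuples_def)
  then have "(As, SL2C.unbraid_move i Bs) \<in> conj_rel n"
    using conj_rel_braid_move(2)[OF assms(1) *] by simp
  moreover have "Bs = braid_move SL2C i (SL2C.unbraid_move i Bs)"
    using SL2C.unbraid_braid(2)[OF Bs] by simp
  ultimately show "Bs \<in> braid_move SL2C i ` (conj_rel n `` {As})" by blast
qed

lemma sigma_in_BijGroup:
  assumes "Suc i < n"
  shows "sigma n i \<in> carrier (BijGroup (X_space n))"
proof -
  have eq: "sigma n i (conj_rel n `` {As}) = conj_rel n `` {braid_move SL2C i As}"
    if "As \<in> dense_tuples n" for As
    using that braid_move_class[OF assms that] by (simp add: sigma_def X_space_def quotientI)
  have "bij_betw (sigma n i) (X_space n) (X_space n)"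
  proof (rule bij_betw_imageI)
    show "inj_on (sigma n i) (X_space n)"
    proof (rule inj_onI)
      fix c d assume cd: "c \<in> X_space n" "d \<in> X_space n" "sigma n i c = sigma n i d"
      have inj: "inj_on (braid_move SL2C i) (dense_tuples n)"
        using assms SL2C.unbraid_braid(1)
        by (intro inj_on_inverseI[where g = "SL2C.unbraid_move i"]) (auto simp: dense_tuples_def)
      have "c \<subseteq> dense_tuples n" "d \<subseteq> dense_tuples n"
        using cd in_quotient_imp_subset[OF equiv_conj_rel] by (auto simp: X_space_def)
      then show "c = d" using cd inj inj_on_image_eq_iff by (fastforce simp: sigma_def)
    qed
    show "sigma n i ` X_space n = X_space n"
    proof (intro equalityI subsetI)
      fix c assume "c \<in> sigma n i ` X_space n"
      then obtain As where "As \<in> dense_tuples n" "c = sigma n i (conj_rel n `` {As})"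
        unfolding X_space_def quotient_def by blast
      then show "c \<in> X_space n"
        using eq braid_move_dense_tuples[OF assms] by (simp add: X_space_def quotientI)
    next
      fix c assume "c \<in> X_space n"
      then obtain As where As: "As \<in> dense_tuples n" "c = conj_rel n `` {As}"
        unfolding X_space_def quotient_def by blast
      have "braid_move SL2C i (SL2C.unbraid_move i As) = As"
        using As assms by (intro SL2C.unbraid_braid) (auto simp: dense_tuples_def)
      moreover have "SL2C.unbraid_move i As \<in> dense_tuples n"
        using unbraid_move_dense_tuples[OF assms As(1)] .
      ultimately have "c = sigma n i (conj_rel n `` {SL2C.unbraid_move i As})"
        using eq As by simp
      then show "c \<in> sigma n i ` X_space n"
        using \<open>SL2C.unbraid_move i As \<in> dense_tuples n\<close> by (auto simp: X_space_def intro: quotientI)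
    qed
  qed
  then show ?thesis by (auto simp: BijGroup_def Bij_def sigma_def)
qed

lemma
  assumes \<rho>: "\<rho> \<in> hom (pi1_sphere n) SL2C"
  shows monodromy_tuple_carrier: "set (monodromy_tuple n \<rho>) \<subseteq> carrier SL2C"
    and monodromy_tuple_prod: "tuple_prod SL2C (monodromy_tuple n \<rho>) = \<one>\<^bsub>SL2C\<^esub>"
    and monodromy_tuple_generate:
      "generate SL2C (set (monodromy_tuple n \<rho>)) = \<rho> ` carrier (pi1_sphere n)"
proof -
  let ?S = "{..<n}" and ?R = "{sphere_relator n}"
  let ?c = "pres_class ?S ?R"
  interpret P: group "pi1_sphere n" by (simp add: pi1_sphere_def group_presented_group)
  interpret h: group_hom "pi1_sphere n" SL2C \<rho>
    using \<rho> by (simp add: group_hom_def group_hom_axioms_def P.is_group group_SL2C)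
  have car: "carrier (pi1_sphere n) = ?c ` lists (?S \<times> UNIV)"
    and one: "\<one>\<^bsub>pi1_sphere n\<^esub> = ?c []"
    by (auto simp: pi1_sphere_def presented_group_def)
  have mult: "?c v \<otimes>\<^bsub>pi1_sphere n\<^esub> ?c w = ?c (v @ w)"
    if "v \<in> lists (?S \<times> UNIV)" "w \<in> lists (?S \<times> UNIV)" for v w
    using that by (simp add: pi1_sphere_def presented_group_mult)
  have loop: "loop n i \<in> carrier (pi1_sphere n)" if "i < n" for i
    using that by (auto simp: car loop_def)
  show "set (monodromy_tuple n \<rho>) \<subseteq> carrier SL2C"
    using loop h.hom_closed by (auto simp: monodromy_tuple_def)
  have prod: "tuple_prod SL2C (map (\<lambda>i. \<rho> (loop n i)) is) = \<rho> (?c (map (\<lambda>i. (i, True)) is))"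
    if "set is \<subseteq> {..<n}" for "is"
    using that
  proof (induction "is")
    case Nil
    then show ?case using h.hom_one one by (simp add: tuple_prod_def)
  next
    case (Cons j js)
    have w: "[(j, True)] \<in> lists (?S \<times> UNIV)" "map (\<lambda>i. (i, True)) js \<in> lists (?S \<times> UNIV)"
      using Cons.prems by auto
    have "\<rho> (?c (map (\<lambda>i. (i, True)) (j # js)))
        = \<rho> (?c [(j, True)] \<otimes>\<^bsub>pi1_sphere n\<^esub> ?c (map (\<lambda>i. (i, True)) js))"
      using mult[OF w] by simp
    also have "\<dots> = \<rho> (?c [(j, True)]) \<otimes>\<^bsub>SL2C\<^esub> \<rho> (?c (map (\<lambda>i. (i, True)) js))"
      using w by (intro h.hom_mult) (auto simp: car)
    finally show ?case using Cons by (simp add: tuple_prod_def loop_def)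
  qed
  have "pres_eq ?S ?R ([] @ sphere_relator n @ []) ([] @ [])"
    by (intro pres_eq.relator) (auto simp: sphere_relator_def)
  then have "?c (sphere_relator n) = ?c []" using pres_class_eqI by fastforce
  then show "tuple_prod SL2C (monodromy_tuple n \<rho>) = \<one>\<^bsub>SL2C\<^esub>"
    using prod[of "[0..<n]"] h.hom_one one
    by (simp add: monodromy_tuple_def sphere_relator_def atLeast0LessThan)
  have gen: "carrier (pi1_sphere n) = generate (pi1_sphere n) (loop n ` {..<n})"
  proof (intro equalityI subsetI)
    fix x assume "x \<in> carrier (pi1_sphere n)"
    then obtain w where w: "w \<in> lists (?S \<times> UNIV)" "x = ?c w" using car by blast
    have "?c w \<in> generate (pi1_sphere n) (loop n ` {..<n})"
      using w(1)
    proof (induction w)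
      case Nil
      then show ?case using generate.one one by metis
    next
      case (Cons p w)
      obtain s b where p: "p = (s, b)" by force
      have s: "s < n" and wS: "w \<in> lists (?S \<times> UNIV)"
        and IH: "?c w \<in> generate (pi1_sphere n) (loop n ` {..<n})" using Cons p by auto
      have "?c [(s, b)] \<in> generate (pi1_sphere n) (loop n ` {..<n})"
      proof (cases b)
        case True
        then show ?thesis using s by (auto simp: loop_def intro: generate.incl)
      next
        case False
        have "pres_eq ?S ?R ([] @ [(s, False), (s, \<not> False)] @ []) ([] @ [])"
          using s by (intro pres_eq.cancel) auto
        then have "?c [(s, False)] \<otimes>\<^bsub>pi1_sphere n\<^esub> loop n s = \<one>\<^bsub>pi1_sphere n\<^esub>"
          using s pres_class_eqI by (fastforce simp: loop_def one mult)
        then have "inv\<^bsub>pi1_sphere n\<^esub> (loop n s) = ?c [(s, False)]"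
          using s loop by (intro P.inv_equality) (auto simp: car)
        then show ?thesis using False s generate.inv by (metis imageI lessThan_iff)
      qed
      moreover have "?c (p # w) = ?c [(s, b)] \<otimes>\<^bsub>pi1_sphere n\<^esub> ?c w"
        using mult[of "[(s, b)]" w] s wS p by simp
      ultimately show ?case using IH generate.eng by metis
    qed
    with w show "x \<in> generate (pi1_sphere n) (loop n ` {..<n})" by simp
  next
    fix x assume "x \<in> generate (pi1_sphere n) (loop n ` {..<n})"
    then show "x \<in> carrier (pi1_sphere n)"
      using P.generate_in_carrier[of "loop n ` {..<n}"] loop by blast
  qed
  have "set (monodromy_tuple n \<rho>) = \<rho> ` loop n ` {..<n}"
    by (auto simp: monodromy_tuple_def)
  then show "generate SL2C (set (monodromy_tuple n \<rho>)) = \<rho> ` carrier (pi1_sphere n)"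
    using h.generate_img[of "loop n ` {..<n}"] loop gen by auto
qed

lemma rep_class_in_X_space:
  assumes "\<rho> \<in> hom (pi1_sphere n) SL2C" "zariski_dense (\<rho> ` carrier (pi1_sphere n))"
  shows "rep_class n \<rho> \<in> X_space n"
proof -
  have "monodromy_tuple n \<rho> \<in> dense_tuples n"
    using monodromy_tuple_carrier monodromy_tuple_prod monodromy_tuple_generate assms
    unfolding dense_tuples_def by (auto simp: monodromy_tuple_def)
  then show ?thesis by (simp add: rep_class_def X_space_def quotientI)
qed

end

theory Submission
  imports Defs
begin

text \<open>Write the monodromy as a tuple \<open>(A\<^sub>1, \<dots>, A\<^sub>n)\<close> with product 1, on which the braid group acts, and
  let \<open>t\<close> be a member of infinite order. Suppose that \<open>n \<ge> 7\<close> and that only finitely many tuples,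
  up to conjugation, can be reached by braid moves. The proof is elementary: it combines the
  transitivity of commutation on noncentral elements of \<open>SL\<^sub>2\<close> with two consequences of finiteness.

  The twisting argument (\<open>pair_finite_order\<close>). If neighbours \<open>g\<close>, \<open>h\<close> do not commute and two other members do
  not commute either, then \<open>g h\<close> has finite order: otherwise the powers of the twist of \<open>g\<close> and \<open>h\<close> give
  infinitely many classes.

  The mass formula (\<open>mass_formula\<close>). Move \<open>t\<close> past all the other members, once over and once
  under them. For a character \<open>\<kappa>\<close> of the centralizer of \<open>t\<close> that is trivial on the centre, compare the
  two results over all classes, \<open>N\<close> in number. The crossings with a member \<open>v\<close> not commuting with \<open>t\<close> cancel in the
  total, and there remains
  \<open>\<kappa>(t)\<^sup>2\<^sup>N \<cdot> \<Prod> \<kappa>(t v) = \<kappa>(t)\<^sup>(\<^sup>n\<^sup>-\<^sup>1\<^sup>)\<^sup>N\<close>,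
  the product being over the crossings with a commuting \<open>v\<close>.

  If \<open>\<kappa>(t)\<close> is not a root of unity and \<open>n \<ge> 4\<close>, the formula forces \<open>t v\<close> to have infinite order for some
  reachable neighbour \<open>v\<close> that commutes with \<open>t\<close>. Merging \<open>t\<close> and \<open>v\<close> and iterating, one reaches
  a tuple \<open>a, c\<^sub>1, \<dots>, c\<^sub>n\<^sub>-\<^sub>2, b\<close> in which all the \<open>c\<^sub>i\<close> commute with a conjugate of \<open>t\<close>, which is among them
  (\<open>commuting_block\<close>). By Zariski density, \<open>a\<close> moves the common centralizer. Since \<open>n - 2 \<ge> 5\<close>, absorbing the
  surplus leaves five elements \<open>c\<^sub>i\<close>; the proof shows that this is impossible.

  Absorb one more \<open>c\<^sub>i\<close> into each end and merge the ends to \<open>d\<close> and \<open>e\<close>; by the twisting argument, these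
  have finite order. Merging two of the other three yields a four-tuple \<open>d, x, y, e\<close> with \<open>x\<close> and \<open>y\<close>
  commuting, in which, for \<open>x\<close> of infinite order, crossings of \<open>x\<close> with \<open>d\<close> and \<open>e\<close> never contribute
  to the mass formula. The formula is applied to \<open>x\<close> and to \<open>y\<close>, and the same classes are counted in
  both cases.
  If \<open>t\<close> is diagonalisable, it follows that \<open>x y\<close> or \<open>x y\<^sup>-\<^sup>1\<close> has finite order whenever \<open>x\<close> has
  infinite order (\<open>diagonal_pair\<close>), and five eigenvalues cannot satisfy all these relations
  (\<open>five_eigenvalues\<close>). If \<open>t\<close> is parabolic, the translation lengths of \<open>x\<close> and \<open>y\<close>, measured relative
  to \<open>d\<close>, have positive ratios, and in some reachable configuration the ratio of \<open>y\<close> to \<open>x\<close> is at least 1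
  (\<open>parabolic_pair\<close>); with \<open>x\<close> itself a product of two elements, this contradicts the maximality of
  a ratio (\<open>no_three_parabolics\<close>).\<close>

section \<open>Groups in which commutation is transitive\<close>

text \<open>Groups in multiplicative notation, as a type class: membership conditions disappear, and
  \<^class>\<open>inverse\<close> provides the notation for inverses.\<close>

class grp = monoid_mult + inverse +
  assumes left_inv [simp]: "inverse a * a = 1"
begin

lemma left_inv_assoc [simp]: "inverse a * (a * b) = b"
  by (simp flip: mult.assoc)

lemma left_cancel: "a * b = a * c \<longleftrightarrow> b = c"
  by (metis left_inv_assoc)

lemma right_inv [simp]: "a * inverse a = 1"
  by (metis left_cancel left_inv mult.right_neutral mult.assoc mult.left_neutral)

lemma right_inv_assoc [simp]: "a * (inverse a * b) = b"
  by (simp flip: mult.assoc)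

lemma right_cancel: "b * a = c * a \<longleftrightarrow> b = c"
  by (metis mult.assoc mult.right_neutral right_inv)

lemma inv_unique: "a * b = 1 \<Longrightarrow> inverse a = b"
  by (metis left_inv_assoc mult.right_neutral)

lemma inv_inv [simp]: "inverse (inverse a) = a"
  by (simp add: inv_unique)

lemma inv_one [simp]: "inverse 1 = 1"
  by (simp add: inv_unique)

lemma inv_mult: "inverse (a * b) = inverse b * inverse a"
  by (rule inv_unique) (simp add: mult.assoc)

definition commute :: "'a \<Rightarrow> 'a \<Rightarrow> bool" where
  "commute x y \<longleftrightarrow> x * y = y * x"

definition central :: "'a \<Rightarrow> bool" where
  "central z \<longleftrightarrow> (\<forall>x. commute z x)"

definition cj :: "'a \<Rightarrow> 'a \<Rightarrow> 'a" where
  "cj g x = g * x * inverse g"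

definition finite_order :: "'a \<Rightarrow> bool" where
  "finite_order x \<longleftrightarrow> (\<exists>k>0. x ^ k = 1)"

lemma commute_sym: "commute x y \<Longrightarrow> commute y x"
  by (simp add: commute_def)

lemma commute_commute: "commute x y \<longleftrightarrow> commute y x"
  by (auto simp: commute_def)

lemma commute_refl [simp]: "commute x x" by (simp add: commute_def)
lemma commute_one [simp]: "commute x 1" "commute 1 x" by (simp_all add: commute_def)

lemma commute_mult: "commute x y \<Longrightarrow> commute x z \<Longrightarrow> commute x (y * z)"
  by (metis commute_def mult.assoc)

lemma commute_mult': "commute x z \<Longrightarrow> commute y z \<Longrightarrow> commute (x * y) z"
  by (metis commute_def mult.assoc)

lemma commute_inverse: "commute x y \<Longrightarrow> commute x (inverse y)"
  unfolding commute_def by (metis mult.assoc left_inv_assoc mult.right_neutral right_inv)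

lemma commute_inverse': "commute x y \<Longrightarrow> commute (inverse x) y"
  using commute_inverse commute_sym by blast

lemma commute_mult_iff: "commute x (x * y) \<longleftrightarrow> commute x y"
  by (simp add: commute_def mult.assoc left_cancel)

lemma commute_mult_iff': "commute x (y * x) \<longleftrightarrow> commute x y"
  by (metis commute_def mult.assoc right_cancel)

lemma commute_power: "commute x y \<Longrightarrow> commute x (y ^ k)"
  by (induction k) (auto intro: commute_mult)

lemma cj_mult: "cj g (x * y) = cj g x * cj g y" by (simp add: cj_def mult.assoc)
lemma cj_inv: "cj g (inverse x) = inverse (cj g x)" by (simp add: cj_def mult.assoc inv_mult)
lemma cj_one [simp]: "cj g 1 = 1" "cj 1 x = x" by (simp_all add: cj_def)
lemma cj_cj: "cj g (cj h x) = cj (g * h) x" by (simp add: cj_def mult.assoc inv_mult)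
lemma cj_inv_cj [simp]: "cj (inverse g) (cj g x) = x" "cj g (cj (inverse g) x) = x"
  by (simp_all add: cj_cj)
lemma cj_eq_iff [simp]: "cj g x = cj g y \<longleftrightarrow> x = y" by (metis cj_inv_cj(1))
lemma cj_power: "cj g (x ^ k) = cj g x ^ k" by (induction k) (auto simp: cj_mult)
lemma cj_fix: "cj g x = x \<longleftrightarrow> commute g x"
  by (metis cj_def commute_def left_inv mult.assoc mult.right_neutral right_inv)
lemma commute_cj [simp]: "commute (cj g x) (cj g y) \<longleftrightarrow> commute x y"
  by (simp add: commute_def flip: cj_mult)
lemma cj_self: "commute g x \<Longrightarrow> cj g x = x" by (simp add: cj_fix)
lemma cj_of_cj: "cj (cj g x) (cj g y) = cj g (cj x y)"
  by (simp add: cj_def mult.assoc inv_mult)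

lemma central_commute: "central z \<Longrightarrow> commute z x" "central z \<Longrightarrow> commute x z"
  by (auto simp: central_def commute_def)

lemma central_cj [simp]: "central (cj g x) \<longleftrightarrow> central x"
  by (metis central_def cj_inv_cj commute_cj)

lemma central_one [simp]: "central 1" by (simp add: central_def)

lemma finite_order_cj [simp]: "finite_order (cj g x) \<longleftrightarrow> finite_order x"
  by (metis cj_eq_iff cj_one(1) cj_power finite_order_def)

lemma inv_power: "inverse x ^ k = inverse (x ^ k)"
  by (induction k) (simp, simp only: power_Suc2[of "inverse x"] power_Suc[of x] inv_mult)

lemma finite_order_inv [simp]: "finite_order (inverse x) \<longleftrightarrow> finite_order x"
  by (metis finite_order_def inv_power inv_inv inv_one)

lemma power_mult_commute: "commute x y \<Longrightarrow> (x * y) ^ k = x ^ k * y ^ k"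
proof (induction k)
  case (Suc k)
  have "y * x ^ k = x ^ k * y"
    using commute_power[OF commute_sym[OF Suc.prems]] by (simp add: commute_def)
  then have "x * y * (x ^ k * y ^ k) = x * x ^ k * (y * y ^ k)"
    by (metis mult.assoc)
  then show ?case using Suc by simp
qed simp

lemma finite_order_mult:
  assumes "commute x y" "finite_order x" "finite_order y"
  shows "finite_order (x * y)"
proof -
  obtain k l where "k > 0" "x ^ k = 1" "l > 0" "y ^ l = 1"
    using assms(2,3) by (auto simp: finite_order_def)
  then have "x ^ (k * l) = 1" "y ^ (k * l) = 1"
    by (simp add: power_mult, metis mult.commute power_mult power_one)
  then have "(x * y) ^ (k * l) = 1" "k * l > 0"
    using assms(1) \<open>k > 0\<close> \<open>l > 0\<close> by (simp_all add: power_mult_commute)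
  then show ?thesis unfolding finite_order_def by blast
qed

lemma finite_order_power: "k > 0 \<Longrightarrow> finite_order (x ^ k) \<Longrightarrow> finite_order x"
  unfolding finite_order_def by (metis nat_0_less_mult_iff power_mult)

end

text \<open>Commutation is transitive on noncentral elements. This single property of
  \<open>SL\<^sub>2\<close> carries the combinatorial part of the proof: two elements that do not commute have a
  central common centralizer.\<close>

class ct_grp = grp +
  assumes commute_trans: "\<not> central t \<Longrightarrow> commute t x \<Longrightarrow> commute t y \<Longrightarrow> commute x y"
begin

lemma commute_two_central: "commute z x \<Longrightarrow> commute z y \<Longrightarrow> \<not> commute x y \<Longrightarrow> central z"
  using commute_trans by blast

end

section \<open>The group of unimodular 2 by 2 matrices\<close>

text \<open>A type instead of a carrier set: the groups below are type classes, and entries are four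
  scalars rather than vectors of vectors.\<close>

typedef sl2 = "{(a, b, c, d). a * d - b * c = (1 :: complex)}"
  by (rule exI[of _ "(1, 0, 0, 1)"]) simp

setup_lifting type_definition_sl2

lift_definition e11 :: "sl2 \<Rightarrow> complex" is "\<lambda>(a, b, c, d). a" .
lift_definition e12 :: "sl2 \<Rightarrow> complex" is "\<lambda>(a, b, c, d). b" .
lift_definition e21 :: "sl2 \<Rightarrow> complex" is "\<lambda>(a, b, c, d). c" .
lift_definition e22 :: "sl2 \<Rightarrow> complex" is "\<lambda>(a, b, c, d). d" .

lemma det_sl2: "e11 x * e22 x - e12 x * e21 x = 1"
  by transfer auto

lemma sl2_eq_iff: "x = y \<longleftrightarrow> e11 x = e11 y \<and> e12 x = e12 y \<and> e21 x = e21 y \<and> e22 x = e22 y"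
  by transfer auto

instantiation sl2 :: grp
begin

lift_definition one_sl2 :: sl2 is "(1, 0, 0, 1)" by simp

lift_definition times_sl2 :: "sl2 \<Rightarrow> sl2 \<Rightarrow> sl2" is
  "\<lambda>(a, b, c, d) (a', b', c', d'). (a * a' + b * c', a * b' + b * d', c * a' + d * c', c * b' + d * d')"
  by clarsimp algebra

lift_definition inverse_sl2 :: "sl2 \<Rightarrow> sl2" is "\<lambda>(a, b, c, d). (d, - b, - c, a)"
  by (auto simp: algebra_simps)

definition divide_sl2 :: "sl2 \<Rightarrow> sl2 \<Rightarrow> sl2" where "divide_sl2 x y = x * inverse y"

instance
  by standard (transfer; auto simp: algebra_simps)+

end

lemma sl2_entries [simp]:
  "e11 1 = 1" "e12 1 = 0" "e21 1 = 0" "e22 1 = 1"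
  "e11 (x * y) = e11 x * e11 y + e12 x * e21 y"
  "e12 (x * y) = e11 x * e12 y + e12 x * e22 y"
  "e21 (x * y) = e21 x * e11 y + e22 x * e21 y"
  "e22 (x * y) = e21 x * e12 y + e22 x * e22 y"
  "e11 (inverse x) = e22 x" "e12 (inverse x) = - e12 x"
  "e21 (inverse x) = - e21 x" "e22 (inverse x) = e11 x"
  by (transfer; auto)+

text \<open>Quadruples whose determinant is not 1 are sent to the identity.\<close>

lift_definition mk :: "complex \<Rightarrow> complex \<Rightarrow> complex \<Rightarrow> complex \<Rightarrow> sl2" is
  "\<lambda>a b c d. if a * d - b * c = 1 then (a, b, c, d) else (1, 0, 0, 1)" by auto

lemma mk_entries:
  assumes "a * d - b * c = 1"
  shows "e11 (mk a b c d) = a" "e12 (mk a b c d) = b" "e21 (mk a b c d) = c" "e22 (mk a b c d) = d"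
  using assms by (transfer; auto)+

definition tr :: "sl2 \<Rightarrow> complex" where "tr x = e11 x + e22 x"

lemma central_sl2: "central z \<longleftrightarrow> e12 z = 0 \<and> e21 z = 0 \<and> e11 z = e22 z"
proof
  assume z: "central z"
  have "commute z (mk 1 1 0 1)" "commute z (mk 1 0 1 1)"
    using z by (auto simp: central_commute)
  then show "e12 z = 0 \<and> e21 z = 0 \<and> e11 z = e22 z"
    by (auto simp: commute_def sl2_eq_iff mk_entries)
next
  assume "e12 z = 0 \<and> e21 z = 0 \<and> e11 z = e22 z"
  then show "central z" by (simp add: central_def commute_def sl2_eq_iff mult.commute)
qed

lemma central_square: "central z \<Longrightarrow> z * (z::sl2) = 1"
  using det_sl2[of z] by (auto simp: central_sl2 sl2_eq_iff)

lemma central_finite_order: "central (z::sl2) \<Longrightarrow> finite_order z"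
  unfolding finite_order_def using central_square[of z] by (intro exI[of _ 2]) (auto simp: power2_eq_square)

instance sl2 :: ct_grp
proof
  fix t x y :: sl2
  assume t: "\<not> central t" and x: "commute t x" and y: "commute t y"
  have par: "e12 t * e21 x = e12 x * e21 t" "e12 t * (e22 x - e11 x) = e12 x * (e22 t - e11 t)"
    "e21 t * (e22 x - e11 x) = e21 x * (e22 t - e11 t)" if "t * x = x * t" for x
  proof -
    have "e11 (t * x) = e11 (x * t)" "e12 (t * x) = e12 (x * t)" "e21 (t * x) = e21 (x * t)"
      using that by simp_all
    then have *: "e11 t * e11 x + e12 t * e21 x = e11 x * e11 t + e12 x * e21 t"
      "e11 t * e12 x + e12 t * e22 x = e11 x * e12 t + e12 x * e22 t"
      "e21 t * e11 x + e22 t * e21 x = e21 x * e11 t + e22 x * e21 t"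
      by (simp_all only: sl2_entries)
    show "e12 t * e21 x = e12 x * e21 t" using *(1) by (simp only: mult.commute[of "e11 x"]) simp
    show "e12 t * (e22 x - e11 x) = e12 x * (e22 t - e11 t)" using *(2) by algebra
    show "e21 t * (e22 x - e11 x) = e21 x * (e22 t - e11 t)" using *(3) by algebra
  qed
  note cx = par[OF x[unfolded commute_def]] and cy = par[OF y[unfolded commute_def]]
  have multiple: "\<exists>l. b' = l * b \<and> c' = l * c \<and> d' = l * d"
    if "b * c' = b' * c" "b * d' = b' * d" "c * d' = c' * d" "b \<noteq> 0 \<or> c \<noteq> 0 \<or> d \<noteq> 0"
    for b c d b' c' d' :: complex
    using that(4)
  proof (elim disjE)
    assume "b \<noteq> 0" then show ?thesis using that(1,2) by (intro exI[of _ "b' / b"]) (simp add: field_simps)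
  next
    assume "c \<noteq> 0" then show ?thesis using that(1,3) by (intro exI[of _ "c' / c"]) (simp add: field_simps)
  next
    assume "d \<noteq> 0" then show ?thesis using that(2,3) by (intro exI[of _ "d' / d"]) (simp add: field_simps)
  qed
  have nz: "e12 t \<noteq> 0 \<or> e21 t \<noteq> 0 \<or> e22 t - e11 t \<noteq> 0"
    using t by (auto simp: central_sl2)
  obtain l where l: "e12 x = l * e12 t" "e21 x = l * e21 t" "e22 x - e11 x = l * (e22 t - e11 t)"
    using multiple[OF cx nz] by blast
  obtain m where m: "e12 y = m * e12 t" "e21 y = m * e21 t" "e22 y - e11 y = m * (e22 t - e11 t)"
    using multiple[OF cy nz] by blast
  have *: "e12 x * e21 y = e12 y * e21 x" "e12 x * (e22 y - e11 y) = e12 y * (e22 x - e11 x)"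
    "e21 x * (e22 y - e11 y) = e21 y * (e22 x - e11 x)"
    unfolding l m by (simp_all add: mult_ac)
  have "e11 x * e12 y + e12 x * e22 y = e11 y * e12 x + e12 y * e22 x" using *(2) by algebra
  moreover have "e21 x * e11 y + e22 x * e21 y = e21 y * e11 x + e22 y * e21 x" using *(3) by algebra
  moreover have "e21 x * e12 y = e21 y * e12 x" using *(1) by (simp add: mult.commute)
  ultimately show "commute x y" using *(1)
    unfolding commute_def sl2_eq_iff sl2_entries by (simp add: mult.commute)
qed

section \<open>Braid moves on labelled tuples\<close>

text \<open>Tuples are lists of labelled group elements. Braid moves permute the labels along with the
  elements, so a label keeps following one puncture and its conjugacy class.\<close>

definition cjl :: "'g::grp \<Rightarrow> ('i \<times> 'g) list \<Rightarrow> ('i \<times> 'g) list" where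
  "cjl g L = map (\<lambda>(i, x). (i, cj g x)) L"

lemma cjl_simps [simp]:
  "cjl g [] = []" "cjl g ((i, x) # L) = (i, cj g x) # cjl g L"
  "cjl g (L @ M) = cjl g L @ cjl g M" "map fst (cjl g L) = map fst L" "length (cjl g L) = length L"
  by (auto simp: cjl_def)

lemma cjl_cjl: "cjl g (cjl h L) = cjl (g * h) L"
  by (auto simp: cjl_def cj_cj)

lemma cjl_one [simp]: "cjl 1 L = L" by (auto simp: cjl_def)

lemma cjl_inv [simp]: "cjl (inverse g) (cjl g L) = L" "cjl g (cjl (inverse g) L) = L"
  by (simp_all add: cjl_cjl)

definition lprod :: "('i \<times> 'g::grp) list \<Rightarrow> 'g" where
  "lprod L = prod_list (map snd L)"

lemma lprod_simps [simp]:
  "lprod [] = 1" "lprod ((i, x) # L) = x * lprod L" "lprod (L @ M) = lprod L * lprod M"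
  by (simp_all add: lprod_def)

lemma lprod_cjl: "lprod (cjl g L) = cj g (lprod L)"
  by (induction L) (auto simp: cj_mult)

text \<open>The moves \<open>over\<close> and \<open>under\<close> are the generator \<open>\<sigma>\<^sub>i\<close> of the braid group and its inverse.
  Conjugation is included as well, so that a reachable tuple may be normalised at any time.\<close>

inductive reach :: "('i \<times> 'g::grp) list \<Rightarrow> ('i \<times> 'g) list \<Rightarrow> bool" for B where
  start: "reach B B"
| over: "reach B (xs @ (i, g) # (j, h) # ys) \<Longrightarrow> reach B (xs @ (j, cj g h) # (i, g) # ys)"
| under: "reach B (xs @ (i, g) # (j, h) # ys) \<Longrightarrow> reach B (xs @ (j, h) # (i, cj (inverse h) g) # ys)"
| conj: "reach B L \<Longrightarrow> reach B (cjl g L)"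

lemma reach_trans: "reach B C \<Longrightarrow> reach A B \<Longrightarrow> reach A C"
  by (induction rule: reach.induct) (auto intro: reach.intros)

lemma reach_prod:
  assumes "reach B L" "lprod B = 1" shows "lprod L = 1"
  using assms by (induction rule: reach.induct) (auto simp: lprod_cjl cj_def mult.assoc)

lemma reach_labels: "reach B L \<Longrightarrow> mset (map fst L) = mset (map fst B)"
  by (induction rule: reach.induct) (auto simp: add_mset_commute)

lemma reach_distinct: "reach B L \<Longrightarrow> distinct (map fst B) \<Longrightarrow> distinct (map fst L)"
  using reach_labels mset_eq_imp_distinct_iff by blast

lemma reach_length: "reach B L \<Longrightarrow> length L = length B"
  using reach_labels by (metis length_map size_mset)

lemma reach_entry:
  assumes "reach B L" "(i, x) \<in> set L"
  shows "\<exists>g y. (i, y) \<in> set B \<and> x = cj g y"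
  using assms
proof (induction arbitrary: i x rule: reach.induct)
  case start
  then show ?case by (metis cj_one(2))
next
  case (over xs i' g j h ys)
  have "\<exists>g y. (j, y) \<in> set B \<and> cj g' h = cj g y" for g'
    using over.IH[of j h] by (auto simp: cj_cj) (metis cj_cj)
  then show ?case using over by auto
next
  case (under xs i' g j h ys)
  have "\<exists>g' y. (i', y) \<in> set B \<and> cj k g = cj g' y" for k
    using under.IH[of i' g] by (auto simp: cj_cj) (metis cj_cj)
  then show ?case using under by auto
next
  case (conj L g)
  then obtain y where "(i, y) \<in> set L" "x = cj g y" by (auto simp: cjl_def)
  with conj.IH show ?case by (metis cj_cj)
qed

definition all_commute :: "('i \<times> 'g::grp) list \<Rightarrow> bool" where
  "all_commute L \<longleftrightarrow> (\<forall>x\<in>snd ` set L. \<forall>y\<in>snd ` set L. commute x y)"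

lemma all_commute_cjl [simp]: "all_commute (cjl g L) = all_commute L"
  by (auto simp: all_commute_def cjl_def image_image split_def)

lemma all_commute_reach:
  assumes "reach B L" "all_commute L" shows "all_commute B"
  using assms
proof (induction rule: reach.induct)
  case (over xs i g j h ys)
  have "commute g (cj g h)" using over.prems by (auto simp: all_commute_def)
  then have "commute (cj g g) (cj g h)" by (simp add: cj_self del: commute_cj)
  then have "commute g h" unfolding commute_cj .
  then have "cj g h = h" by (simp add: cj_self)
  then show ?case using over by (auto simp: all_commute_def)
next
  case (under xs i g j h ys)
  have "commute h (cj (inverse h) g)" using under.prems by (auto simp: all_commute_def)
  then have "commute (cj h h) (cj h (cj (inverse h) g))" unfolding commute_cj .
  then have "commute h g" by (simp add: cj_self del: commute_cj)
  then have "cj (inverse h) g = g" by (simp add: cj_self commute_inverse')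
  then show ?case using under by (auto simp: all_commute_def)
qed auto

definition finite_orbit :: "('i \<times> 'g::grp) list \<Rightarrow> bool" where
  "finite_orbit B \<longleftrightarrow> (\<exists>S. finite S \<and> (\<forall>L. reach B L \<longrightarrow> (\<exists>M\<in>S. \<exists>g. L = cjl g M)))"

lemma finite_orbit_reach: "finite_orbit B \<Longrightarrow> reach B L \<Longrightarrow> finite_orbit L"
  unfolding finite_orbit_def by (meson reach_trans)

lemma reach_swap:
  assumes "reach B (xs @ (i, g) # (j, h) # ys)" "commute g h"
  shows "reach B (xs @ (j, h) # (i, g) # ys)"
  using over[OF assms(1)] assms(2) by (simp add: cj_self)

text \<open>The square of a braid generator conjugates both elements by their product.\<close>

lemma reach_twist:
  assumes "reach B (xs @ (i, g) # (j, h) # ys)"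
  shows "reach B (xs @ (i, cj (g * h) g) # (j, cj (g * h) h) # ys)"
  using over[OF over[OF assms]] by (simp add: cj_def mult.assoc inv_mult)

lemma reach_twists:
  assumes "reach B (xs @ (i, g) # (j, h) # ys)"
  shows "reach B (xs @ (i, cj ((g * h) ^ k) g) # (j, cj ((g * h) ^ k) h) # ys)"
proof (induction k)
  case (Suc k)
  let ?m = "g * h"
  have e: "cj (?m ^ k) g * cj (?m ^ k) h = ?m"
    by (simp flip: cj_mult add: cj_self commute_commute commute_power)
  show ?case using reach_twist[OF Suc] unfolding e by (simp add: cj_cj)
qed (use assms in simp)

text \<open>Labels locate an element in a tuple, since they are distinct.\<close>

lemma split_unique:
  assumes eq: "us @ (i, x) # vs = xs @ (i, y) # ys" and dist: "distinct (map fst (us @ (i, x) # vs))"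
  shows "us = xs \<and> x = y \<and> vs = ys"
proof -
  have u: "i \<notin> fst ` set us" and v: "i \<notin> fst ` set vs" using dist by auto
  from eq consider zs where "us = xs @ zs" "zs @ (i, x) # vs = (i, y) # ys"
    | zs where "us @ zs = xs" "(i, x) # vs = zs @ (i, y) # ys"
    by (auto simp: append_eq_append_conv2)
  then show ?thesis
  proof cases
    case (1 zs)
    then show ?thesis using u by (cases zs) auto
  next
    case (2 zs)
    then show ?thesis using v by (cases zs) auto
  qed
qed

lemma split_pair_cases:
  assumes eq: "us @ (a, x) # (b, y) # vs = xs @ (i, z) # ys"
    and dist: "distinct (map fst (us @ (a, x) # (b, y) # vs))"
  obtains "a = i" "x = z" "us = xs" "ys = (b, y) # vs"
  | "b = i" "y = z" "xs = us @ [(a, x)]" "ys = vs"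
  | us' where "us = xs @ (i, z) # us'" "ys = us' @ (a, x) # (b, y) # vs"
  | vs' where "vs = vs' @ (i, z) # ys" "xs = us @ (a, x) # (b, y) # vs'"
proof -
  have "(i, z) \<in> set (us @ (a, x) # (b, y) # vs)" unfolding eq by simp
  then consider "a = i" | "b = i" | "(i, z) \<in> set us" | "(i, z) \<in> set vs" by auto
  then show thesis
  proof cases
    case 1
    then have "us @ (i, x) # ((b, y) # vs) = xs @ (i, z) # ys" using eq by simp
    from split_unique[OF this] dist 1 show thesis by (intro that(1)) auto
  next
    case 2
    then have "(us @ [(a, x)]) @ (i, y) # vs = xs @ (i, z) # ys" using eq by simp
    from split_unique[OF this] dist 2 show thesis by (intro that(2)) auto
  next
    case 3
    then obtain us1 us2 where us: "us = us1 @ (i, z) # us2" by (meson split_list)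
    then have "us1 @ (i, z) # (us2 @ (a, x) # (b, y) # vs) = xs @ (i, z) # ys" using eq by simp
    from split_unique[OF this] dist us show thesis by (intro that(3)[of us2]) auto
  next
    case 4
    then obtain us1 us2 where us: "vs = us1 @ (i, z) # us2" by (meson split_list)
    then have "(us @ (a, x) # (b, y) # us1) @ (i, z) # us2 = xs @ (i, z) # ys" using eq by simp
    from split_unique[OF this] dist us show thesis by (intro that(4)[of us1]) auto
  qed
qed

text \<open>Two neighbouring elements can be replaced by their product: a strand of the merged tuple is
  a ribbon of two parallel strands, and every move of the ribbon is a composition of moves of its
  strands.\<close>

lemma reach_merge:
  assumes "reach (p @ (i, g * h) # q) L" and dist: "distinct (map fst (p @ (i, g) # (j, h) # q))"
  shows "\<exists>xs ys k. L = xs @ (i, cj k (g * h)) # ys \<and>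
    reach (p @ (i, g) # (j, h) # q) (xs @ (i, cj k g) # (j, cj k h) # ys)"
  using assms(1)
proof (induction rule: reach.induct)
  case start
  show ?case by (rule exI[of _ p], rule exI[of _ q], rule exI[of _ 1]) (auto intro: reach.start)
next
  case (over us a x b y vs)
  let ?B = "p @ (i, g) # (j, h) # q"
  obtain xs ys k where eq: "us @ (a, x) # (b, y) # vs = xs @ (i, cj k (g * h)) # ys"
    and r: "reach ?B (xs @ (i, cj k g) # (j, cj k h) # ys)" using over.IH by blast
  have "distinct (map fst (us @ (a, x) # (b, y) # vs))"
    using reach_distinct[OF over.hyps] dist by auto
  from eq this show ?case
  proof (cases rule: split_pair_cases)
    case 1
    have "reach ?B (xs @ (i, cj k g) # (b, cj (cj k h) y) # (j, cj k h) # vs)"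
      using reach.over[of ?B "xs @ [(i, cj k g)]"] r 1 by auto
    then have "reach ?B (xs @ (b, cj (cj k g) (cj (cj k h) y)) # (i, cj k g) # (j, cj k h) # vs)"
      by (rule reach.over)
    then have "reach ?B ((xs @ [(b, cj x y)]) @ (i, cj k g) # (j, cj k h) # vs)"
      using 1 by (simp add: cj_cj cj_mult)
    moreover have "us @ (b, cj x y) # (a, x) # vs = (xs @ [(b, cj x y)]) @ (i, cj k (g * h)) # vs"
      using 1 by simp
    ultimately show ?thesis by blast
  next
    case 2
    have "reach ?B (us @ (i, cj x (cj k g)) # (a, x) # (j, cj k h) # vs)"
      using reach.over[of ?B us a x i] r 2 by auto
    then have "reach ?B (us @ (i, cj x (cj k g)) # (j, cj x (cj k h)) # (a, x) # vs)"
      using reach.over[of ?B "us @ [(i, cj x (cj k g))]" a x j] by auto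
    then have "reach ?B (us @ (i, cj (x * k) g) # (j, cj (x * k) h) # (a, x) # vs)"
      by (simp add: cj_cj)
    moreover have "us @ (b, cj x y) # (a, x) # vs = us @ (i, cj (x * k) (g * h)) # (a, x) # vs"
      using 2 by (simp add: cj_cj)
    ultimately show ?thesis by blast
  next
    case (3 us')
    have "reach ?B ((xs @ (i, cj k g) # (j, cj k h) # us') @ (b, cj x y) # (a, x) # vs)"
      using r 3 by (intro reach.over) auto
    then show ?thesis using 3 by auto
  next
    case (4 vs')
    have "reach ?B (us @ (b, cj x y) # (a, x) # (vs' @ (i, cj k g) # (j, cj k h) # ys))"
      using r 4 by (intro reach.over) auto
    then have "reach ?B ((us @ (b, cj x y) # (a, x) # vs') @ (i, cj k g) # (j, cj k h) # ys)"
      by simp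
    moreover have "us @ (b, cj x y) # (a, x) # vs = (us @ (b, cj x y) # (a, x) # vs') @ (i, cj k (g * h)) # ys"
      using 4 by simp
    ultimately show ?thesis by blast
  qed
next
  case (under us a x b y vs)
  let ?B = "p @ (i, g) # (j, h) # q"
  obtain xs ys k where eq: "us @ (a, x) # (b, y) # vs = xs @ (i, cj k (g * h)) # ys"
    and r: "reach ?B (xs @ (i, cj k g) # (j, cj k h) # ys)" using under.IH by blast
  have "distinct (map fst (us @ (a, x) # (b, y) # vs))"
    using reach_distinct[OF under.hyps] dist by auto
  from eq this show ?case
  proof (cases rule: split_pair_cases)
    case 1
    have "reach ?B (xs @ (i, cj k g) # (b, y) # (j, cj (inverse y) (cj k h)) # vs)"
      using reach.under[of ?B "xs @ [(i, cj k g)]"] r 1 by auto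
    then have "reach ?B (xs @ (b, y) # (i, cj (inverse y) (cj k g)) # (j, cj (inverse y) (cj k h)) # vs)"
      by (rule reach.under)
    then have "reach ?B ((xs @ [(b, y)]) @ (i, cj (inverse y * k) g) # (j, cj (inverse y * k) h) # vs)"
      by (simp add: cj_cj)
    moreover have "us @ (b, y) # (a, cj (inverse y) x) # vs
        = (xs @ [(b, y)]) @ (i, cj (inverse y * k) (g * h)) # vs"
      using 1 by (simp add: cj_cj)
    ultimately show ?thesis by blast
  next
    case 2
    have "reach ?B (us @ (i, cj k g) # (a, cj (inverse (cj k g)) x) # (j, cj k h) # vs)"
      using reach.under[of ?B us a x i] r 2 by auto
    then have "reach ?B (us @ (i, cj k g) # (j, cj k h) # (a, cj (inverse (cj k h)) (cj (inverse (cj k g)) x)) # vs)"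
      using reach.under[of ?B "us @ [(i, cj k g)]" a _ j] by auto
    then have "reach ?B (us @ (i, cj k g) # (j, cj k h) # (a, cj (inverse y) x) # vs)"
      using 2 by (simp add: cj_cj cj_mult inv_mult)
    moreover have "us @ (b, y) # (a, cj (inverse y) x) # vs = us @ (i, cj k (g * h)) # (a, cj (inverse y) x) # vs"
      using 2 by simp
    ultimately show ?thesis by blast
  next
    case (3 us')
    have "reach ?B ((xs @ (i, cj k g) # (j, cj k h) # us') @ (b, y) # (a, cj (inverse y) x) # vs)"
      using r 3 by (intro reach.under) auto
    then show ?thesis using 3 by auto
  next
    case (4 vs')
    have "reach ?B (us @ (b, y) # (a, cj (inverse y) x) # (vs' @ (i, cj k g) # (j, cj k h) # ys))"
      using r 4 by (intro reach.under) auto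
    then have "reach ?B ((us @ (b, y) # (a, cj (inverse y) x) # vs') @ (i, cj k g) # (j, cj k h) # ys)"
      by simp
    moreover have "us @ (b, y) # (a, cj (inverse y) x) # vs
        = (us @ (b, y) # (a, cj (inverse y) x) # vs') @ (i, cj k (g * h)) # ys"
      using 4 by simp
    ultimately show ?thesis by blast
  qed
next
  case (conj L c)
  then obtain xs ys k where "L = xs @ (i, cj k (g * h)) # ys"
    and r: "reach (p @ (i, g) # (j, h) # q) (xs @ (i, cj k g) # (j, cj k h) # ys)" by blast
  moreover from reach.conj[OF r, of c]
  have "reach (p @ (i, g) # (j, h) # q) (cjl c xs @ (i, cj (c * k) g) # (j, cj (c * k) h) # cjl c ys)"
    by (simp add: cj_cj)
  moreover have "cjl c L = cjl c xs @ (i, cj (c * k) (g * h)) # cjl c ys"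
    using calculation(1) by (simp add: cj_cj)
  ultimately show ?case by blast
qed

text \<open>A class of merged tuples is determined by a class of the original tuple and the position
  of the ribbon.\<close>

lemma finite_orbit_merge:
  assumes fin: "finite_orbit (p @ (i, g) # (j, h) # q)"
    and dist: "distinct (map fst (p @ (i, g) # (j, h) # q))"
  shows "finite_orbit (p @ (i, g * h) # q)"
proof -
  let ?B = "p @ (i, g) # (j, h) # q"
  obtain S where S: "finite S" "\<And>L. reach ?B L \<Longrightarrow> \<exists>M\<in>S. \<exists>g. L = cjl g M"
    using fin unfolding finite_orbit_def by blast
  let ?m = "\<lambda>n M. take n M @ (i, snd (M ! n) * snd (M ! Suc n)) # drop (Suc (Suc n)) M"
  let ?S = "(\<lambda>(n, M). ?m n M) ` ({..length ?B} \<times> S)"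
  have "\<exists>N\<in>?S. \<exists>c. L = cjl c N" if L: "reach (p @ (i, g * h) # q) L" for L
  proof -
    obtain xs ys k where L': "L = xs @ (i, cj k (g * h)) # ys"
      and r: "reach ?B (xs @ (i, cj k g) # (j, cj k h) # ys)"
      using reach_merge[OF L dist] by blast
    obtain M c where M: "M \<in> S" "xs @ (i, cj k g) # (j, cj k h) # ys = cjl c M" using S(2)[OF r] by blast
    have "M = cjl (inverse c) (xs @ (i, cj k g) # (j, cj k h) # ys)" unfolding M(2) by simp
    then have "?m (length xs) M = cjl (inverse c) L"
      unfolding L' by (simp add: nth_append cj_mult)
    then have "L = cjl c (?m (length xs) M)" by simp
    moreover have "length xs \<le> length ?B" using reach_length[OF r] by simp
    ultimately show ?thesis using M(1) by force
  qed
  moreover have "finite ?S" using S(1) by simp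
  ultimately show ?thesis unfolding finite_orbit_def by blast
qed

section \<open>Orbit representatives and weights\<close>

text \<open>Configurations are counted up to conjugation by the centralizer \<open>Z\<close> of a fixed element. The
  carrier \<open>Z\<close> is a subset of the ambient type, but \<open>act\<close> is an action of the whole type, which
  holds for conjugation and saves side conditions.\<close>

locale action =
  fixes Z :: "'g::grp set" and act :: "'g \<Rightarrow> 'x \<Rightarrow> 'x"
  assumes one_in: "1 \<in> Z"
    and mult_in: "z \<in> Z \<Longrightarrow> w \<in> Z \<Longrightarrow> z * w \<in> Z"
    and inverse_in: "z \<in> Z \<Longrightarrow> inverse z \<in> Z"
    and act_one [simp]: "act 1 x = x"
    and act_mult: "act (z * w) x = act z (act w x)"
begin

lemma act_inverse [simp]: "act (inverse z) (act z x) = x" "act z (act (inverse z) x) = x"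
  by (simp_all flip: act_mult)

definition rel :: "'x \<Rightarrow> 'x \<Rightarrow> bool" where
  "rel x y \<longleftrightarrow> (\<exists>z\<in>Z. y = act z x)"

lemma rel_refl [simp]: "rel x x"
  using one_in act_one[of x] unfolding rel_def by metis

lemma rel_sym: "rel x y \<Longrightarrow> rel y x"
  using inverse_in unfolding rel_def by (metis act_inverse(1))

lemma rel_trans: "rel x y \<Longrightarrow> rel y z \<Longrightarrow> rel x z"
  using mult_in unfolding rel_def by (metis act_mult)

definition transversal :: "'x set \<Rightarrow> 'x set \<Rightarrow> bool" where
  "transversal S R \<longleftrightarrow> R \<subseteq> S \<and> finite R \<and> (\<forall>x\<in>S. \<exists>!r. r \<in> R \<and> rel r x)"

lemma transversal_exists:
  assumes "finite K" "\<And>x. x \<in> S \<Longrightarrow> \<exists>k\<in>K. \<Phi> k x"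
    and "\<And>k x y. x \<in> S \<Longrightarrow> y \<in> S \<Longrightarrow> \<Phi> k x \<Longrightarrow> \<Phi> k y \<Longrightarrow> rel x y"
  shows "\<exists>R. transversal S R"
proof -
  define rep where "rep x = (SOME y. y \<in> S \<and> rel x y)" for x
  have rep: "rep x \<in> S" "rel x (rep x)" if "x \<in> S" for x
    using someI[of "\<lambda>y. y \<in> S \<and> rel x y" x] that unfolding rep_def by auto
  have eq: "rep x = rep y" if "rel x y" for x y
  proof -
    have "rel x = rel y" using that rel_sym rel_trans by blast
    then show ?thesis unfolding rep_def by simp
  qed
  have "rep ` S \<subseteq> (\<lambda>k. rep (SOME x. x \<in> S \<and> \<Phi> k x)) ` K"
  proof
    fix r assume "r \<in> rep ` S"
    then obtain x where x: "x \<in> S" "r = rep x" by blast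
    obtain k where k: "k \<in> K" "\<Phi> k x" using assms(2) x(1) by blast
    let ?y = "SOME x. x \<in> S \<and> \<Phi> k x"
    have "?y \<in> S \<and> \<Phi> k ?y" using someI[of "\<lambda>x. x \<in> S \<and> \<Phi> k x" x] x(1) k(2) by blast
    then have "rel x ?y" using assms(3)[of x ?y k] x(1) k(2) by simp
    then have "rep x = rep ?y" by (rule eq)
    then show "r \<in> (\<lambda>k. rep (SOME x. x \<in> S \<and> \<Phi> k x)) ` K" using k(1) x(2) by blast
  qed
  then have "finite (rep ` S)" using assms(1) finite_surj by blast
  moreover have "rep ` S \<subseteq> S" using rep by blast
  moreover have "\<exists>!r. r \<in> rep ` S \<and> rel r x" if x: "x \<in> S" for x
  proof (rule ex1I[of _ "rep x"])
    show "rep x \<in> rep ` S \<and> rel (rep x) x" using rep x rel_sym by blast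
    fix r assume r: "r \<in> rep ` S \<and> rel r x"
    then obtain y where "y \<in> S" "r = rep y" by blast
    then have "rel y x" using r rep(2)[of y] rel_trans[of y r x] by simp
    then show "r = rep x" using eq[of y x] \<open>r = rep y\<close> by simp
  qed
  ultimately have "transversal S (rep ` S)" unfolding transversal_def by simp
  then show ?thesis by (rule exI)
qed

lemma transversal_bij:
  assumes R: "transversal S R" and R': "transversal S' R'"
    and f: "\<And>x. x \<in> S \<Longrightarrow> f x \<in> S'"
    and rel: "\<And>x y. x \<in> S \<Longrightarrow> y \<in> S \<Longrightarrow> rel (f x) (f y) \<longleftrightarrow> rel x y"
    and surj: "\<And>y. y \<in> S' \<Longrightarrow> \<exists>x\<in>S. rel (f x) y"
  obtains b where "bij_betw b R R'" "\<And>x. x \<in> R \<Longrightarrow> rel (b x) (f x)"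
proof
  define b where "b x = (THE r. r \<in> R' \<and> rel r (f x))" for x
  have b: "b x \<in> R'" "rel (b x) (f x)" if "x \<in> R" for x
    using theI'[of "\<lambda>r. r \<in> R' \<and> rel r (f x)"] that R R' f unfolding b_def transversal_def by blast+
  then show "\<And>x. x \<in> R \<Longrightarrow> rel (b x) (f x)" by blast
  have uniq: "r = r'" if "r \<in> R" "r' \<in> R" "rel r r'" for r r'
    using R that unfolding transversal_def by (metis rel_refl rel_sym subsetD)
  have uniq': "r = r'" if "r \<in> R'" "r' \<in> R'" "rel r r'" for r r'
    using R' that unfolding transversal_def by (metis rel_refl rel_sym subsetD)
  show "bij_betw b R R'"
  proof (rule bij_betw_imageI)
    show "inj_on b R"
    proof (rule inj_onI)
      fix x y assume x: "x \<in> R" and y: "y \<in> R" and "b x = b y"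
      then have "rel (f x) (f y)" using b rel_sym rel_trans by metis
      moreover have "x \<in> S" "y \<in> S" using R x y unfolding transversal_def by auto
      ultimately show "x = y" using rel[of x y] uniq[OF x y] by simp
    qed
    show "b ` R = R'"
    proof (intro equalityI subsetI)
      fix y assume y: "y \<in> R'"
      then have "y \<in> S'" using R' unfolding transversal_def by blast
      then obtain x where x: "x \<in> S" "rel (f x) y" using surj by blast
      then obtain r where r: "r \<in> R" "rel r x" using R unfolding transversal_def by metis
      then have "r \<in> S" using R unfolding transversal_def by blast
      then have "rel (f r) (f x)" using rel[of r x] r x by simp
      then have "rel (b r) y" using b(2)[OF r(1)] x(2) rel_trans by metis
      then have "b r = y" using uniq'[OF b(1)[OF r(1)] y] by simp
      then show "y \<in> b ` R" using r(1) by blast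
    qed (use b in auto)
  qed
qed

text \<open>A map that is bijective on orbits turns a product over representatives into a product over
  representatives, if the factors are constant on orbits.\<close>

lemma prod_reindex:
  assumes R: "transversal S R" and R': "transversal S' R'"
    and f: "\<And>x. x \<in> S \<Longrightarrow> f x \<in> S'"
    and rel: "\<And>x y. x \<in> S \<Longrightarrow> y \<in> S \<Longrightarrow> rel (f x) (f y) \<longleftrightarrow> rel x y"
    and surj: "\<And>y. y \<in> S' \<Longrightarrow> \<exists>x\<in>S. rel (f x) y"
    and F: "\<And>x z. x \<in> S' \<Longrightarrow> z \<in> Z \<Longrightarrow> F (act z x) = F x"
  shows "(\<Prod>x\<in>R. F (f x)) = (\<Prod>x\<in>R'. F x :: 'c::comm_monoid_mult)" "card R = card R'"
proof -
  obtain b where b: "bij_betw b R R'" "\<And>x. x \<in> R \<Longrightarrow> rel (b x) (f x)"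
    using transversal_bij[OF R R' f rel surj] by blast
  have "F (f x) = F (b x)" if x: "x \<in> R" for x
  proof -
    have "b x \<in> S'" using b(1) x R' unfolding transversal_def bij_betw_def by blast
    then show ?thesis using b(2)[OF x] F unfolding rel_def by metis
  qed
  then have "(\<Prod>x\<in>R. F (f x)) = (\<Prod>x\<in>R. F (b x))" by simp
  also have "\<dots> = (\<Prod>x\<in>R'. F x)" by (rule prod.reindex_bij_betw[OF b(1)])
  finally show "(\<Prod>x\<in>R. F (f x)) = (\<Prod>x\<in>R'. F x)" .
  show "card R = card R'" using bij_betw_same_card[OF b(1)] .
qed

text \<open>A weight trivialises the character \<open>\<kappa>\<close> on a set of configurations. It exists if \<open>\<kappa>\<close> is
  trivial on stabilizers.\<close>

definition weight :: "('g \<Rightarrow> complex) \<Rightarrow> 'x set \<Rightarrow> ('x \<Rightarrow> complex) \<Rightarrow> bool" where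
  "weight \<kappa> S m \<longleftrightarrow> (\<forall>x\<in>S. m x \<noteq> 0 \<and> (\<forall>z\<in>Z. m (act z x) = \<kappa> z * m x))"

lemma weight_exists:
  assumes \<kappa>: "\<And>z w. z \<in> Z \<Longrightarrow> w \<in> Z \<Longrightarrow> \<kappa> (z * w) = \<kappa> z * \<kappa> w" "\<And>z. z \<in> Z \<Longrightarrow> \<kappa> z \<noteq> 0"
    and stab: "\<And>x z. x \<in> S \<Longrightarrow> z \<in> Z \<Longrightarrow> act z x = x \<Longrightarrow> \<kappa> z = 1"
    and closed: "\<And>x z. x \<in> S \<Longrightarrow> z \<in> Z \<Longrightarrow> act z x \<in> S"
  shows "\<exists>m. weight \<kappa> S m"
proof -
  define rep where "rep x = (SOME y. rel y x)" for x
  have rep: "rel (rep x) x" for x unfolding rep_def by (rule someI[of _ x]) simp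
  \<comment> \<open>The weight is \<open>\<kappa>\<close> of an element that carries the chosen representative of the orbit to \<open>x\<close>.\<close>
  define tw where "tw x = (SOME z. z \<in> Z \<and> x = act z (rep x))" for x
  have tw: "tw x \<in> Z" "act (tw x) (rep x) = x" for x
  proof -
    have "\<exists>z. z \<in> Z \<and> x = act z (rep x)" using rep[of x] unfolding rel_def by blast
    from someI_ex[OF this] show "tw x \<in> Z" "act (tw x) (rep x) = x" unfolding tw_def by simp_all
  qed
  have "\<kappa> (tw (act z x)) = \<kappa> z * \<kappa> (tw x)" if x: "x \<in> S" and z: "z \<in> Z" for x z
  proof -
    let ?y = "act z x"
    have "rel x ?y" using z unfolding rel_def by blast
    then have "(\<lambda>y. rel y x) = (\<lambda>y. rel y ?y)" using rel_sym rel_trans by blast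
    then have r: "rep ?y = rep x" unfolding rep_def by simp
    let ?w = "inverse (tw ?y) * (z * tw x)"
    have w: "?w \<in> Z" using tw z mult_in inverse_in by simp
    have "act (z * tw x) (rep x) = ?y" by (simp add: act_mult tw)
    moreover have "act (tw ?y) (rep x) = ?y" using tw(2)[of ?y] r by simp
    ultimately have "act (inverse (tw ?y)) (act (z * tw x) (rep x)) = rep x"
      using act_inverse(1)[of "tw ?y" "rep x"] by simp
    then have "act ?w (rep x) = rep x" by (simp only: act_mult[of "inverse (tw ?y)"])
    moreover have "rep x \<in> S"
    proof -
      have "rep x = act (inverse (tw x)) x" using tw(2)[of x] act_inverse(1) by metis
      then show ?thesis using closed x tw(1) inverse_in by simp
    qed
    ultimately have "\<kappa> ?w = 1" using stab w by blast
    moreover have "tw ?y * ?w = z * tw x" by simp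
    ultimately have "\<kappa> (tw ?y) = \<kappa> (z * tw x)" using \<kappa>(1)[of "tw ?y" ?w] tw(1) w by simp
    then show ?thesis using \<kappa>(1) z tw(1) by simp
  qed
  then have "weight \<kappa> S (\<lambda>x. \<kappa> (tw x))" unfolding weight_def using \<kappa>(2) tw(1) by blast
  then show ?thesis by blast
qed

end

section \<open>The mass formula\<close>

lemma cjl_fix: "cjl z L = L \<longleftrightarrow> (\<forall>y\<in>snd ` set L. commute z y)"
  by (induction L) (auto simp: cj_fix)

text \<open>Configurations in which the element labelled \<open>T\<close> equals \<open>t\<close> exactly, and not merely up to
  conjugation, are called framed. They still admit conjugation by the centralizer of \<open>t\<close>, on
  which the character \<open>\<kappa>\<close> lives.\<close>

locale braid_frame =
  fixes B :: "('i \<times> 'g::ct_grp) list" and T :: 'i and t :: 'g and \<kappa> :: "'g \<Rightarrow> complex"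
  assumes fin: "finite_orbit B" and prod_one: "lprod B = 1"
    and not_comm: "\<not> all_commute B"
    and char_mult: "commute z t \<Longrightarrow> commute w t \<Longrightarrow> \<kappa> (z * w) = \<kappa> z * \<kappa> w"
    and char_central: "central z \<Longrightarrow> \<kappa> z = 1"
begin

definition Z where "Z = {z. commute z t}"

text \<open>A framed configuration is the pair of lists to the left and to the right of \<open>t\<close>.\<close>

definition pc :: "'g \<Rightarrow> ('i \<times> 'g) list \<times> ('i \<times> 'g) list \<Rightarrow> ('i \<times> 'g) list \<times> ('i \<times> 'g) list" where
  "pc z x = (cjl z (fst x), cjl z (snd x))"

sublocale P: action Z pc
  by standard (auto simp: Z_def pc_def cjl_cjl intro: commute_mult' commute_inverse')

sublocale G: action Z cj
  by standard (auto simp: Z_def cj_cj intro: commute_mult' commute_inverse')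

lemma char_nz: "z \<in> Z \<Longrightarrow> \<kappa> z \<noteq> 0"
  using char_mult[of z "inverse z"] char_central[of 1] by (auto simp: Z_def commute_inverse')

definition S :: "'i list \<Rightarrow> 'i list \<Rightarrow> (('i \<times> 'g) list \<times> ('i \<times> 'g) list) set" where
  "S p q = {(xs, ys). map fst xs = p \<and> map fst ys = q \<and> reach B (xs @ (T, t) # ys)}"

lemma S_pc: "x \<in> S p q \<Longrightarrow> z \<in> Z \<Longrightarrow> pc z x \<in> S p q"
proof -
  assume x: "x \<in> S p q" and z: "z \<in> Z"
  obtain xs ys where xy: "x = (xs, ys)" by force
  have "reach B (cjl z (xs @ (T, t) # ys))" using x unfolding xy S_def by (intro reach.conj) simp
  then show "pc z x \<in> S p q" using x z unfolding xy by (simp add: S_def pc_def Z_def cj_self)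
qed

text \<open>An element that fixes the configuration commutes with all its members. These do not all
  commute with each other, so the element is central.\<close>

lemma stabilizer_central:
  assumes "x \<in> S p q" "pc z x = x" "z \<in> Z" shows "central z"
proof (rule ccontr)
  assume z: "\<not> central z"
  obtain xs ys where x: "x = (xs, ys)" by force
  let ?L = "xs @ (T, t) # ys"
  have L: "reach B ?L" using assms(1) x by (simp add: S_def)
  have "cjl z ?L = ?L" using assms(2,3) x by (simp add: pc_def Z_def cj_self)
  then have "commute z y" if "y \<in> snd ` set ?L" for y using that unfolding cjl_fix by blast
  then have "all_commute ?L" unfolding all_commute_def using commute_trans[OF z] by blast
  then show False using all_commute_reach[OF L] not_comm by blast
qed

lemma transversal_S: "\<exists>R. P.transversal (S p q) R"
proof -
  obtain K where K: "finite K" "\<And>L. reach B L \<Longrightarrow> \<exists>M\<in>K. \<exists>g. L = cjl g M"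
    using fin unfolding finite_orbit_def by blast
  let ?\<Phi> = "\<lambda>M x. \<exists>g. fst x @ (T, t) # snd x = cjl g M"
  show ?thesis
  proof (rule P.transversal_exists[of K _ ?\<Phi>])
    fix M x y assume x: "x \<in> S p q" and y: "y \<in> S p q" and \<Phi>: "?\<Phi> M x" "?\<Phi> M y"
    then obtain g h where g: "fst x @ (T, t) # snd x = cjl g M" and h: "fst y @ (T, t) # snd y = cjl h M"
      by blast
    let ?z = "h * inverse g"
    have "M = cjl (inverse g) (fst x @ (T, t) # snd x)" unfolding g by simp
    then have eq: "fst y @ (T, t) # snd y = cjl ?z (fst x) @ (T, cj ?z t) # cjl ?z (snd x)"
      using h by (simp only: cjl_cjl flip: cjl_simps)
    have "map fst (fst x) = p" "map fst (fst y) = p" using x y by (auto simp: S_def)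
    then have "length (fst y) = length (cjl ?z (fst x))" by (metis length_map cjl_simps(5))
    with eq have "fst y = cjl ?z (fst x)" "t = cj ?z t" "snd y = cjl ?z (snd x)" by simp_all
    then have "y = pc ?z x" "?z \<in> Z"
      by (simp_all add: pc_def Z_def cj_fix[symmetric]) (metis prod.collapse)
    then show "P.rel x y" unfolding P.rel_def by blast
  next
    fix x assume "x \<in> S p q"
    then have "reach B (fst x @ (T, t) # snd x)" by (auto simp: S_def)
    then show "\<exists>M\<in>K. ?\<Phi> M x" by (rule K(2))
  qed (rule K(1))
qed

definition R where "R p q = (SOME R. P.transversal (S p q) R)"

lemma R: "P.transversal (S p q) (R p q)"
  unfolding R_def using someI_ex[OF transversal_S] .

end

lemma reach_untwist:
  assumes "reach B (xs @ (i, g) # (j, h) # ys)"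
  shows "reach B (xs @ (i, cj (inverse (g * h)) g) # (j, cj (inverse (g * h)) h) # ys)"
  using under[OF under[OF assms]] by (simp add: cj_def mult.assoc inv_mult)

context braid_frame
begin

lemma t_in_Z: "t \<in> Z" by (simp add: Z_def)

lemma mem_S: "(xs, ys) \<in> S p q \<longleftrightarrow> map fst xs = p \<and> map fst ys = q \<and> reach B (xs @ (T, t) # ys)"
  by (simp add: S_def)

lemma S_Cons: "x \<in> S p (V # q) \<Longrightarrow> \<exists>xs v ys. x = (xs, (V, v) # ys)"
  by (force simp: S_def)

text \<open>The element \<open>t\<close> and its right neighbour \<open>v\<close> can change places in two ways. Over:
  \<open>v\<close> becomes \<open>t v t\<^sup>-\<^sup>1\<close> and \<open>t\<close> stays. Under: \<open>t\<close> becomes \<open>v\<^sup>-\<^sup>1 t v\<close>, and conjugating everything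
  by \<open>v\<close> restores the frame. The third map is the full twist of \<open>t\<close> and \<open>v\<close>, conjugated back so
  that these two stay fixed and all other members are moved by \<open>(t v)\<^sup>-\<^sup>1\<close> instead.\<close>

definition over_next where
  "over_next x = (fst x @ [(fst (hd (snd x)), cj t (snd (hd (snd x))))], tl (snd x))"

definition under_next where
  "under_next x = (let v = snd (hd (snd x)) in (cjl v (fst x) @ [hd (snd x)], cjl v (tl (snd x))))"

definition next_twist where
  "next_twist x = (let c = inverse (t * snd (hd (snd x))) in (cjl c (fst x), hd (snd x) # cjl c (tl (snd x))))"

lemma steps [simp]:
  "over_next (xs, (V, v) # ys) = (xs @ [(V, cj t v)], ys)"
  "under_next (xs, (V, v) # ys) = (cjl v xs @ [(V, v)], cjl v ys)"
  "next_twist (xs, (V, v) # ys) = (cjl (inverse (t * v)) xs, (V, v) # cjl (inverse (t * v)) ys)"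
  by (simp_all add: over_next_def under_next_def next_twist_def Let_def)

lemma over_next_in:
  assumes "x \<in> S p (V # q)" shows "over_next x \<in> S (p @ [V]) q"
proof -
  obtain xs v ys where x: "x = (xs, (V, v) # ys)" using S_Cons[OF assms] by blast
  have "reach B (xs @ (V, cj t v) # (T, t) # ys)"
    using assms unfolding x mem_S by (intro reach.over) simp
  then show ?thesis using assms unfolding x by (auto simp: mem_S)
qed

lemma under_next_in:
  assumes "x \<in> S p (V # q)" shows "under_next x \<in> S (p @ [V]) q"
proof -
  obtain xs v ys where x: "x = (xs, (V, v) # ys)" using S_Cons[OF assms] by blast
  have "reach B (xs @ (V, v) # (T, cj (inverse v) t) # ys)"
    using assms unfolding x mem_S by (intro reach.under) simp
  from reach.conj[OF this, of v]
  have "reach B (cjl v xs @ (V, v) # (T, t) # cjl v ys)" by (simp add: cj_self)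
  then show ?thesis using assms unfolding x by (auto simp: mem_S)
qed

lemma next_twist_in:
  assumes "x \<in> S p (V # q)" shows "next_twist x \<in> S p (V # q)"
proof -
  obtain xs v ys where x: "x = (xs, (V, v) # ys)" using S_Cons[OF assms] by blast
  have "reach B (xs @ (T, cj (t * v) t) # (V, cj (t * v) v) # ys)"
    using assms unfolding x mem_S by (intro reach_twist) simp
  from reach.conj[OF this, of "inverse (t * v)"]
  have "reach B (cjl (inverse (t * v)) xs @ (T, t) # (V, v) # cjl (inverse (t * v)) ys)" by simp
  then show ?thesis using assms unfolding x by (auto simp: mem_S)
qed

lemma over_next_pc:
  assumes "x \<in> S p (V # q)" "z \<in> Z" shows "over_next (pc z x) = pc z (over_next x)"
proof -
  obtain xs v ys where x: "x = (xs, (V, v) # ys)" using S_Cons[OF assms(1)] by blast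
  have "t * z = z * t" using assms(2) by (simp add: Z_def commute_def)
  then show ?thesis unfolding x by (simp add: pc_def cj_cj)
qed

lemma next_twist_pc:
  assumes "x \<in> S p (V # q)" "z \<in> Z" shows "next_twist (pc z x) = pc z (next_twist x)"
proof -
  obtain xs v ys where x: "x = (xs, (V, v) # ys)" using S_Cons[OF assms(1)] by blast
  have "t = cj z t" using assms(2) by (simp add: Z_def cj_self)
  then have "t * cj z v = cj z (t * v)" by (metis cj_mult)
  then have "inverse (t * cj z v) * z = z * inverse (t * v)"
    by (simp add: cj_inv[symmetric]) (simp add: cj_def mult.assoc)
  then show ?thesis unfolding x by (simp add: pc_def cjl_cjl)
qed

text \<open>The relation that drives the mass formula: the two ways of crossing differ by the twist
  and one conjugation by \<open>t\<close>.\<close>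

lemma over_under: "x \<in> S p (V # q) \<Longrightarrow> over_next x = under_next (pc t (next_twist x))"
proof -
  assume "x \<in> S p (V # q)"
  then obtain xs v ys where x: "x = (xs, (V, v) # ys)" using S_Cons by blast
  have "cj t v * (t * inverse (t * v)) = 1" by (simp add: cj_def mult.assoc inv_mult)
  then show ?thesis unfolding x by (simp add: pc_def cjl_cjl)
qed

lemma over_next_rel:
  assumes x: "x \<in> S p (V # q)" and y: "y \<in> S p (V # q)"
  shows "P.rel (over_next x) (over_next y) \<longleftrightarrow> P.rel x y"
proof
  assume "P.rel (over_next x) (over_next y)"
  then obtain z where z: "z \<in> Z" "over_next y = over_next (pc z x)"
    unfolding P.rel_def using over_next_pc[OF x] by auto
  obtain xs v ys where x': "pc z x = (xs, (V, v) # ys)" using S_Cons[OF S_pc[OF x z(1)]] by blast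
  obtain xs' v' ys' where y': "y = (xs', (V, v') # ys')" using S_Cons[OF y] by blast
  have "y = pc z x" using z(2) unfolding x' y' by simp
  then show "P.rel x y" using z(1) unfolding P.rel_def by blast
next
  assume "P.rel x y"
  then show "P.rel (over_next x) (over_next y)"
    unfolding P.rel_def using over_next_pc[OF x] by auto
qed

lemma over_next_surj:
  assumes "y \<in> S (p @ [V]) q" shows "\<exists>x\<in>S p (V # q). P.rel (over_next x) y"
proof -
  obtain xs v ys where y: "y = (xs @ [(V, v)], ys)"
    using assms by (force simp: S_def map_eq_append_conv)
  have "reach B (xs @ (V, v) # (T, t) # ys)" using assms unfolding y mem_S by simp
  then have "reach B (xs @ (T, t) # (V, cj (inverse t) v) # ys)" by (rule reach.under)
  then have "(xs, (V, cj (inverse t) v) # ys) \<in> S p (V # q)" using assms unfolding y by (simp add: mem_S)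
  moreover have "over_next (xs, (V, cj (inverse t) v) # ys) = y" unfolding y by simp
  ultimately show ?thesis by force
qed

lemma next_twist_rel:
  assumes x: "x \<in> S p (V # q)" and y: "y \<in> S p (V # q)"
  shows "P.rel (next_twist x) (next_twist y) \<longleftrightarrow> P.rel x y"
proof
  assume "P.rel (next_twist x) (next_twist y)"
  then obtain z where z: "z \<in> Z" "next_twist y = next_twist (pc z x)"
    unfolding P.rel_def using next_twist_pc[OF x] by auto
  obtain xs v ys where x': "pc z x = (xs, (V, v) # ys)" using S_Cons[OF S_pc[OF x z(1)]] by blast
  obtain xs' v' ys' where y': "y = (xs', (V, v') # ys')" using S_Cons[OF y] by blast
  have eq: "v' = v" "cjl (inverse (t * v)) xs' = cjl (inverse (t * v)) xs"
    "cjl (inverse (t * v)) ys' = cjl (inverse (t * v)) ys"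
    using z(2) unfolding x' y' by auto
  then have "xs' = xs" "ys' = ys" by (metis cjl_inv(2))+
  then have "y = pc z x" using eq(1) unfolding x' y' by simp
  then show "P.rel x y" using z(1) unfolding P.rel_def by blast
next
  assume "P.rel x y"
  then show "P.rel (next_twist x) (next_twist y)"
    unfolding P.rel_def using next_twist_pc[OF x] by auto
qed

lemma next_twist_surj:
  assumes "y \<in> S p (V # q)"
  shows "\<exists>x\<in>S p (V # q). next_twist x = y"
proof -
  obtain xs v ys where y: "y = (xs, (V, v) # ys)" using S_Cons[OF assms] by blast
  have "reach B (xs @ (T, cj (inverse (t * v)) t) # (V, cj (inverse (t * v)) v) # ys)"
    using assms unfolding y mem_S by (intro reach_untwist) simp
  from reach.conj[OF this, of "t * v"]
  have "reach B (cjl (t * v) xs @ (T, t) # (V, v) # cjl (t * v) ys)" by simp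
  then have "(cjl (t * v) xs, (V, v) # cjl (t * v) ys) \<in> S p (V # q)"
    using assms unfolding y by (simp add: mem_S)
  moreover have "next_twist (cjl (t * v) xs, (V, v) # cjl (t * v) ys) = y" unfolding y by simp
  ultimately show ?thesis by blast
qed

definition next_value where "next_value x = snd (hd (snd x))"

text \<open>The events are the crossings that survive in the mass formula.\<close>

definition event where
  "event x \<longleftrightarrow> commute t (next_value x)"

lemma next_value_pc: "x \<in> S p (V # q) \<Longrightarrow> next_value (pc z x) = cj z (next_value x)"
  using S_Cons by (fastforce simp: next_value_def pc_def)

lemma next_value_twist: "x \<in> S p (V # q) \<Longrightarrow> next_value (next_twist x) = next_value x"
  using S_Cons by (fastforce simp: next_value_def)

lemma event_pc: "x \<in> S p (V # q) \<Longrightarrow> z \<in> Z \<Longrightarrow> event (pc z x) \<longleftrightarrow> event x"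
  using commute_cj[of z t "next_value x"] by (simp add: event_def next_value_pc Z_def cj_self del: commute_cj)

text \<open>How much the twist changes a weight, multiplied over all classes. The twist does not change
  \<open>v\<close>. If \<open>v\<close> does not commute with \<open>t\<close>, then the common centralizer of the two is central, so a weight
  \<open>n\<close> on the possible values \<open>v\<close> exists; \<open>m / n\<close> is constant on orbits and the twist permutes the
  orbits, hence the total change of \<open>m\<close> on these configurations is 1. If \<open>v\<close> commutes with \<open>t\<close>,
  then the twist is the action of \<open>(t v)\<^sup>-\<^sup>1\<close> and changes \<open>m\<close> by \<open>\<kappa> (t v)\<^sup>-\<^sup>1\<close>.\<close>

lemma twist_product:
  assumes m: "P.weight \<kappa> (S p (V # q)) m" and R': "P.transversal (S p (V # q)) R'"
  shows "(\<Prod>x\<in>R'. m (next_twist x) / m x) =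
    (\<Prod>x\<in>R'. if event x then inverse (\<kappa> (t * next_value x)) else 1)"
proof -
  let ?S = "S p (V # q)"
  let ?N = "{x \<in> ?S. \<not> event x}" and ?RN = "{x \<in> R'. \<not> event x}"
  have fin: "finite R'" and sub: "R' \<subseteq> ?S" using R' by (auto simp: P.transversal_def)
  have twist_N: "next_twist x \<in> ?N" if "x \<in> ?N" for x
    using that next_twist_in[of x p V q] next_value_twist[of x p V q] by (simp add: event_def)
  have RN: "P.transversal ?N ?RN"
  proof -
    have "\<exists>!r. r \<in> ?RN \<and> P.rel r x" if x: "x \<in> ?N" for x
    proof -
      obtain r where r: "r \<in> R'" "P.rel r x" and u: "\<And>r'. r' \<in> R' \<Longrightarrow> P.rel r' x \<Longrightarrow> r' = r"
        using R' x unfolding P.transversal_def by (metis (no_types, lifting) mem_Collect_eq)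
      have "\<not> event r" using r x sub event_pc unfolding P.rel_def by blast
      then show ?thesis using r u by blast
    qed
    then show ?thesis using fin sub unfolding P.transversal_def by auto
  qed
  have "\<exists>n. G.weight \<kappa> {y. \<not> commute t y} n"
  proof (rule G.weight_exists)
    fix y z assume "y \<in> {y. \<not> commute t y}" "z \<in> Z" "cj z y = y"
    then have "central z" using commute_two_central[of z t y] by (auto simp: Z_def cj_fix)
    then show "\<kappa> z = 1" by (rule char_central)
  next
    fix y z assume "y \<in> {y. \<not> commute t y}" "z \<in> Z"
    then show "cj z y \<in> {y. \<not> commute t y}"
      using commute_cj[of z t y] by (auto simp: Z_def cj_self simp del: commute_cj)
  qed (use char_mult char_nz in \<open>auto simp: Z_def\<close>)
  then obtain n where n: "G.weight \<kappa> {y. \<not> commute t y} n" by blast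
  \<comment> \<open>This quotient is constant on orbits of configurations without an event.\<close>
  define u where "u x = m x / n (next_value x)" for x
  have n_nz: "n (next_value x) \<noteq> 0" if "x \<in> ?N" for x
    using that n by (auto simp: G.weight_def event_def)
  have u_inv: "u (pc z x) = u x" if x: "x \<in> ?N" and z: "z \<in> Z" for x z
  proof -
    have "m (pc z x) = \<kappa> z * m x" using m x z by (auto simp: P.weight_def)
    moreover have "n (next_value (pc z x)) = \<kappa> z * n (next_value x)"
      using n x z next_value_pc[of x p V q z] by (simp add: G.weight_def event_def)
    ultimately show ?thesis using char_nz[OF z] by (simp add: u_def)
  qed
  have "(\<Prod>x\<in>?RN. u (next_twist x)) = (\<Prod>x\<in>?RN. u x)"
  proof (rule P.prod_reindex(1)[OF RN RN twist_N])
    fix y assume y: "y \<in> ?N"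
    then obtain x where x: "x \<in> ?S" "next_twist x = y" using next_twist_surj by blast
    then have "x \<in> ?N" using y next_value_twist[OF x(1)] by (simp add: event_def)
    then show "\<exists>x\<in>?N. P.rel (next_twist x) y" using x(2) P.rel_refl by (intro bexI[of _ x]) simp_all
  qed (use next_twist_rel u_inv in auto)
  moreover have "u x \<noteq> 0" if "x \<in> ?RN" for x
  proof -
    have "x \<in> ?N" using that sub by blast
    then show ?thesis using n_nz[of x] m by (simp add: u_def P.weight_def)
  qed
  ultimately have "(\<Prod>x\<in>?RN. u (next_twist x) / u x) = 1" using fin by (simp add: prod_dividef)
  moreover have "u (next_twist x) / u x = m (next_twist x) / m x" if "x \<in> ?RN" for x
  proof -
    have "next_value (next_twist x) = next_value x" using that sub next_value_twist by blast
    then show ?thesis using n_nz[of x] that sub by (auto simp: u_def)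
  qed
  ultimately have N: "(\<Prod>x\<in>?RN. m (next_twist x) / m x) = 1" by simp
  have E: "m (next_twist x) / m x = inverse (\<kappa> (t * next_value x))" if x: "x \<in> R'" "event x" for x
  proof -
    have xS: "x \<in> ?S" using x sub by blast
    obtain xs v ys where xv: "x = (xs, (V, v) # ys)" using S_Cons[OF xS] by blast
    have c: "commute t v" using x(2) by (simp add: event_def next_value_def xv)
    let ?z = "t * v"
    have "commute ?z t" using c by (intro commute_mult') (auto intro: commute_sym)
    then have z: "?z \<in> Z" "inverse ?z \<in> Z" by (auto simp: Z_def intro: commute_inverse')
    have "next_twist x = pc (inverse ?z) x"
      using c unfolding xv by (simp add: pc_def cj_self commute_inverse' commute_mult')
    then have "m (next_twist x) = \<kappa> (inverse ?z) * m x" and "m x \<noteq> 0"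
      using m xS z by (auto simp: P.weight_def)
    moreover have "\<kappa> (inverse ?z) * \<kappa> ?z = 1"
      using char_mult[of "inverse ?z" ?z] z char_central[of 1] by (simp add: Z_def)
    ultimately show ?thesis using Fields.inverse_unique[of "\<kappa> ?z" "\<kappa> (inverse ?z)"]
      by (simp add: xv next_value_def mult.commute)
  qed
  have "(\<Prod>x\<in>R'. m (next_twist x) / m x) =
      (\<Prod>x\<in>{x \<in> R'. event x}. m (next_twist x) / m x) * (\<Prod>x\<in>?RN. m (next_twist x) / m x)"
    by (subst prod.union_disjoint[symmetric]) (use fin in \<open>auto intro: prod.cong\<close>)
  also have "\<dots> = (\<Prod>x\<in>{x \<in> R'. event x}. inverse (\<kappa> (t * next_value x)))"
    unfolding N using E by simp
  also have "\<dots> = (\<Prod>x\<in>R'. if event x then inverse (\<kappa> (t * next_value x)) else 1)"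
    using fin by (simp add: prod.If_cases Int_def)
  finally show ?thesis .
qed

text \<open>The contribution of all events while \<open>t\<close> crosses \<open>q\<close>, the labels \<open>p\<close> being to its left.\<close>

fun events :: "'i list \<Rightarrow> 'i list \<Rightarrow> complex" where
  "events p [] = 1"
| "events p (V # q) = (\<Prod>x\<in>R p (V # q). if event x then \<kappa> (t * next_value x) else 1) * events (p @ [V]) q"

text \<open>The result of crossing everything on the right by repeated \<open>over_next\<close> or by repeated
  \<open>under_next\<close>.\<close>

definition all_over where "all_over x = (fst x @ cjl t (snd x), [] :: ('i \<times> 'g) list)"
definition all_under where
  "all_under x = (cjl (lprod (snd x)) (fst x) @ cjl (lprod (snd x)) (snd x), [] :: ('i \<times> 'g) list)"

lemma all_over_Cons: "x \<in> S p (V # q) \<Longrightarrow> all_over x = all_over (over_next x)"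
  using S_Cons by (fastforce simp: all_over_def)

lemma all_under_Cons: "x \<in> S p (V # q) \<Longrightarrow> all_under x = all_under (under_next x)"
proof -
  assume "x \<in> S p (V # q)"
  then obtain xs v ys where x: "x = (xs, (V, v) # ys)" using S_Cons by blast
  have "cj v (lprod ys) * v = v * lprod ys" by (simp add: cj_def mult.assoc)
  moreover have "cj (v * lprod ys) v = cj (cj v (lprod ys)) v"
    by (simp add: cj_def mult.assoc inv_mult)
  ultimately show ?thesis unfolding x by (simp add: all_under_def cjl_cjl lprod_cjl)
qed

lemma all_under_in: "x \<in> S p q \<Longrightarrow> all_under x \<in> S (p @ q) []"
proof (induction q arbitrary: x p)
  case Nil
  then show ?case by (auto simp: S_def all_under_def)
next
  case (Cons V q)
  from Cons.IH[OF under_next_in[OF Cons.prems]] show ?case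
    using all_under_Cons[OF Cons.prems] by simp
qed

lemma all_over_in: "x \<in> S p q \<Longrightarrow> all_over x \<in> S (p @ q) []"
proof (induction q arbitrary: x p)
  case Nil
  then show ?case by (auto simp: S_def all_over_def)
next
  case (Cons V q)
  from Cons.IH[OF over_next_in[OF Cons.prems]] show ?case
    using all_over_Cons[OF Cons.prems] by simp
qed

lemma all_over_pc: "x \<in> S p q \<Longrightarrow> z \<in> Z \<Longrightarrow> all_over (pc z x) = pc z (all_over x)"
  by (auto simp: all_over_def pc_def cjl_cjl Z_def commute_def)

lemma all_under_pc: "x \<in> S p q \<Longrightarrow> z \<in> Z \<Longrightarrow> all_under (pc z x) = pc z (all_under x)"
proof -
  have "cj z (lprod (snd x)) * z = z * lprod (snd x)" by (simp add: cj_def mult.assoc)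
  then show ?thesis by (simp add: all_under_def pc_def cjl_cjl lprod_cjl)
qed

lemma card_R_Cons: "card (R p (V # q)) = card (R (p @ [V]) q)"
  by (rule P.prod_reindex(2)[OF R R, where f = over_next and F = "\<lambda>_. 1 :: nat"])
    (simp_all add: over_next_in over_next_rel over_next_surj)

text \<open>Induction on the number of strands crossed: replacing one crossing over by a crossing
  under costs \<open>\<kappa> t\<close> for each class and the events of that crossing.\<close>

lemma crossing_ratio:
  assumes "P.weight \<kappa> (S (p @ q) []) m"
  shows "(\<Prod>x\<in>R p q. m (all_over x) / m (all_under x)) * events p q = \<kappa> t ^ (length q * card (R p q))"
  using assms
proof (induction q arbitrary: p)
  case Nil
  have "m (all_over x) / m (all_under x) = 1" if "x \<in> R p []" for x
  proof -
    have x: "x \<in> S p []" using R that unfolding P.transversal_def by blast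
    then obtain xs where "x = (xs, [])" by (auto simp: S_def)
    then show ?thesis using Nil x by (auto simp: all_over_def all_under_def P.weight_def)
  qed
  then show ?case by simp
next
  case (Cons V q)
  let ?R = "R p (V # q)"
  let ?S = "S p (V # q)"
  have m: "P.weight \<kappa> (S ((p @ [V]) @ q) []) m" using Cons.prems by simp
  have sub: "?R \<subseteq> ?S" and fin: "finite ?R" using R[of p "V # q"] by (auto simp: P.transversal_def)
  have nz: "m (all_under y) \<noteq> 0" "m (all_over y) \<noteq> 0" if "y \<in> S p' q'" "p' @ q' = p @ V # q" for y p' q'
    using all_under_in[OF that(1)] all_over_in[OF that(1)] Cons.prems that(2) by (auto simp: P.weight_def)
  have w: "P.weight \<kappa> (S p' q') (\<lambda>y. m (all_under y))" if "p' @ q' = p @ V # q" for p' q'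
    using all_under_in[of _ p' q'] Cons.prems that all_under_pc[of _ p' q'] unfolding P.weight_def by auto
  have "(\<Prod>x\<in>?R. m (all_over x) / m (all_under x)) =
      (\<Prod>x\<in>?R. m (all_over (over_next x)) / m (all_under (over_next x))) *
      (\<Prod>x\<in>?R. m (all_under (over_next x)) / m (all_under x))"
    unfolding prod.distrib[symmetric]
  proof (rule prod.cong)
    fix x assume "x \<in> ?R"
    then have x: "x \<in> ?S" using sub by blast
    then show "m (all_over x) / m (all_under x) = m (all_over (over_next x)) / m (all_under (over_next x)) *
        (m (all_under (over_next x)) / m (all_under x))"
      using nz(1)[OF over_next_in[OF x]] all_over_Cons[OF x] by simp
  qed simp
  also have "(\<Prod>x\<in>?R. m (all_over (over_next x)) / m (all_under (over_next x))) =
      (\<Prod>x\<in>R (p @ [V]) q. m (all_over x) / m (all_under x))"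
  proof (rule P.prod_reindex(1)[OF R R over_next_in over_next_rel over_next_surj,
        where F = "\<lambda>x. m (all_over x) / m (all_under x)"])
    fix y z assume y: "y \<in> S (p @ [V]) q" and z: "z \<in> Z"
    have "m (all_over (pc z y)) = \<kappa> z * m (all_over y)" "m (all_under (pc z y)) = \<kappa> z * m (all_under y)"
      using all_over_in[OF y] all_under_in[OF y] m z all_over_pc[OF y z] all_under_pc[OF y z]
      by (auto simp: P.weight_def)
    then show "m (all_over (pc z y)) / m (all_under (pc z y)) = m (all_over y) / m (all_under y)"
      using char_nz[OF z] by simp
  qed
  also have "(\<Prod>x\<in>?R. m (all_under (over_next x)) / m (all_under x)) =
      \<kappa> t ^ card ?R * (\<Prod>x\<in>?R. m (all_under (next_twist x)) / m (all_under x))"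
    unfolding prod_constant[symmetric] prod.distrib[symmetric]
  proof (rule prod.cong)
    fix x assume "x \<in> ?R"
    then have x: "x \<in> ?S" using sub by blast
    have "all_under (over_next x) = all_under (pc t (next_twist x))"
      using over_under[OF x] all_under_Cons[OF S_pc[OF next_twist_in[OF x] t_in_Z]] by simp
    also have "m \<dots> = \<kappa> t * m (all_under (next_twist x))"
      using w[of p "V # q"] next_twist_in[OF x] t_in_Z by (simp add: P.weight_def)
    finally show "m (all_under (over_next x)) / m (all_under x) =
        \<kappa> t * (m (all_under (next_twist x)) / m (all_under x))" by simp
  qed simp
  also have "(\<Prod>x\<in>?R. m (all_under (next_twist x)) / m (all_under x)) =
      (\<Prod>x\<in>?R. if event x then inverse (\<kappa> (t * next_value x)) else 1)"
    by (rule twist_product[OF w R]) simp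
  finally have eq: "(\<Prod>x\<in>?R. m (all_over x) / m (all_under x)) =
      (\<Prod>x\<in>R (p @ [V]) q. m (all_over x) / m (all_under x)) *
      (\<kappa> t ^ card ?R * (\<Prod>x\<in>?R. if event x then inverse (\<kappa> (t * next_value x)) else 1))" .
  have "(\<Prod>x\<in>?R. if event x then inverse (\<kappa> (t * next_value x)) else 1) *
      (\<Prod>x\<in>?R. if event x then \<kappa> (t * next_value x) else 1) = 1"
    unfolding prod.distrib[symmetric]
  proof (rule prod.neutral, rule ballI)
    fix x assume "x \<in> ?R"
    show "(if event x then inverse (\<kappa> (t * next_value x)) else 1) *
        (if event x then \<kappa> (t * next_value x) else 1) = 1"
    proof (cases "event x")
      case True
      then have "t * next_value x \<in> Z"
        using commute_mult'[OF commute_refl commute_sym] by (simp add: event_def Z_def)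
      with True show ?thesis using char_nz by simp
    qed simp
  qed
  then show ?case
    using Cons.IH[OF m] unfolding eq events.simps card_R_Cons
    by (simp add: power_add mult_ac)
qed

text \<open>Let \<open>t\<close> cross all the other elements. Their product is \<open>t\<^sup>-\<^sup>1\<close>, so crossing over and crossing
  under both amount to a conjugation of the others, and these conjugations differ by \<open>t\<^sup>2\<close>. Comparison with
  \<open>crossing_ratio\<close> yields the formula.\<close>

theorem mass_formula:
  assumes "reach B ((T, t) # L)" and "map fst L = q"
  shows "\<kappa> t ^ (2 * card (R [] q)) * events [] q = \<kappa> t ^ (length q * card (R [] q))"
proof -
  have "\<exists>m. P.weight \<kappa> (S q []) m"
    by (rule P.weight_exists)
      (use char_mult char_nz char_central stabilizer_central S_pc in \<open>auto simp: Z_def\<close>)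
  then obtain m where m: "P.weight \<kappa> (S ([] @ q) []) m" by auto
  have "m (all_over x) / m (all_under x) = \<kappa> t ^ 2" if "x \<in> R [] q" for x
  proof -
    have x: "x \<in> S [] q" using R that unfolding P.transversal_def by blast
    then obtain ys where ys: "x = ([], ys)" "reach B ((T, t) # ys)" by (auto simp: S_def)
    have "t * lprod ys = 1" using reach_prod[OF ys(2) prod_one] by simp
    then have "lprod ys = inverse t" by (simp add: inv_unique)
    then have "all_over x = pc t (pc t (all_under x))"
      by (simp add: ys(1) all_over_def all_under_def pc_def cjl_cjl)
    moreover have "all_under x \<in> S q []" using all_under_in[OF x] by simp
    ultimately have "m (all_over x) = \<kappa> t * (\<kappa> t * m (all_under x))" "m (all_under x) \<noteq> 0"
      using m t_in_Z S_pc[of _ q "[]" t] by (auto simp: P.weight_def)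
    then show ?thesis by (simp add: power2_eq_square)
  qed
  then have "(\<Prod>x\<in>R [] q. m (all_over x) / m (all_under x)) = \<kappa> t ^ (2 * card (R [] q))"
    by (simp add: power_mult)
  then show ?thesis using crossing_ratio[OF m] by simp
qed

end

section \<open>Normal forms, orders and characters of unimodular matrices\<close>

lemma tr_commute: "tr (x * y) = tr (y * x)" by (simp add: tr_def algebra_simps)

lemma tr_cj [simp]: "tr (cj g x) = tr x"
  unfolding cj_def using tr_commute[of "g * x" "inverse g"] by (simp flip: mult.assoc)

text \<open>A root \<open>l\<close> of the characteristic polynomial gives the eigenvector
  \<open>(l - e22 t, e21 t)\<close>, the first column of the conjugating matrix.\<close>

lemma sl2_upper_triangular: "\<exists>g. e21 (cj g t) = 0"
proof (cases "e21 t = 0")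
  case True
  then show ?thesis by (metis cj_one(2))
next
  case False
  define l where "l = (tr t + csqrt ((tr t)\<^sup>2 - 4)) / 2"
  have "2 * l - tr t = csqrt ((tr t)\<^sup>2 - 4)" unfolding l_def by (simp add: field_simps)
  then have "(2 * l - tr t)\<^sup>2 = (tr t)\<^sup>2 - 4" by simp
  then have "4 * (l * l - tr t * l + 1) = 0" by (simp add: power2_eq_square algebra_simps)
  then have l: "l * l - tr t * l + 1 = 0" by (metis mult_eq_0_iff zero_neq_numeral)
  define h where "h = mk (l - e22 t) (- 1 / e21 t) (e21 t) 0"
  have h: "e11 h = l - e22 t" "e12 h = - 1 / e21 t" "e21 h = e21 t" "e22 h = 0"
    unfolding h_def using False by (simp_all add: mk_entries)
  have "e21 (cj (inverse h) t) =
      (l - e22 t) * (e21 t * (l - e22 t) + e22 t * e21 t) - e21 t * (e11 t * (l - e22 t) + e12 t * e21 t)"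
    unfolding cj_def by (simp add: h algebra_simps)
  also have "\<dots> = e21 t * (l * l - (e11 t + e22 t) * l + (e11 t * e22 t - e12 t * e21 t))"
    by (simp add: algebra_simps)
  also have "\<dots> = 0" using l by (simp add: det_sl2 tr_def)
  finally show ?thesis by blast
qed

lemma sl2_normal_form:
  assumes "\<not> central t"
  obtains (diagonal) g where "e21 (cj g t) = 0" "e12 (cj g t) = 0" "e11 (cj g t) \<noteq> e22 (cj g t)"
  | (unipotent) g where "e21 (cj g t) = 0" "e12 (cj g t) \<noteq> 0" "e11 (cj g t) = e22 (cj g t)"
proof -
  obtain g where g: "e21 (cj g t) = 0" using sl2_upper_triangular by blast
  let ?u = "cj g t"
  show thesis
  proof (cases "e11 ?u = e22 ?u")
    case True
    then have "e12 ?u \<noteq> 0" using assms g central_cj[of g t] by (auto simp: central_sl2)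
    then show thesis using unipotent g True by blast
  next
    case False
    define s where "s = e12 ?u / (e11 ?u - e22 ?u)"
    define h where "h = mk 1 s 0 1"
    have h: "e11 h = 1" "e12 h = s" "e21 h = 0" "e22 h = 1"
      unfolding h_def by (simp_all add: mk_entries)
    have s: "s * (e11 ?u - e22 ?u) = e12 ?u" using False by (simp add: s_def)
    have "e21 (cj h ?u) = 0" "e11 (cj h ?u) = e11 ?u" "e22 (cj h ?u) = e22 ?u"
      unfolding cj_def[of h] by (simp_all add: h g)
    moreover have "e12 (cj h ?u) = 0"
      using s unfolding cj_def[of h] by (simp add: h g algebra_simps)
    ultimately show thesis using diagonal[of "h * g"] False by (simp add: cj_cj)
  qed
qed

lemma commute_diagonal:
  assumes "e21 t = 0" "e12 t = 0" "e11 t \<noteq> e22 t"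
  shows "commute t x \<longleftrightarrow> e12 x = 0 \<and> e21 x = 0"
  using assms by (auto simp: commute_def sl2_eq_iff mult.commute)

lemma commute_unipotent:
  assumes "e21 t = 0" "e12 t \<noteq> 0" "e11 t = e22 t"
  shows "commute t x \<longleftrightarrow> e21 x = 0 \<and> e11 x = e22 x"
  using assms by (auto simp: commute_def sl2_eq_iff mult.commute)

lemma triangular_power:
  "e21 x = 0 \<Longrightarrow> e21 (x ^ k) = 0 \<and> e11 (x ^ k) = e11 x ^ k \<and> e22 (x ^ k) = e22 x ^ k"
  by (induction k) auto

lemma unipotent_power:
  assumes "e21 x = 0" "e11 x = e22 x"
  shows "e12 (x ^ k) * e11 x = of_nat k * e11 x ^ k * e12 x"
proof (induction k)
  case (Suc k)
  have "e12 (x ^ Suc k) * e11 x = e11 x * (e12 (x ^ k) * e11 x) + e12 x * e22 (x ^ k) * e11 x"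
    by (simp add: algebra_simps)
  then show ?case using Suc triangular_power[OF assms(1), of k] assms(2) by (simp add: algebra_simps)
qed simp

lemma unipotent_infinite_order:
  assumes "e21 x = 0" "e12 x \<noteq> 0" "e11 x = e22 x"
  shows "\<not> finite_order x"
proof
  assume "finite_order x"
  then obtain k where k: "k > 0" "x ^ k = 1" by (auto simp: finite_order_def)
  have "e11 x \<noteq> 0" using det_sl2[of x] assms by auto
  moreover have "of_nat k * e11 x ^ k * e12 x = 0"
    using unipotent_power[OF assms(1,3), of k] k(2) by simp
  ultimately show False using k(1) assms(2) by simp
qed

definition root_of_unity :: "complex \<Rightarrow> bool" where
  "root_of_unity z \<longleftrightarrow> (\<exists>k>0. z ^ k = 1)"

lemma root_of_unity_one [simp]: "root_of_unity 1" by (auto simp: root_of_unity_def)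

lemma root_of_unity_mult: "root_of_unity z \<Longrightarrow> root_of_unity w \<Longrightarrow> root_of_unity (z * w)"
  unfolding root_of_unity_def
proof clarify
  fix k l :: nat assume "k > 0" "z ^ k = 1" "l > 0" "w ^ l = 1"
  then have "(z * w) ^ (k * l) = 1"
    by (simp add: power_mult_distrib power_mult) (metis mult.commute power_mult power_one)
  then show "\<exists>m>0. (z * w) ^ m = 1" using \<open>k > 0\<close> \<open>l > 0\<close> by (metis nat_0_less_mult_iff)
qed

lemma root_of_unity_inverse: "root_of_unity z \<Longrightarrow> root_of_unity (inverse z)"
  unfolding root_of_unity_def by (metis inverse_1 power_inverse)

lemma root_of_unity_power: "k > 0 \<Longrightarrow> root_of_unity (z ^ k) \<Longrightarrow> root_of_unity z"
  unfolding root_of_unity_def by (metis nat_0_less_mult_iff power_mult)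

lemma root_of_unity_prod: "(\<And>x. x \<in> A \<Longrightarrow> root_of_unity (f x)) \<Longrightarrow> root_of_unity (\<Prod>x\<in>A. f x)"
  by (induction A rule: infinite_finite_induct) (auto intro: root_of_unity_mult)

lemma diagonal_finite_order:
  assumes "e21 x = 0" "e12 x = 0"
  shows "finite_order x \<longleftrightarrow> root_of_unity (e11 x)"
proof -
  have d: "e11 x * e22 x = 1" using det_sl2[of x] assms by simp
  have "x ^ k = 1 \<longleftrightarrow> e11 x ^ k = 1" for k
  proof -
    have "e12 (x ^ k) = 0" using assms by (induction k) auto
    moreover have "e11 x ^ k * e22 x ^ k = 1" using d by (simp flip: power_mult_distrib)
    ultimately show ?thesis using triangular_power[OF assms(1), of k] by (auto simp: sl2_eq_iff)
  qed
  then show ?thesis by (simp add: finite_order_def root_of_unity_def)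
qed

text \<open>Eigenvalues of an element of finite order are roots of unity, so the trace is
  \<open>2 Re \<lambda>\<close> with \<open>|\<lambda>| = 1\<close>. The extreme values force \<open>\<lambda> = \<plusminus>1\<close>, and a noncentral matrix with
  a double eigenvalue has infinite order.\<close>

lemma finite_order_trace:
  assumes "finite_order x"
  shows "tr x \<in> \<real>" and "\<not> central x \<Longrightarrow> \<bar>Re (tr x)\<bar> < 2"
proof -
  obtain g where g: "e21 (cj g x) = 0" using sl2_upper_triangular by blast
  let ?u = "cj g x"
  have fo: "finite_order ?u" using assms by simp
  then obtain k where k: "k > 0" "?u ^ k = 1" by (auto simp: finite_order_def)
  then have "e11 ?u ^ k = 1" using triangular_power[OF g, of k] by simp
  then have n: "norm (e11 ?u) = 1" using k(1) by (metis norm_one norm_power power_eq_1_iff norm_ge_zero gr_implies_not0)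
  have d: "e11 ?u * e22 ?u = 1" using det_sl2[of ?u] g by simp
  then have "e22 ?u = cnj (e11 ?u)"
    by (metis n complex_norm_square mult.commute mult_cancel_left mult_zero_left norm_one of_real_1 one_power2 power_one zero_neq_one)
  then have t: "tr x = of_real (2 * Re (e11 ?u))"
    using tr_cj[of g x] unfolding tr_def by (simp add: complex_add_cnj)
  then show "tr x \<in> \<real>" by simp
  assume "\<not> central x"
  then have nc: "\<not> central ?u" by simp
  have "\<bar>Re (e11 ?u)\<bar> \<noteq> 1"
  proof
    assume r: "\<bar>Re (e11 ?u)\<bar> = 1"
    then have "Im (e11 ?u) = 0" using n by (simp add: cmod_def) (metis abs_square_eq_1 add_cancel_left_right power2_abs power2_eq_iff real_sqrt_eq_1_iff zero_eq_power2)
    then have "e22 ?u = e11 ?u" using \<open>e22 ?u = cnj (e11 ?u)\<close> by (simp add: complex_eq_iff)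
    moreover have "e12 ?u \<noteq> 0" using nc g calculation by (auto simp: central_sl2)
    ultimately show False using unipotent_infinite_order[OF g] fo by simp
  qed
  moreover have "\<bar>Re (e11 ?u)\<bar> \<le> 1" using abs_Re_le_cmod[of "e11 ?u"] n by simp
  ultimately show "\<bar>Re (tr x)\<bar> < 2" unfolding t by simp
qed

text \<open>The characters that detect infinite order. For a diagonal \<open>t\<close> take the square of
  the first eigenvalue; the square kills the centre. For a unipotent \<open>t\<close> up to sign take the exponential of the
  translation length, scaled so that \<open>t\<close> has value \<open>e\<close>.\<close>

lemma character_exists:
  assumes "\<not> finite_order (t :: sl2)"
  obtains \<kappa> :: "sl2 \<Rightarrow> complex" where
    "\<And>z w. commute z t \<Longrightarrow> commute w t \<Longrightarrow> \<kappa> (z * w) = \<kappa> z * \<kappa> w"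
    "\<And>z. central z \<Longrightarrow> \<kappa> z = 1" "\<not> root_of_unity (\<kappa> t)"
proof -
  have "\<not> central t" using assms central_finite_order by blast
  then show thesis
  proof (cases rule: sl2_normal_form)
    case (diagonal g)
    show thesis
    proof (rule that[of "\<lambda>z. (e11 (cj g z))\<^sup>2"])
      fix z w assume "commute z t" "commute w t"
      then have "commute (cj g t) (cj g z)" by (simp add: commute_sym)
      then have "e12 (cj g z) = 0" using commute_diagonal[OF diagonal] by blast
      then show "(e11 (cj g (z * w)))\<^sup>2 = (e11 (cj g z))\<^sup>2 * (e11 (cj g w))\<^sup>2"
        by (simp add: cj_mult power_mult_distrib)
    next
      fix z :: sl2 assume "central z"
      then have "central (cj g z)" by simp
      then show "(e11 (cj g z))\<^sup>2 = 1" using det_sl2[of "cj g z"] by (simp add: central_sl2 power2_eq_square)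
    next
      have "\<not> finite_order (cj g t)" using assms by simp
      then show "\<not> root_of_unity ((e11 (cj g t))\<^sup>2)"
        using diagonal_finite_order[OF diagonal(1,2)] root_of_unity_power[of 2] by auto
    qed
  next
    case (unipotent g)
    let ?r = "\<lambda>z. e12 (cj g z) / (e11 (cj g z) * e12 (cj g t))"
    show thesis
    proof (rule that[of "\<lambda>z. exp (e11 (cj g t) * ?r z)"])
      fix z w assume "commute z t" "commute w t"
      then have "commute (cj g t) (cj g z)" "commute (cj g t) (cj g w)" by (simp_all add: commute_sym)
      then have *: "e21 (cj g z) = 0" "e11 (cj g z) = e22 (cj g z)" "e21 (cj g w) = 0" "e11 (cj g w) = e22 (cj g w)"
        using commute_unipotent[OF unipotent] by blast+
      then have "e11 (cj g z) \<noteq> 0" "e11 (cj g w) \<noteq> 0" using det_sl2[of "cj g z"] det_sl2[of "cj g w"] by auto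
      then have "?r (z * w) = ?r z + ?r w"
        using * unipotent(2) by (simp add: cj_mult field_simps)
      then show "exp (e11 (cj g t) * ?r (z * w)) = exp (e11 (cj g t) * ?r z) * exp (e11 (cj g t) * ?r w)"
        by (simp add: distrib_left exp_add)
    next
      fix z :: sl2 assume "central z"
      then have "central (cj g z)" by simp
      then show "exp (e11 (cj g t) * ?r z) = 1" by (simp add: central_sl2)
    next
      have "e11 (cj g t) \<noteq> 0" using unipotent det_sl2[of "cj g t"] by auto
      then have e: "exp (e11 (cj g t) * ?r t) = exp 1" using unipotent(2) by simp
      have "norm (exp (1::complex) ^ k) > 1" if "k > 0" for k
        using that by (simp add: norm_power)
      then show "\<not> root_of_unity (exp (e11 (cj g t) * ?r t))"
        unfolding e root_of_unity_def by (metis less_irrefl norm_one)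
    qed
  qed
qed

section \<open>A block of commuting elements\<close>

text \<open>Twisting two neighbours repeatedly conjugates them by powers of their product and
  leaves the others alone. By finiteness two of these tuples are conjugate. The conjugating element
  commutes with two noncommuting members \<open>u\<close> and \<open>v\<close>, so it is central, and a power of \<open>g h\<close>
  commutes with both \<open>g\<close> and \<open>h\<close>.\<close>

lemma pair_finite_order:
  fixes g h :: sl2
  assumes fin: "finite_orbit B" and r: "reach B (xs @ (i, g) # (j, h) # ys)"
    and gh: "\<not> commute g h"
    and uv: "u \<in> snd ` set (xs @ ys)" "v \<in> snd ` set (xs @ ys)" "\<not> commute u v"
  shows "finite_order (g * h)"
proof -
  let ?m = "g * h"
  let ?L = "\<lambda>k. xs @ (i, cj (?m ^ k) g) # (j, cj (?m ^ k) h) # ys"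
  obtain K where K: "finite K" "\<And>L. reach B L \<Longrightarrow> \<exists>M\<in>K. \<exists>g. L = cjl g M"
    using fin unfolding finite_orbit_def by blast
  have "\<exists>M. M \<in> K \<and> (\<exists>a. ?L k = cjl a M)" for k using K(2)[OF reach_twists[OF r, of k]] by blast
  then obtain f where f: "\<And>k. f k \<in> K" "\<And>k. \<exists>a. ?L k = cjl a (f k)" by metis
  have "\<not> inj f"
    using f(1) K(1) by (metis finite_imageD finite_subset image_subsetI infinite_UNIV_nat)
  then obtain k l where kl: "k < l" "f k = f l" unfolding inj_def by (metis linorder_neqE_nat)
  obtain a b where "?L k = cjl a (f k)" "?L l = cjl b (f l)" using f(2) by blast
  then have "cjl (inverse a) (?L k) = cjl (inverse b) (?L l)" using kl(2) by (simp only: cjl_inv)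
  then have "cjl b (cjl (inverse a) (?L k)) = ?L l" by (simp only: cjl_inv)
  then have eq: "cjl (b * inverse a) (?L k) = ?L l" by (simp only: cjl_cjl)
  let ?c = "b * inverse a"
  have len: "length (cjl ?c xs) = length xs" by simp
  have eqs: "cjl ?c xs = xs" "cj ?c (cj (?m ^ k) g) = cj (?m ^ l) g" "cj ?c (cj (?m ^ k) h) = cj (?m ^ l) h" "cjl ?c ys = ys"
    using eq len by auto
  then have "commute ?c u" "commute ?c v" using uv unfolding cjl_fix by auto
  then have c: "central ?c" using uv(3) by (rule commute_two_central)
  have e: "?m ^ l = ?m ^ k * ?m ^ (l - k)" using kl(1) by (simp flip: power_add)
  have "cj (?m ^ k) x = cj (?m ^ k) (cj (?m ^ (l - k)) x)" if "cj ?c (cj (?m ^ k) x) = cj (?m ^ l) x" for x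
  proof -
    have "cj ?c (cj (?m ^ k) x) = cj (?m ^ k) x" using c by (simp add: cj_self central_commute)
    then show ?thesis using that unfolding e cj_cj[symmetric] by simp
  qed
  then have "commute (?m ^ (l - k)) g" "commute (?m ^ (l - k)) h"
    using eqs by (auto simp flip: cj_fix)
  then have "central (?m ^ (l - k))" using gh by (rule commute_two_central)
  then show ?thesis using central_finite_order finite_order_power[of "l - k" ?m] kl(1) by auto
qed

lemma reach_to_front:
  "reach B (xs @ (T, t) # ys) \<Longrightarrow> \<exists>L. reach B ((T, t) # L)"
proof (induction xs arbitrary: ys rule: rev_induct)
  case (snoc x xs)
  obtain i g where x: "x = (i, g)" by force
  have "reach B (xs @ (T, t) # (i, cj (inverse t) g) # ys)"
    using snoc.prems x by (intro reach.under) simp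
  then show ?case by (rule snoc.IH)
qed auto

text \<open>Suppose that \<open>t v\<close> had finite order at every event. Then the events contribute a root of
  unity to the mass formula, and a positive power of \<open>\<kappa> t\<close> would be one too, as there are at least
  three other elements.\<close>

lemma commuting_neighbour:
  fixes t :: sl2
  assumes fin: "finite_orbit B" and dist: "distinct (map fst B)" and prod: "lprod B = 1"
    and nc: "\<not> all_commute B" and B: "B = (T, t) # L" and len: "length L \<ge> 3"
    and t: "\<not> finite_order t"
  obtains xs V v ys where "reach B (xs @ (T, t) # (V, v) # ys)" "commute t v" "\<not> finite_order (t * v)"
proof -
  note thesisI = that
  obtain \<kappa> :: "sl2 \<Rightarrow> complex" where \<kappa>:
    "\<And>z w. commute z t \<Longrightarrow> commute w t \<Longrightarrow> \<kappa> (z * w) = \<kappa> z * \<kappa> w"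
    "\<And>z. central z \<Longrightarrow> \<kappa> z = 1" "\<not> root_of_unity (\<kappa> t)"
    using character_exists[OF t] by blast
  interpret braid_frame B T t \<kappa>
    by standard (use fin prod nc \<kappa> in auto)
  show thesis
  proof (rule ccontr)
    assume not: "\<not> thesis"
    have root: "root_of_unity (\<kappa> (t * next_value x))" if x: "x \<in> R p (V # q)" "event x" for p V q x
    proof -
      have "x \<in> S p (V # q)" using x(1) R unfolding P.transversal_def by blast
      moreover from this obtain xs v ys where xv: "x = (xs, (V, v) # ys)" using S_Cons by blast
      ultimately have r: "reach B (xs @ (T, t) # (V, v) # ys)" by (simp add: mem_S)
      have c: "commute t v" using x(2) by (simp add: event_def next_value_def xv)
      have "finite_order (t * v)" using not thesisI[OF r c] by blast
      then obtain k where k: "k > 0" "(t * v) ^ k = 1" by (auto simp: finite_order_def)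
      have c': "commute (t * v) t" using c by (intro commute_mult') (auto intro: commute_sym)
      have "\<kappa> ((t * v) ^ m) = \<kappa> (t * v) ^ m" for m
      proof (induction m)
        case (Suc m)
        have "commute ((t * v) ^ m) t" using commute_power[OF commute_sym[OF c']] commute_sym by blast
        then show ?case using Suc \<kappa>(1)[OF c'] by simp
      qed (simp add: \<kappa>(2))
      from this[of k] have "\<kappa> (t * v) ^ k = 1" using k \<kappa>(2)[of 1] by simp
      then show ?thesis using k(1) unfolding root_of_unity_def by (auto simp: xv next_value_def)
    qed
    have ev: "root_of_unity (events p q)" for p q
      by (induction q arbitrary: p) (auto intro!: root_of_unity_mult root_of_unity_prod root)
    \<comment> \<open>The mass formula for the given tuple, from which \<open>\<kappa> t\<close> cancels.\<close>
    let ?q = "map fst L"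
    have r: "reach B ((T, t) # L)" using reach.start[of B] by (simp add: B)
    then have "([], L) \<in> S [] ?q" by (simp add: mem_S)
    then have "R [] ?q \<noteq> {}" "finite (R [] ?q)" using R[of "[]" ?q] unfolding P.transversal_def by auto
    then have N: "card (R [] ?q) > 0" by (simp add: card_gt_0_iff)
    let ?N = "card (R [] ?q)"
    have t0: "\<kappa> t \<noteq> 0" using char_nz t_in_Z by blast
    have "\<kappa> t ^ (2 * ?N) * events [] ?q = \<kappa> t ^ (length ?q * ?N)"
      by (rule mass_formula[OF r HOL.refl])
    moreover have len': "2 + (length ?q - 2) = length ?q" using len by simp
    ultimately have "\<kappa> t ^ (2 * ?N) * events [] ?q = \<kappa> t ^ ((2 + (length ?q - 2)) * ?N)"
      by (simp only: len')
    then have "events [] ?q = \<kappa> t ^ ((length ?q - 2) * ?N)"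
      using t0 unfolding add_mult_distrib power_add by simp
    then have "root_of_unity (\<kappa> t ^ ((length ?q - 2) * ?N))" using ev by metis
    then have "root_of_unity (\<kappa> t)" using N len root_of_unity_power[of "(length ?q - 2) * ?N"] by simp
    then show False using \<kappa>(3) by simp
  qed
qed

text \<open>Merge \<open>t\<close> with the commuting neighbour and repeat, until three elements are left; the
  middle one then unfolds to a block of commuting elements.\<close>

lemma commuting_block:
  fixes t :: sl2
  assumes "finite_orbit B" "distinct (map fst B)" "lprod B = 1"
    and "\<not> all_commute B" "(T, t) \<in> set B" "length B \<ge> 3" "\<not> finite_order t"
  shows "\<exists>a xa cs b xb t'. reach B ((a, xa) # cs @ [(b, xb)]) \<and> (T, t') \<in> set cs \<and>
    \<not> finite_order t' \<and> (\<forall>y\<in>snd ` set cs. commute t' y)"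
  using assms
proof (induction "length B" arbitrary: B t rule: less_induct)
  case less
  obtain xs ys where "B = xs @ (T, t) # ys" using less.prems(5) by (meson split_list)
  then obtain L where L: "reach B ((T, t) # L)" using reach_to_front[of B xs T t ys] reach.start[of B] by auto
  show ?case
  proof (cases "length B = 3")
    case True
    then have "length L = 2" using reach_length[OF L] by simp
    then obtain a xa b xb where "L = [(a, xa), (b, xb)]"
      by (auto simp: length_Suc_conv numeral_2_eq_2)
    then have "reach B ([] @ (a, cj t xa) # (T, t) # [(b, xb)])"
      using L by (intro reach.over) simp
    then have "reach B ((a, cj t xa) # [(T, t)] @ [(b, xb)])" by simp
    then show ?thesis using less.prems(7)
      by (intro exI[of _ a] exI[of _ "cj t xa"] exI[of _ "[(T, t)]"] exI[of _ b] exI[of _ xb] exI[of _ t]) simp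
  next
    case False
    let ?B = "(T, t) # L"
    have fin: "finite_orbit ?B" using finite_orbit_reach less.prems(1) L by blast
    have dist: "distinct (map fst ?B)" using reach_distinct L less.prems(2) by blast
    have prod: "lprod ?B = 1" using reach_prod L less.prems(3) by blast
    have nc: "\<not> all_commute ?B" using all_commute_reach L less.prems(4) by blast
    have "length L \<ge> 3" using reach_length[OF L] False less.prems(6) by simp
    then obtain xs V v ys where r: "reach ?B (xs @ (T, t) # (V, v) # ys)"
      and tv: "commute t v" "\<not> finite_order (t * v)"
      using commuting_neighbour[OF fin dist prod nc HOL.refl _ less.prems(7)] by blast
    let ?M = "xs @ (T, t) # (V, v) # ys" and ?C = "xs @ (T, t * v) # ys"
    have rM: "reach B ?M" using r L reach_trans by blast
    have distM: "distinct (map fst ?M)" using reach_distinct[OF rM less.prems(2)] .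
    have tvnc: "\<not> central (t * v)" using tv(2) central_finite_order by blast
    have ct: "commute (t * v) t" "commute (t * v) v" using tv(1)
      by (auto intro!: commute_mult' intro: commute_sym)
    have "length ?C < length B" using reach_length[OF rM] by simp
    moreover have "finite_orbit ?C"
      using finite_orbit_merge[OF _ distM] finite_orbit_reach[OF less.prems(1) rM] by blast
    moreover have "distinct (map fst ?C)" using distM by auto
    moreover have "lprod ?C = 1" using reach_prod[OF rM less.prems(3)] by (simp add: mult.assoc)
    moreover have "\<not> all_commute ?C"
    proof
      assume "all_commute ?C"
      then have "commute (t * v) y" if "y \<in> snd ` set (xs @ ys)" for y
        using that unfolding all_commute_def by auto
      then have "commute (t * v) y" if "y \<in> snd ` set ?M" for y using that ct by auto
      then have "all_commute ?M" unfolding all_commute_def using commute_trans[OF tvnc] by blast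
      then show False using all_commute_reach[OF rM] less.prems(4) by blast
    qed
    moreover have "(T, t * v) \<in> set ?C" by simp
    moreover have "length ?C \<ge> 3" using reach_length[OF rM] False less.prems(6) by simp
    ultimately obtain a xa cs b xb t' where IH: "reach ?C ((a, xa) # cs @ [(b, xb)])" "(T, t') \<in> set cs"
      "\<forall>y\<in>snd ` set cs. commute t' y"
      using less.hyps[of ?C "t * v"] tv(2) by blast
    obtain us vs k where uv: "(a, xa) # cs @ [(b, xb)] = us @ (T, cj k (t * v)) # vs"
      "reach ?M (us @ (T, cj k t) # (V, cj k v) # vs)"
      using reach_merge[OF IH(1) distM] by blast
    obtain cs1 cs2 where cs: "cs = cs1 @ (T, t') # cs2" using IH(2) by (meson split_list)
    have d1: "((a, xa) # cs1) @ (T, t') # (cs2 @ [(b, xb)]) = us @ (T, cj k (t * v)) # vs"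
      using uv(1) cs by simp
    have d2: "distinct (map fst (((a, xa) # cs1) @ (T, t') # (cs2 @ [(b, xb)])))"
      using reach_distinct[OF IH(1)] \<open>distinct (map fst ?C)\<close> cs by simp
    have e: "us = (a, xa) # cs1" "t' = cj k (t * v)" "vs = cs2 @ [(b, xb)]"
      using split_unique[OF d1 d2] by simp_all
    \<comment> \<open>Unfolding the ribbon keeps the block commuting: \<open>t\<close> and \<open>v\<close> commute with \<open>t v\<close>.\<close>
    let ?cs = "cs1 @ (T, cj k t) # (V, cj k v) # cs2"
    have "reach B ((a, xa) # ?cs @ [(b, xb)])"
      using uv(2) rM reach_trans unfolding e by auto
    moreover have "commute (cj k t) y" if y: "y \<in> snd ` set ?cs" for y
    proof -
      have "y = cj k t \<or> y = cj k v \<or> y \<in> snd ` set cs" using y unfolding cs by auto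
      then have "commute t' y" using IH(3) ct unfolding e by auto
      moreover have "commute t' (cj k t)" "\<not> central t'" unfolding e using ct tvnc by auto
      ultimately show ?thesis using commute_trans by blast
    qed
    moreover have "\<not> finite_order (cj k t)" using less.prems(7) by simp
    moreover have "(T, cj k t) \<in> set ?cs" by simp
    ultimately show ?thesis by blast
  qed
qed

section \<open>Two commuting elements between noncommuting pairs\<close>

text \<open>Here \<open>t d = (w e)\<^sup>-\<^sup>1\<close> commutes with all four elements.\<close>

lemma four_commute:
  fixes t d w e :: "'g::ct_grp"
  assumes "t * d * w * e = 1" "commute t d" "commute w e" "\<not> central (t * d)"
  shows "all_commute [(i, t), (j, d), (k, w), (l, e)]"
proof -
  have inv: "inverse (t * d) = w * e" using assms(1) by (intro inv_unique) (simp add: mult.assoc)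
  have "commute (t * d) t" "commute (t * d) d" using assms(2)
    by (auto intro!: commute_mult' intro: commute_sym)
  moreover have "commute (w * e) w" "commute (w * e) e" using assms(3)
    by (auto intro!: commute_mult' intro: commute_sym)
  then have "commute (t * d) w" "commute (t * d) e"
    unfolding inv[symmetric] by (metis commute_inverse' inv_inv)+
  ultimately have "commute (t * d) x" if "x \<in> {t, d, w, e}" for x using that by blast
  then show ?thesis unfolding all_commute_def using commute_trans[OF assms(4)] by simp
qed

interpretation C: action "UNIV :: 'g::grp set" "cjl :: 'g \<Rightarrow> ('i \<times> 'g) list \<Rightarrow> ('i \<times> 'g) list"
  by standard (auto simp: cjl_cjl)

text \<open>Tuples with a given order of labels, without a frame. Their classes can be represented
  by tuples framed at any chosen label, which makes counts in different frames comparable.\<close>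

definition word_set :: "('i \<times> 'g::grp) list \<Rightarrow> 'i list \<Rightarrow> ('i \<times> 'g) list set" where
  "word_set B w = {L. reach B L \<and> map fst L = w}"

lemma length_four: "map fst L = [i, j, k, l] \<longleftrightarrow> (\<exists>x y z w. L = [(i, x), (j, y), (k, z), (l, w)])"
  by (auto simp: map_eq_Cons_conv)

lemma infinite_times_finite_order:
  assumes "commute t d" "finite_order d" "\<not> finite_order t"
  shows "\<not> finite_order (t * d)"
proof
  assume fo: "finite_order (t * d)"
  have "commute (t * d) (inverse d)" using assms(1) by (intro commute_inverse) (auto intro: commute_mult')
  then have "finite_order (t * d * inverse d)" using finite_order_mult[of "t * d" "inverse d"] fo assms(2) by simp
  then show False using assms(3) by (simp add: mult.assoc)
qed

text \<open>Two commuting elements \<open>p\<close>, \<open>y\<close> stand between pairs with noncommuting members. The pairs are merged into \<open>d\<close> and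
  \<open>e\<close> for the counting; that they come from pairs makes \<open>d\<close> and \<open>e\<close> elements of finite order, by
  the twisting argument, and keeps \<open>p\<close>, if it has infinite order, from ever commuting with them as a neighbour. The label of a merged pair is that of its first
  member, so \<open>a\<close> labels \<open>d\<close> and \<open>m\<close> labels \<open>e\<close>.\<close>

locale quad =
  fixes a l P Y m b :: 'i and xa xl p y xm xb :: sl2
  assumes fin6: "finite_orbit [(a, xa), (l, xl), (P, p), (Y, y), (m, xm), (b, xb)]"
    and dist: "distinct [a, l, P, Y, m, b]"
    and prod6: "xa * xl * p * y * xm * xb = 1"
    and nc_left: "\<not> commute xa xl" and nc_right: "\<not> commute xm xb"
    and comm: "commute p y" and p_nc: "\<not> central p" and y_nc: "\<not> central y"
    and moves: "\<not> commute p (cj (xa * xl) p)"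
begin

definition d where "d = xa * xl"
definition e where "e = xm * xb"
definition Q where "Q = [(a, d), (P, p), (Y, y), (m, e)]"
definition Ql where "Ql = [(a, xa), (l, xl), (P, p), (Y, y), (m, e)]"
definition Qr where "Qr = [(a, d), (P, p), (Y, y), (m, xm), (b, xb)]"

lemma finite_orbits: "finite_orbit Ql" "finite_orbit Qr" "finite_orbit Q"
proof -
  show l: "finite_orbit Ql"
    using finite_orbit_merge[of "[(a, xa), (l, xl), (P, p), (Y, y)]" m xm b xb "[]"] fin6 dist
    by (simp add: Ql_def e_def)
  show "finite_orbit Qr"
    using finite_orbit_merge[of "[]" a xa l xl "[(P, p), (Y, y), (m, xm), (b, xb)]"] fin6 dist
    by (simp add: Qr_def d_def)
  show "finite_orbit Q"
    using finite_orbit_merge[of "[]" a xa l xl "[(P, p), (Y, y), (m, e)]"] l dist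
    by (simp add: Q_def Ql_def d_def)
qed

lemma finite_order_d: "finite_order d"
  using pair_finite_order[OF fin6, of "[]" a xa l xl "[(P, p), (Y, y), (m, xm), (b, xb)]" xm xb]
    nc_left nc_right by (simp add: d_def reach.start)

lemma finite_order_e: "finite_order e"
  using pair_finite_order[OF fin6, of "[(a, xa), (l, xl), (P, p), (Y, y)]" m xm b xb "[]" xa xl]
    nc_left nc_right by (simp add: e_def reach.start)

lemma prod_Q: "lprod Q = 1"
  using prod6 by (simp add: Q_def d_def e_def mult.assoc)

lemma not_all_commute_Q: "\<not> all_commute Q"
proof
  assume "all_commute Q"
  then have "commute d p" by (auto simp: all_commute_def Q_def)
  then show False using moves by (simp add: d_def cj_self)
qed

lemma entries_Q:
  assumes "reach Q L"
  shows "(a, x) \<in> set L \<Longrightarrow> \<exists>g. x = cj g d" "(m, x) \<in> set L \<Longrightarrow> \<exists>g. x = cj g e"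
    "(P, x) \<in> set L \<Longrightarrow> \<exists>g. x = cj g p" "(Y, x) \<in> set L \<Longrightarrow> \<exists>g. x = cj g y"
  using reach_entry[OF assms] dist by (fastforce simp: Q_def)+

text \<open>Otherwise \<open>t d'\<close> has infinite order and is inverse to \<open>w e'\<close>. If \<open>w\<close> and \<open>e'\<close>
  commute, then all four elements do. If not, the twisting argument applies to \<open>w\<close> and \<open>e'\<close>, because
  unfolding \<open>d'\<close> provides a noncommuting pair elsewhere, and \<open>w e'\<close> has finite order.\<close>

lemma not_commute_left:
  assumes r: "reach Q [(P, t), (a, d'), (Y, w), (m, e')]" and inf: "\<not> finite_order p"
  shows "\<not> commute t d'"
proof
  assume c: "commute t d'"
  let ?L = "[(P, t), (a, d'), (Y, w), (m, e')]"
  have t: "\<not> finite_order t" and d': "finite_order d'"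
    using entries_Q(3)[OF r, of t] entries_Q(1)[OF r, of d'] inf finite_order_d by auto
  have td: "\<not> finite_order (t * d')" by (rule infinite_times_finite_order[OF c d' t])
  have prod: "t * d' * w * e' = 1" using reach_prod[OF r prod_Q] by (simp add: mult.assoc)
  show False
  proof (cases "commute w e'")
    case True
    have "\<not> central (t * d')" using td central_finite_order by blast
    then have "all_commute ?L" by (rule four_commute[OF prod c True])
    then show False using all_commute_reach[OF r] not_all_commute_Q by blast
  next
    case False
    have rl: "reach ([] @ (a, xa * xl) # [(P, p), (Y, y), (m, e)]) ?L" using r by (simp add: Q_def d_def)
    obtain xs ys k where L: "?L = xs @ (a, cj k (xa * xl)) # ys"
      "reach ([] @ (a, xa) # (l, xl) # [(P, p), (Y, y), (m, e)]) (xs @ (a, cj k xa) # (l, cj k xl) # ys)"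
      using reach_merge[OF rl, of l] dist by auto
    have eq: "[(P, t)] @ (a, d') # [(Y, w), (m, e')] = xs @ (a, cj k (xa * xl)) # ys" using L(1) by simp
    have dd: "distinct (map fst ([(P, t)] @ (a, d') # [(Y, w), (m, e')]))" using dist by auto
    have "xs = [(P, t)]" "ys = [(Y, w), (m, e')]"
      using split_unique[OF eq dd] by simp_all
    then have "reach Ql ([(P, t), (a, cj k xa), (l, cj k xl)] @ (Y, w) # (m, e') # [])"
      using L(2) by (simp add: Ql_def)
    then have "finite_order (w * e')"
      by (rule pair_finite_order[OF finite_orbits(1) _ False, of _ _ _ _ "cj k xa" "cj k xl"])
        (use nc_left in auto)
    moreover have "t * d' = inverse (w * e')"
      using inv_unique[of "t * d'" "w * e'"] prod by (simp add: mult.assoc) (metis inv_inv)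
    ultimately show False using td by simp
  qed
qed

text \<open>The mirror image of \<open>not_commute_left\<close>.\<close>

lemma not_commute_right:
  assumes r: "reach Q [(a, d'), (Y, w), (P, t), (m, e')]" and inf: "\<not> finite_order p"
  shows "\<not> commute t e'"
proof
  assume c: "commute t e'"
  let ?L = "[(a, d'), (Y, w), (P, t), (m, e')]"
  have t: "\<not> finite_order t" and e': "finite_order e'"
    using entries_Q(3)[OF r, of t] entries_Q(2)[OF r, of e'] inf finite_order_e by auto
  have te: "\<not> finite_order (t * e')" by (rule infinite_times_finite_order[OF c e' t])
  have prod: "d' * w * t * e' = 1" using reach_prod[OF r prod_Q] by (simp add: mult.assoc)
  then have inv: "t * e' = inverse (d' * w)"
    using inv_unique[of "d' * w" "t * e'"] by (simp add: mult.assoc)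
  have dw: "\<not> finite_order (d' * w)" using te unfolding inv by simp
  show False
  proof (cases "commute d' w")
    case True
    have "\<not> central (d' * w)" using dw central_finite_order by blast
    then have "all_commute ?L" by (rule four_commute[OF prod True c])
    then show False using all_commute_reach[OF r] not_all_commute_Q by blast
  next
    case False
    have rl: "reach ([(a, d), (P, p), (Y, y)] @ (m, xm * xb) # []) ?L" using r by (simp add: Q_def e_def)
    obtain xs ys k where L: "?L = xs @ (m, cj k (xm * xb)) # ys"
      "reach ([(a, d), (P, p), (Y, y)] @ (m, xm) # (b, xb) # []) (xs @ (m, cj k xm) # (b, cj k xb) # ys)"
      using reach_merge[OF rl, of b] dist by auto
    have eq: "[(a, d'), (Y, w), (P, t)] @ (m, e') # [] = xs @ (m, cj k (xm * xb)) # ys" using L(1) by simp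
    have dd: "distinct (map fst ([(a, d'), (Y, w), (P, t)] @ (m, e') # []))" using dist by auto
    have "xs = [(a, d'), (Y, w), (P, t)]" "ys = []"
      using split_unique[OF eq dd] by simp_all
    then have "reach Qr ([] @ (a, d') # (Y, w) # [(P, t), (m, cj k xm), (b, cj k xb)])"
      using L(2) by (simp add: Qr_def)
    then have "finite_order (d' * w)"
      by (rule pair_finite_order[OF finite_orbits(2) _ False, of _ _ _ _ "cj k xm" "cj k xb"])
        (use nc_right in auto)
    then show False using dw by simp
  qed
qed

text \<open>Only crossings of \<open>p\<close> with the element labelled \<open>Y\<close> can be events, by the two
  preceding lemmas. The product over framed classes is rewritten as one over representatives \<open>F\<close> of
  all classes of the word \<open>a P Y m\<close>.\<close>

lemma mass_formula_four:
  fixes \<kappa> :: "sl2 \<Rightarrow> complex"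
  assumes inf: "\<not> finite_order p"
    and \<kappa>: "\<And>z w. commute z p \<Longrightarrow> commute w p \<Longrightarrow> \<kappa> (z * w) = \<kappa> z * \<kappa> w"
      "\<And>z. central z \<Longrightarrow> \<kappa> z = 1"
    and F: "C.transversal (word_set Q [a, P, Y, m]) F" "\<And>L. L \<in> F \<Longrightarrow> L ! 1 = (P, p)"
  shows "(\<Prod>L\<in>F. if commute p (snd (L ! 2)) then \<kappa> (p * snd (L ! 2)) else 1) = \<kappa> p ^ card F"
proof -
  interpret braid_frame Q P p \<kappa>
    by standard (use finite_orbits prod_Q not_all_commute_Q \<kappa> in auto)
  have rP: "reach Q ((P, p) # [(a, cj (inverse p) d), (Y, y), (m, e)])"
    using reach.under[of Q "[]" a d P p "[(Y, y), (m, e)]"] reach.start[of Q] by (simp add: Q_def)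
  let ?q = "[a, Y, m]" and ?N = "card (R [a] [Y, m])"
  have N: "card (R [] ?q) = ?N" using card_R_Cons[of "[]" a "[Y, m]"] by simp
  have mass: "\<kappa> p ^ (2 * ?N) * events [] ?q = \<kappa> p ^ (length ?q * ?N)"
    unfolding N[symmetric] by (rule mass_formula[OF rP]) simp
  have no1: "\<not> event x" if "x \<in> R [] [a, Y, m]" for x
  proof -
    have "x \<in> S [] [a, Y, m]" using that R unfolding P.transversal_def by blast
    then obtain d' w e' where x: "x = ([], [(a, d'), (Y, w), (m, e')])" "reach Q [(P, p), (a, d'), (Y, w), (m, e')]"
      by (auto simp: S_def map_eq_Cons_conv)
    show ?thesis using not_commute_left[OF x(2) inf] by (simp add: x(1) event_def next_value_def)
  qed
  have no3: "\<not> event x" if "x \<in> R [a, Y] [m]" for x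
  proof -
    have "x \<in> S [a, Y] [m]" using that R unfolding P.transversal_def by blast
    then obtain d' w e' where x: "x = ([(a, d'), (Y, w)], [(m, e')])" "reach Q [(a, d'), (Y, w), (P, p), (m, e')]"
      by (auto simp: S_def map_eq_Cons_conv)
    show ?thesis using not_commute_right[OF x(2) inf] by (simp add: x(1) event_def next_value_def)
  qed
  let ?f = "\<lambda>x. if event x then \<kappa> (p * next_value x) else 1"
  have "(\<Prod>x\<in>R [] [a, Y, m]. ?f x) = 1" "(\<Prod>x\<in>R [a, Y] [m]. ?f x) = 1"
    using no1 no3 by (auto intro!: prod.neutral)
  then have "events [] ?q = (\<Prod>x\<in>R [a] [Y, m]. ?f x)" by simp
  then have "\<kappa> p ^ (2 * ?N) * (\<Prod>x\<in>R [a] [Y, m]. ?f x) = \<kappa> p ^ (2 * ?N) * \<kappa> p ^ ?N"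
    using mass by (simp add: power_add mult_2 del: events.simps)
  then have fR: "(\<Prod>x\<in>R [a] [Y, m]. ?f x) = \<kappa> p ^ ?N"
    using char_nz[OF t_in_Z] by simp
  \<comment> \<open>Removing \<open>p\<close> at position 1 turns a list framed at \<open>p\<close> into a framed configuration.\<close>
  define j where "j L = (take 1 L, drop 2 L)" for L :: "('i \<times> sl2) list"
  have FL: "\<exists>d' w e'. L = [(a, d'), (P, p), (Y, w), (m, e')] \<and> reach Q L" if "L \<in> F" for L
  proof -
    have "L \<in> word_set Q [a, P, Y, m]" using F(1) that unfolding C.transversal_def by blast
    then show ?thesis using F(2)[OF that] by (auto simp: word_set_def map_eq_Cons_conv)
  qed
  have inj: "inj_on j F"
  proof (rule inj_onI)
    fix L M assume LM: "L \<in> F" "M \<in> F" "j L = j M"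
    then show "L = M" using FL[OF LM(1)] FL[OF LM(2)] by (auto simp: j_def)
  qed
  have jS: "j ` F \<subseteq> S [a] [Y, m]"
  proof (rule image_subsetI)
    fix L assume "L \<in> F"
    then show "j L \<in> S [a] [Y, m]" using FL[of L] by (auto simp: j_def S_def)
  qed
  have tr: "P.transversal (S [a] [Y, m]) (j ` F)"
    unfolding P.transversal_def
  proof (intro conjI ballI)
    show "finite (j ` F)" using F(1) unfolding C.transversal_def by blast
    show "j ` F \<subseteq> S [a] [Y, m]" by (rule jS)
    fix x assume "x \<in> S [a] [Y, m]"
    then obtain d1 w1 e1 where x: "x = ([(a, d1)], [(Y, w1), (m, e1)])" "reach Q [(a, d1), (P, p), (Y, w1), (m, e1)]"
      by (auto simp: S_def map_eq_Cons_conv)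
    let ?L = "[(a, d1), (P, p), (Y, w1), (m, e1)]"
    have rel: "P.rel (j M) x \<longleftrightarrow> C.rel M ?L" if M: "M \<in> F" for M
    proof -
      obtain d' w e' where M': "M = [(a, d'), (P, p), (Y, w), (m, e')]" using FL[OF M] by blast
      show ?thesis unfolding P.rel_def C.rel_def M' x(1) j_def
        by (auto simp: pc_def Z_def numeral_2_eq_2 cj_fix[symmetric] eq_commute[of p])
    qed
    have "?L \<in> word_set Q [a, P, Y, m]" using x(2) by (simp add: word_set_def)
    then obtain M where M: "M \<in> F" "C.rel M ?L" "\<And>M'. M' \<in> F \<Longrightarrow> C.rel M' ?L \<Longrightarrow> M' = M"
      using F(1) unfolding C.transversal_def by metis
    show "\<exists>!r. r \<in> j ` F \<and> P.rel r x"
    proof (rule ex1I[of _ "j M"])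
      show "j M \<in> j ` F \<and> P.rel (j M) x" using M rel by blast
      fix r assume "r \<in> j ` F \<and> P.rel r x"
      then obtain M' where "M' \<in> F" "r = j M'" "P.rel (j M') x" by blast
      then show "r = j M" using M(3)[of M'] rel[of M'] by simp
    qed
  qed
  have F_inv: "?f (pc z x) = ?f x" if "x \<in> S [a] [Y, m]" "z \<in> Z" for x z
  proof -
    have "event x \<Longrightarrow> next_value (pc z x) = next_value x"
      using next_value_pc[OF that(1)] that(2) commute_trans[OF p_nc]
      by (auto simp: event_def Z_def intro!: cj_self) (metis commute_sym)
    then show ?thesis using event_pc[OF that] by simp
  qed
  have re: "(\<Prod>x\<in>j ` F. ?f x) = (\<Prod>x\<in>R [a] [Y, m]. ?f x)" "card (j ` F) = ?N"
    using P.prod_reindex[OF tr R, where f = "\<lambda>x. x" and F = ?f] F_inv P.rel_refl by blast+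
  have "(\<Prod>L\<in>F. if commute p (snd (L ! 2)) then \<kappa> (p * snd (L ! 2)) else 1) = (\<Prod>x\<in>j ` F. ?f x)"
    unfolding prod.reindex[OF inj] comp_def
  proof (rule prod.cong)
    fix L assume "L \<in> F"
    then obtain d' w e' where "L = [(a, d'), (P, p), (Y, w), (m, e')]" using FL by blast
    then show "(if commute p (snd (L ! 2)) then \<kappa> (p * snd (L ! 2)) else 1) = ?f (j L)"
      by (simp add: j_def event_def next_value_def)
  qed simp
  then show ?thesis using re fR card_image[OF inj] by simp
qed

text \<open>Conjugate each representative so that its element labelled \<open>P\<close> becomes \<open>p\<close>.\<close>

lemma framed_transversal: "\<exists>F. C.transversal (word_set Q [a, P, Y, m]) F \<and> (\<forall>L\<in>F. L ! 1 = (P, p))"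
proof -
  let ?W = "word_set Q [a, P, Y, m]"
  obtain K where K: "finite K" "\<And>L. reach Q L \<Longrightarrow> \<exists>M\<in>K. \<exists>g. L = cjl g M"
    using finite_orbits(3) unfolding finite_orbit_def by blast
  have "\<exists>R. C.transversal ?W R"
  proof (rule C.transversal_exists[of K _ "\<lambda>M L. C.rel M L"])
    show "\<exists>k\<in>K. C.rel k L" if "L \<in> ?W" for L
      using K(2)[of L] that unfolding word_set_def C.rel_def by blast
  qed (use K(1) C.rel_sym C.rel_trans in blast)+
  then obtain R where R: "C.transversal ?W R" by blast
  have "\<exists>g. cjl g L ! 1 = (P, p)" if "L \<in> R" for L
  proof -
    have "L \<in> ?W" using that R unfolding C.transversal_def by blast
    then obtain d' t w e' where L: "L = [(a, d'), (P, t), (Y, w), (m, e')]" "reach Q L"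
      by (auto simp: word_set_def map_eq_Cons_conv)
    then obtain g where "t = cj g p" using entries_Q(3)[OF L(2), of t] by auto
    then have "cjl (inverse g) L ! 1 = (P, p)" by (simp add: L(1))
    then show ?thesis by blast
  qed
  then obtain c where c: "\<And>L. L \<in> R \<Longrightarrow> cjl (c L) L ! 1 = (P, p)" by metis
  let ?h = "\<lambda>L. cjl (c L) L"
  have hW: "?h L \<in> ?W" if "L \<in> ?W" for L using that reach.conj by (auto simp: word_set_def)
  have rel: "C.rel (?h L) M \<longleftrightarrow> C.rel L M" for L M
    using C.rel_sym C.rel_trans unfolding C.rel_def by (metis UNIV_I cjl_inv(1))
  have "C.transversal ?W (?h ` R)"
    unfolding C.transversal_def
  proof (intro conjI ballI)
    fix L assume "L \<in> ?W"
    then obtain r where r: "r \<in> R" "C.rel r L" "\<And>r'. r' \<in> R \<Longrightarrow> C.rel r' L \<Longrightarrow> r' = r"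
      using R unfolding C.transversal_def by metis
    show "\<exists>!s. s \<in> ?h ` R \<and> C.rel s L"
    proof (rule ex1I[of _ "?h r"])
      show "?h r \<in> ?h ` R \<and> C.rel (?h r) L" using r rel by blast
      fix s assume "s \<in> ?h ` R \<and> C.rel s L"
      then obtain r' where "r' \<in> R" "s = ?h r'" "C.rel (?h r') L" by blast
      then show "s = ?h r" using r(3)[of r'] rel[of r'] by simp
    qed
  qed (use R hW in \<open>auto simp: C.transversal_def\<close>)
  then show ?thesis using c by blast
qed

end

section \<open>The semisimple case\<close>

text \<open>The move that turns the word \<open>a P Y m\<close> into \<open>a Y P m\<close>; lists of other lengths stay as they are.\<close>

fun swap_middle :: "('i \<times> 'g::grp) list \<Rightarrow> ('i \<times> 'g) list" where
  "swap_middle [(i, d), (j, x), (k, y), (l, e)] = [(i, d), (k, cj x y), (j, x), (l, e)]"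
| "swap_middle L = L"

text \<open>The centralizer of \<open>t\<close> is also the centralizer of each of its noncentral elements \<open>p\<close>.\<close>

lemma moves_transfer:
  fixes t p x :: "'g::ct_grp"
  assumes "\<not> commute t (cj x t)" "\<not> central t" "commute t p" "\<not> central p"
  shows "\<not> commute p (cj x p)"
proof
  assume "commute p (cj x p)"
  then have "commute t (cj x p)" using commute_trans[OF assms(4) commute_sym[OF assms(3)]] by blast
  then have "commute (cj x p) t" by (rule commute_sym)
  moreover have "commute (cj x p) (cj x t)" using assms(3) by (simp add: commute_sym)
  moreover have "\<not> central (cj x p)" using assms(4) by simp
  ultimately show False using commute_trans assms(1) by blast
qed

context quad
begin

lemma swapped: "quad a l Y P m b xa xl y p xm xb"
proof
  have "reach [(a, xa), (l, xl), (P, p), (Y, y), (m, xm), (b, xb)]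
      ([(a, xa), (l, xl)] @ (P, p) # (Y, y) # [(m, xm), (b, xb)])"
    by (simp add: reach.start)
  from reach_swap[OF this comm]
  have "reach [(a, xa), (l, xl), (P, p), (Y, y), (m, xm), (b, xb)]
      [(a, xa), (l, xl), (Y, y), (P, p), (m, xm), (b, xb)]" by simp
  then show "finite_orbit [(a, xa), (l, xl), (Y, y), (P, p), (m, xm), (b, xb)]"
    using finite_orbit_reach[OF fin6] by blast
  show "distinct [a, l, Y, P, m, b]" using dist by auto
  show "xa * xl * y * p * xm * xb = 1" using prod6 comm by (metis commute_def mult.assoc)
  show "commute y p" using comm by (rule commute_sym)
  show "\<not> commute y (cj (xa * xl) y)" by (rule moves_transfer[OF moves p_nc comm y_nc])
qed (use nc_left nc_right p_nc y_nc in auto)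

lemma word_set_swapped: "word_set (quad.Q a Y P m xa xl y p xm xb) w = word_set Q w"
proof -
  interpret sw: quad a l Y P m b xa xl y p xm xb by (rule swapped)
  have 1: "reach Q sw.Q" using reach_swap[of Q "[(a, d)]" P p Y y "[(m, e)]"] comm reach.start[of Q]
    by (simp add: Q_def sw.Q_def d_def e_def sw.d_def sw.e_def)
  have 2: "reach sw.Q Q" using reach_swap[of sw.Q "[(a, d)]" Y y P p "[(m, e)]"] comm reach.start[of sw.Q]
    by (simp add: Q_def sw.Q_def d_def e_def sw.d_def sw.e_def commute_commute)
  show ?thesis unfolding word_set_def using 1 2 reach_trans by blast
qed

lemma word_setD:
  assumes "L \<in> word_set Q [a, P, Y, m]"
  obtains d' t w e' where "L = [(a, d'), (P, t), (Y, w), (m, e')]" "reach Q L"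
  using assms by (auto simp: word_set_def map_eq_Cons_conv)

text \<open>The same classes seen from both commuting elements: \<open>F\<close> is framed at \<open>p\<close>, \<open>G\<close> at \<open>y\<close>, and
  \<open>f\<close> matches them in such a way that events correspond to events.\<close>

lemma two_frames:
  obtains F G f where
    "C.transversal (word_set Q [a, P, Y, m]) F" "\<And>L. L \<in> F \<Longrightarrow> L ! 1 = (P, p)"
    "C.transversal (word_set Q [a, Y, P, m]) G" "\<And>L. L \<in> G \<Longrightarrow> L ! 1 = (Y, y)"
    "bij_betw f F G" "\<And>L. L \<in> F \<Longrightarrow> \<exists>d' w e' g. L = [(a, d'), (P, p), (Y, w), (m, e')] \<and> reach Q L \<and>
      f L = [(a, cj g d'), (Y, y), (P, cj g p), (m, cj g e')] \<and> y = cj g (cj p w) \<and>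
      (commute y (cj g p) \<longleftrightarrow> commute p w)"
proof -
  interpret sw: quad a l Y P m b xa xl y p xm xb by (rule swapped)
  obtain F where F: "C.transversal (word_set Q [a, P, Y, m]) F" "\<And>L. L \<in> F \<Longrightarrow> L ! 1 = (P, p)"
    using framed_transversal by blast
  obtain G where G: "C.transversal (word_set Q [a, Y, P, m]) G" "\<And>L. L \<in> G \<Longrightarrow> L ! 1 = (Y, y)"
    using sw.framed_transversal unfolding word_set_swapped by blast
  have sw_in: "swap_middle L \<in> word_set Q [a, Y, P, m]" if L: "L \<in> word_set Q [a, P, Y, m]" for L
  proof -
    obtain d' t w e' where L': "L = [(a, d'), (P, t), (Y, w), (m, e')]" "reach Q L"
      using word_setD[OF L] .
    have "reach Q ([(a, d')] @ (Y, cj t w) # (P, t) # [(m, e')])"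
      using L' by (intro reach.over) simp
    then show ?thesis by (simp add: word_set_def L'(1))
  qed
  have sw_rel: "C.rel (swap_middle L) (swap_middle M) \<longleftrightarrow> C.rel L M"
    if L: "L \<in> word_set Q [a, P, Y, m]" and M: "M \<in> word_set Q [a, P, Y, m]" for L M
  proof -
    obtain d' t w e' where L': "L = [(a, d'), (P, t), (Y, w), (m, e')]" using word_setD[OF L] .
    obtain d'' t' w' e'' where M': "M = [(a, d''), (P, t'), (Y, w'), (m, e'')]" using word_setD[OF M] .
    have "cj (cj g t) w' = cj g (cj t w) \<longleftrightarrow> w' = cj g w" for g
    proof -
      have "cj g (cj t w) = cj (cj g t) (cj g w)" by (simp add: cj_of_cj)
      then show ?thesis by simp
    qed
    then show ?thesis unfolding C.rel_def L' M' by auto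
  qed
  have sw_surj: "\<exists>L\<in>word_set Q [a, P, Y, m]. C.rel (swap_middle L) M"
    if MW: "M \<in> word_set Q [a, Y, P, m]" for M
  proof -
    obtain d' w t e' where M: "M = [(a, d'), (Y, w), (P, t), (m, e')]" "reach Q M"
      using MW unfolding word_set_def mem_Collect_eq length_four by blast
    have "reach Q ([(a, d')] @ (P, t) # (Y, cj (inverse t) w) # [(m, e')])"
      using M by (intro reach.under) simp
    then have "[(a, d'), (P, t), (Y, cj (inverse t) w), (m, e')] \<in> word_set Q [a, P, Y, m]"
      by (simp add: word_set_def)
    moreover have "swap_middle [(a, d'), (P, t), (Y, cj (inverse t) w), (m, e')] = M"
      by (simp add: M(1))
    ultimately show ?thesis using C.rel_refl by metis
  qed
  obtain f where f: "bij_betw f F G" "\<And>L. L \<in> F \<Longrightarrow> C.rel (f L) (swap_middle L)"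
    using C.transversal_bij[OF F(1) G(1) sw_in sw_rel sw_surj] by blast
  show thesis
  proof (rule that[OF F G f(1)])
    fix L assume L: "L \<in> F"
    have "L \<in> word_set Q [a, P, Y, m]" using F(1) L unfolding C.transversal_def by blast
    then obtain d' w e' where L': "L = [(a, d'), (P, p), (Y, w), (m, e')]" "reach Q L"
      using F(2)[OF L] by (auto elim!: word_setD)
    obtain g where g: "f L = cjl g (swap_middle L)"
      using C.rel_sym[OF f(2)[OF L]] unfolding C.rel_def by blast
    have fL: "f L = [(a, cj g d'), (Y, cj g (cj p w)), (P, cj g p), (m, cj g e')]" using g by (simp add: L'(1))
    have "f L \<in> G" using f(1) L by (auto simp: bij_betw_def)
    then have y: "y = cj g (cj p w)" using G(2) unfolding fL by fastforce
    have "commute y (cj g p) \<longleftrightarrow> commute (cj p w) (cj p p)"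
      unfolding y by (simp add: cj_self del: commute_cj) (simp add: cj_self)
    also have "\<dots> \<longleftrightarrow> commute p w" unfolding commute_cj by (rule commute_commute)
    finally show "\<exists>d' w e' g. L = [(a, d'), (P, p), (Y, w), (m, e')] \<and> reach Q L \<and>
      f L = [(a, cj g d'), (Y, y), (P, cj g p), (m, cj g e')] \<and> y = cj g (cj p w) \<and>
      (commute y (cj g p) \<longleftrightarrow> commute p w)" using L' fL y by blast
  qed
qed

text \<open>After a twist of \<open>d\<close> with \<open>p\<close>, the middle elements no longer commute, since \<open>d\<close> moves \<open>p\<close>
  out of its centralizer.\<close>

lemma non_event:
  assumes "C.transversal (word_set Q [a, P, Y, m]) F"
  obtains L where "L \<in> F" "\<not> commute (snd (L ! 1)) (snd (L ! 2))"
proof -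
  have "reach Q ([] @ (a, cj (d * p) d) # (P, cj (d * p) p) # [(Y, y), (m, e)])"
    by (rule reach_twist) (simp add: Q_def[symmetric] reach.start)
  then have "[(a, cj (d * p) d), (P, cj (d * p) p), (Y, y), (m, e)] \<in> word_set Q [a, P, Y, m]"
    (is "?M \<in> _") by (simp add: word_set_def)
  then obtain L where L: "L \<in> F" "C.rel ?M L"
    using assms C.rel_sym unfolding C.transversal_def by metis
  then obtain g where g: "L = cjl g ?M" unfolding C.rel_def by blast
  have "\<not> commute (cj (d * p) p) y"
  proof
    have "cj (d * p) p = cj d p" by (simp add: cj_self flip: cj_cj)
    moreover assume "commute (cj (d * p) p) y"
    ultimately have "commute y (cj d p)" by (simp add: commute_sym)
    then have "commute p (cj d p)" using commute_trans[OF y_nc commute_sym[OF comm]] by blast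
    then show False using moves by (simp add: d_def)
  qed
  then show thesis using that[OF L(1)] by (simp add: g)
qed

lemma base_event:
  assumes "C.transversal (word_set Q [a, P, Y, m]) F"
  obtains L where "L \<in> F" "commute (snd (L ! 1)) (snd (L ! 2))"
proof -
  have "Q \<in> word_set Q [a, P, Y, m]" by (simp add: word_set_def reach.start Q_def)
  then obtain L where L: "L \<in> F" "C.rel Q L"
    using assms C.rel_sym unfolding C.transversal_def by metis
  then obtain g where g: "L = cjl g Q" unfolding C.rel_def by blast
  show thesis using that[OF L(1)] comm by (simp add: g Q_def)
qed

text \<open>An element \<open>w\<close> labelled \<open>Y\<close> is conjugate to \<open>y\<close>. At an event it is moreover diagonal, so it is
  \<open>y\<close> or \<open>y\<^sup>-\<^sup>1\<close>, and the mass formula for the squared eigenvalue becomes a relation between the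
  eigenvalues of \<open>p\<close> and \<open>y\<close>.\<close>

lemma diagonal_product:
  assumes diag: "e21 p = 0" "e12 p = 0" and y: "e21 y = 0" "e12 y = 0"
    and inf: "\<not> finite_order p"
    and F: "C.transversal (word_set Q [a, P, Y, m]) F" "\<And>L. L \<in> F \<Longrightarrow> L ! 1 = (P, p)"
  shows "e11 p ^ (2 * (card F - card {L \<in> F. commute p (snd (L ! 2))})) *
      e11 y ^ (2 * card {L \<in> F. commute p (snd (L ! 2)) \<and> snd (L ! 2) \<noteq> y}) =
      e11 y ^ (2 * card {L \<in> F. commute p (snd (L ! 2)) \<and> snd (L ! 2) = y})"
    and "card {L \<in> F. commute p (snd (L ! 2))} < card F"
proof -
  let ?w = "\<lambda>L. snd (L ! 2)"
  let ?E = "{L \<in> F. commute p (?w L)}"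
  let ?A = "{L \<in> F. commute p (?w L) \<and> ?w L = y}" and ?D = "{L \<in> F. commute p (?w L) \<and> ?w L \<noteq> y}"
  have fin: "finite F" using F(1) unfolding C.transversal_def by blast
  obtain L where "L \<in> F" "\<not> commute (snd (L ! 1)) (?w L)" using non_event[OF F(1)] .
  then have "L \<in> F - ?E" using F(2) by auto
  then show lt: "card ?E < card F" using fin by (intro psubset_card_mono) auto
  have ne: "e11 p \<noteq> e22 p" using p_nc diag by (auto simp: central_sl2)
  have dp: "e11 p * e22 p = 1" "e11 y * e22 y = 1" using det_sl2[of p] det_sl2[of y] diag y by auto
  have nz: "e11 p \<noteq> 0" "e11 y \<noteq> 0" using dp by auto
  have cm: "e12 z = 0" if "commute z p" for z
    using commute_diagonal[OF diag ne] that commute_sym by blast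
  have "(\<Prod>L\<in>F. if commute p (?w L) then (e11 (p * ?w L))\<^sup>2 else 1) = ((e11 p)\<^sup>2) ^ card F"
  proof (rule mass_formula_four[OF inf _ _ F])
    fix z :: sl2 assume "central z"
    then show "(e11 z)\<^sup>2 = 1" using det_sl2[of z] by (simp add: central_sl2 power2_eq_square)
  qed (use cm in \<open>auto simp: power_mult_distrib\<close>)
  also have "(\<Prod>L\<in>F. if commute p (?w L) then (e11 (p * ?w L))\<^sup>2 else 1) = (\<Prod>L\<in>?E. (e11 (p * ?w L))\<^sup>2)"
    using fin by (simp add: prod.If_cases Int_def)
  also have "\<dots> = (\<Prod>L\<in>?E. (e11 p)\<^sup>2 * (if ?w L = y then (e11 y)\<^sup>2 else inverse ((e11 y)\<^sup>2)))"
  proof (rule prod.cong)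
    fix L assume L: "L \<in> ?E"
    then have "L \<in> word_set Q [a, P, Y, m]" using F(1) unfolding C.transversal_def by blast
    then obtain d' t w e' where L': "L = [(a, d'), (P, t), (Y, w), (m, e')]" "reach Q L"
      by (rule word_setD)
    then obtain g where g: "w = cj g y" using entries_Q(4)[OF L'(2), of w] by auto
    have w: "e12 w = 0" "e21 w = 0" using L commute_diagonal[OF diag ne, of w] by (auto simp: L'(1))
    have "tr w = tr y" unfolding g by simp
    moreover have "e11 w * e22 w = 1" using det_sl2[of w] w by simp
    ultimately have "(e11 w - e11 y) * (e11 w - e22 y) = 0"
      using dp(2) unfolding tr_def by algebra
    then have "e11 w = e11 y \<or> e11 w = e22 y" by simp
    moreover have "e22 y = inverse (e11 y)" using dp(2) nz by (simp add: field_simps)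
    moreover have "w = y" if "e11 w = e11 y"
      using that \<open>tr w = tr y\<close> w y by (simp add: sl2_eq_iff tr_def)
    ultimately show "(e11 (p * ?w L))\<^sup>2 = (e11 p)\<^sup>2 * (if ?w L = y then (e11 y)\<^sup>2 else inverse ((e11 y)\<^sup>2))"
      using diag by (auto simp: L'(1) power_mult_distrib power_inverse)
  qed simp
  also have "\<dots> = ((e11 p)\<^sup>2) ^ card ?E * ((\<Prod>L\<in>?A. (e11 y)\<^sup>2) * (\<Prod>L\<in>?D. inverse ((e11 y)\<^sup>2)))"
    using fin by (simp add: prod.distrib prod.If_cases Int_def)
  finally have eq: "((e11 p)\<^sup>2) ^ card ?E * ((e11 y)\<^sup>2 ^ card ?A * inverse ((e11 y)\<^sup>2) ^ card ?D) = ((e11 p)\<^sup>2) ^ card F"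
    by simp
  also have "card F = card ?E + (card F - card ?E)" using lt by simp
  finally have "(e11 y)\<^sup>2 ^ card ?A * inverse ((e11 y)\<^sup>2) ^ card ?D = ((e11 p)\<^sup>2) ^ (card F - card ?E)"
    using nz by (simp add: power_add)
  then show "e11 p ^ (2 * (card F - card ?E)) * e11 y ^ (2 * card ?D) = e11 y ^ (2 * card ?A)"
    using nz by (simp add: power_mult field_simps power_inverse)
qed

text \<open>The relation of \<open>diagonal_product\<close> holds for \<open>p\<close> and for \<open>y\<close>, and by \<open>two_frames\<close>
  with the same exponents: with \<open>t\<close> and \<open>h\<close> the squared eigenvalues, \<open>t\<^sup>k = h\<^sup>s\<close> and
  \<open>h\<^sup>k = t\<^sup>s\<close>. As \<open>t\<close> is not a root of unity, \<open>k\<^sup>2 = s\<^sup>2\<close>, so \<open>t h\<close> or \<open>t / h\<close> is one.\<close>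

lemma diagonal_pair:
  assumes diag: "e21 p = 0" "e12 p = 0" and inf: "\<not> finite_order p"
  shows "finite_order (p * y) \<or> finite_order (p * inverse y)"
proof -
  interpret sw: quad a l Y P m b xa xl y p xm xb by (rule swapped)
  obtain F G f where F: "C.transversal (word_set Q [a, P, Y, m]) F" "\<And>L. L \<in> F \<Longrightarrow> L ! 1 = (P, p)"
    and G: "C.transversal (word_set Q [a, Y, P, m]) G" "\<And>L. L \<in> G \<Longrightarrow> L ! 1 = (Y, y)"
    and f: "bij_betw f F G" "\<And>L. L \<in> F \<Longrightarrow> \<exists>d' w e' g. L = [(a, d'), (P, p), (Y, w), (m, e')] \<and> reach Q L \<and>
      f L = [(a, cj g d'), (Y, y), (P, cj g p), (m, cj g e')] \<and> y = cj g (cj p w) \<and>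
      (commute y (cj g p) \<longleftrightarrow> commute p w)"
    by (rule two_frames) blast
  have ne: "e11 p \<noteq> e22 p" using p_nc diag by (auto simp: central_sl2)
  have y: "e21 y = 0" "e12 y = 0" using commute_diagonal[OF diag ne] comm by auto
  have dp: "e11 p * e22 p = 1" "e11 y * e22 y = 1" using det_sl2[of p] det_sl2[of y] diag y by auto
  let ?t = "e11 p" and ?h = "e11 y"
  have nz: "?t \<noteq> 0" "?h \<noteq> 0" using dp by auto
  let ?w = "\<lambda>L. snd (L ! 2)"
  let ?N = "card F" and ?n = "card {L \<in> F. commute p (?w L)}"
    and ?A = "card {L \<in> F. commute p (?w L) \<and> ?w L = y}"
    and ?D = "card {L \<in> F. commute p (?w L) \<and> ?w L \<noteq> y}"
  define k where "k = ?N - ?n"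
  have k: "?t ^ (2 * k) * ?h ^ (2 * ?D) = ?h ^ (2 * ?A)" "k > 0"
    using diagonal_product[OF diag y inf F] unfolding k_def by simp_all
  have t: "\<not> root_of_unity ?t" using inf diagonal_finite_order[OF diag] by simp
  have h: "\<not> root_of_unity ?h"
  proof
    assume "root_of_unity ?h"
    then have r: "root_of_unity (?h ^ j)" for j by (induction j) (auto intro: root_of_unity_mult)
    have "?t ^ (2 * k) = ?h ^ (2 * ?A) * inverse (?h ^ (2 * ?D))"
      using k(1) nz by (simp add: field_simps)
    then have "root_of_unity (?t ^ (2 * k))"
      using root_of_unity_mult[OF r root_of_unity_inverse[OF r]] by simp
    then show False using t k(2) root_of_unity_power[of "2 * k"] by simp
  qed
  have inf_y: "\<not> finite_order y" using h diagonal_finite_order[OF y] by simp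
  have fL: "commute y (?w (f L)) \<longleftrightarrow> commute p (?w L)" "commute p (?w L) \<Longrightarrow> ?w (f L) = p \<longleftrightarrow> ?w L = y"
    if L: "L \<in> F" for L
  proof -
    obtain d' w e' g where L': "L = [(a, d'), (P, p), (Y, w), (m, e')]" and yg: "y = cj g (cj p w)"
      and fLe: "f L = [(a, cj g d'), (Y, y), (P, cj g p), (m, cj g e')]"
      and cw: "commute y (cj g p) \<longleftrightarrow> commute p w" using f(2)[OF L] by blast
    have wf: "?w (f L) = cj g p" unfolding fLe by simp
    show "commute y (?w (f L)) \<longleftrightarrow> commute p (?w L)" unfolding wf cw by (simp add: L')
    assume "commute p (?w L)"
    then have pw: "commute p w" by (simp add: L')
    then have yg: "y = cj g w" using yg by (simp add: cj_self)
    have w_nc: "\<not> central w" using y_nc unfolding yg by simp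
    have "cj g p = p \<longleftrightarrow> commute g p" by (rule cj_fix)
    also have "\<dots> \<longleftrightarrow> commute g w"
      using commute_trans[OF p_nc, of g w] commute_trans[OF w_nc, of g p] pw commute_sym by blast
    also have "\<dots> \<longleftrightarrow> w = y" unfolding yg cj_fix[symmetric] by auto
    finally show "?w (f L) = p \<longleftrightarrow> ?w L = y" unfolding wf by (simp add: L')
  qed
  have cards: "card {L \<in> G. q L} = card {L \<in> F. q (f L)}" for q
  proof -
    have "bij_betw f {L \<in> F. q (f L)} {L \<in> G. q L}"
      using f(1) unfolding bij_betw_def by (auto simp: inj_on_def)
    then show ?thesis by (simp add: bij_betw_same_card)
  qed
  have N: "card G = ?N" using bij_betw_same_card[OF f(1)] by simp
  have c1: "card {L \<in> G. commute y (?w L)} = ?n"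
    unfolding cards using fL(1) by (metis (mono_tags, lifting))
  have c2: "card {L \<in> G. commute y (?w L) \<and> ?w L = p} = ?A"
    unfolding cards using fL by (metis (mono_tags, lifting))
  have c3: "card {L \<in> G. commute y (?w L) \<and> ?w L \<noteq> p} = ?D"
    unfolding cards using fL by (metis (mono_tags, lifting))
  have k': "?h ^ (2 * k) * ?t ^ (2 * ?D) = ?t ^ (2 * ?A)"
    using sw.diagonal_product(1)[OF y diag inf_y, unfolded word_set_swapped, OF G]
    unfolding N c1 c2 c3 k_def .
  define s :: int where "s = int ?A - int ?D"
  have I: "(?t powi 2) powi (int k) = (?h powi 2) powi s"
  proof -
    have "(?t powi 2) powi (int k) * (?h powi 2) powi (int ?D) = (?h powi 2) powi (int ?A)"
      using k(1) by (simp add: power_mult)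
    then show ?thesis using nz unfolding s_def by (simp add: power_int_diff field_simps)
  qed
  have II: "(?h powi 2) powi (int k) = (?t powi 2) powi s"
  proof -
    have "(?h powi 2) powi (int k) * (?t powi 2) powi (int ?D) = (?t powi 2) powi (int ?A)"
      using k' by (simp add: power_mult)
    then show ?thesis using nz unfolding s_def by (simp add: power_int_diff field_simps)
  qed
  have no_power: "j = 0" if "(?t powi 2) powi j = 1" for j :: int
  proof (rule ccontr)
    assume j: "j \<noteq> 0"
    have "(?t powi 2) powi \<bar>j\<bar> = 1" using that by (cases "j \<ge> 0") (simp_all add: power_int_minus)
    then have "?t ^ (2 * nat \<bar>j\<bar>) = 1"
      by (simp add: power_int_def power_mult split: if_splits)
    then show False using t j unfolding root_of_unity_def by (metis nat_0_less_mult_iff zero_less_abs_iff zero_less_nat_eq zero_less_numeral)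
  qed
  have "(?t powi 2) powi (int k * int k) = ((?t powi 2) powi int k) powi int k" by (simp add: power_int_mult)
  also have "\<dots> = ((?h powi 2) powi int k) powi s" unfolding I
    by (metis power_int_mult mult.commute)
  also have "\<dots> = (?t powi 2) powi (s * s)" unfolding II by (simp add: power_int_mult)
  finally have "(?t powi 2) powi (int k * int k - s * s) = 1"
    using nz by (simp add: power_int_diff)
  then have "int k * int k = s * s" using no_power by fastforce
  then have "s = int k \<or> s = - int k" by (metis square_eq_iff)
  then show ?thesis
  proof
    assume "s = int k"
    then have "?t ^ (2 * k) = ?h ^ (2 * k)" using I by (simp add: power_mult)
    then have "(?t * e22 y) ^ (2 * k) = (?h * e22 y) ^ (2 * k)" by (simp only: power_mult_distrib)
    then have "root_of_unity (?t * e22 y)" unfolding dp root_of_unity_def using k(2) by (intro exI[of _ "2 * k"]) simp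
    then show ?thesis using diagonal_finite_order[of "p * inverse y"] diag y by simp
  next
    assume "s = - int k"
    then have "?t ^ (2 * k) * ?h ^ (2 * k) = 1" using I nz by (simp add: power_mult power_int_minus)
    then have "root_of_unity (?t * ?h)" unfolding root_of_unity_def using k(2)
      by (intro exI[of _ "2 * k"]) (simp add: power_mult_distrib)
    then show ?thesis using diagonal_finite_order[of "p * y"] diag y by simp
  qed
qed

end

section \<open>The parabolic case\<close>

definition parabolic :: "sl2 \<Rightarrow> bool" where
  "parabolic c \<longleftrightarrow> \<not> central c \<and> (tr c)\<^sup>2 = 4"

lemma parabolic_cj [simp]: "parabolic (cj g c) \<longleftrightarrow> parabolic c"
  by (simp add: parabolic_def)

lemma parabolic_frame:
  assumes "parabolic c"
  obtains g where "e21 (cj g c) = 0" "e12 (cj g c) \<noteq> 0" "e11 (cj g c) = e22 (cj g c)"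
proof -
  have "\<not> central c" using assms by (simp add: parabolic_def)
  then show thesis
  proof (cases rule: sl2_normal_form)
    case (diagonal g)
    have "(tr (cj g c))\<^sup>2 = 4" using assms by (simp add: parabolic_def)
    moreover have "(tr (cj g c))\<^sup>2 - 4 * (e11 (cj g c) * e22 (cj g c)) = (e11 (cj g c) - e22 (cj g c))\<^sup>2"
      by (simp add: tr_def power2_eq_square algebra_simps)
    ultimately show thesis using diagonal det_sl2[of "cj g c"] by simp
  qed (rule that)
qed

text \<open>For \<open>c = \<plusminus>(1 + N)\<close> with \<open>N\<^sup>2 = 0\<close> this is the trace of \<open>N d\<close>. It is a coordinate on the
  centralizer of a parabolic element which is additive and, being a trace expression, invariant under conjugation;
  it vanishes on noncentral elements only if \<open>d\<close> fixes their eigenvector.\<close>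

definition drift :: "sl2 \<Rightarrow> sl2 \<Rightarrow> complex" where
  "drift d c = tr c / 2 * tr (c * d) - tr d"

lemma drift_cj [simp]: "drift (cj g d) (cj g c) = drift d c"
  by (simp add: drift_def flip: cj_mult)

lemma drift_unipotent:
  assumes "e21 c = 0" "e11 c = e22 c"
  shows "drift d c = e12 c / e11 c * e21 d"
proof -
  have d: "e11 c * e11 c = 1" using det_sl2[of c] assms by simp
  then have "e11 c \<noteq> 0" by auto
  have "drift d c = e11 c * (e11 c * e11 d + e12 c * e21 d + e11 c * e22 d) - (e11 d + e22 d)"
    using assms by (simp add: drift_def tr_def)
  also have "\<dots> = e11 c * e11 c * (e11 d + e22 d) + e11 c * e12 c * e21 d - (e11 d + e22 d)"
    by (simp add: algebra_simps)
  also have "\<dots> = e11 c * e12 c * e21 d" unfolding d by simp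
  also have "e11 c = 1 / e11 c" using d \<open>e11 c \<noteq> 0\<close> by (simp add: field_simps)
  finally show ?thesis using \<open>e11 c \<noteq> 0\<close> by simp
qed

lemma drift_zero_unless:
  "central c \<Longrightarrow> drift d c = 0"
proof -
  assume c: "central c"
  then have e: "e12 c = 0" "e21 c = 0" "e11 c = e22 c" by (auto simp: central_sl2)
  then have "e22 c * e22 c = 1" using det_sl2[of c] by simp
  moreover have "drift d c = e22 c * e22 c * (e11 d + e22 d) - (e11 d + e22 d)"
    using e by (simp add: drift_def tr_def algebra_simps)
  ultimately show ?thesis by simp
qed

lemma parabolic_commuting_form:
  assumes c: "e21 c = 0" "e12 c \<noteq> 0" "e11 c = e22 c" and x: "commute c x"
  shows "e21 x = 0" "e11 x = e22 x" "e11 x * e11 x = 1" "tr x = 2 * e11 x"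
    "drift d x = e12 x / e11 x * e21 d" "central x \<longleftrightarrow> e12 x = 0"
proof -
  show xu: "e21 x = 0" "e11 x = e22 x" using x commute_unipotent[OF c] by auto
  then show "e11 x * e11 x = 1" using det_sl2[of x] by simp
  show "tr x = 2 * e11 x" using xu by (simp add: tr_def)
  show "drift d x = e12 x / e11 x * e21 d" using drift_unipotent[OF xu] .
  show "central x \<longleftrightarrow> e12 x = 0" using xu by (auto simp: central_sl2)
qed

lemma drift_mult:
  assumes "parabolic c" "commute c x" "commute c y"
  shows "drift d (x * y) = drift d x + drift d y" "tr (x * y) / 2 = tr x / 2 * (tr y / 2)"
proof -
  obtain g where g: "e21 (cj g c) = 0" "e12 (cj g c) \<noteq> 0" "e11 (cj g c) = e22 (cj g c)"
    using parabolic_frame[OF assms(1)] .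
  have x: "commute (cj g c) (cj g x)" and y: "commute (cj g c) (cj g y)" using assms by simp_all
  then have xy: "commute (cj g c) (cj g x * cj g y)" by (rule commute_mult)
  note X = parabolic_commuting_form[OF g x] and Y = parabolic_commuting_form[OF g y]
    and XY = parabolic_commuting_form[OF g xy]
  have nz: "e11 (cj g x) \<noteq> 0" "e11 (cj g y) \<noteq> 0" using X(3) Y(3) by auto
  have "drift (cj g d) (cj g x * cj g y) = drift (cj g d) (cj g x) + drift (cj g d) (cj g y)"
    unfolding X(5) Y(5) XY(5) using X(1,2) Y(1,2) nz by (simp add: field_simps)
  then show "drift d (x * y) = drift d x + drift d y" by (simp flip: cj_mult)
  have "tr (cj g x * cj g y) / 2 = tr (cj g x) / 2 * (tr (cj g y) / 2)"
    unfolding X(4) Y(4) XY(4) using X(1,2) Y(1,2) by simp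
  then show "tr (x * y) / 2 = tr x / 2 * (tr y / 2)" by (simp flip: cj_mult)
qed

text \<open>In normal form the drift is the translation length times an entry of \<open>d\<close>, and this entry
  cancels in the ratio.\<close>

lemma drift_ratio:
  assumes "parabolic c" "commute c x" "drift d c \<noteq> 0" "drift d' (cj h c) \<noteq> 0"
  shows "drift d' (cj h x) / drift d' (cj h c) = drift d x / drift d c"
proof -
  obtain g where g: "e21 (cj g c) = 0" "e12 (cj g c) \<noteq> 0" "e11 (cj g c) = e22 (cj g c)"
    using parabolic_frame[OF assms(1)] .
  have x: "commute (cj g c) (cj g x)" using assms by simp
  have form: "drift b x = e12 (cj g x) / e11 (cj g x) * e21 (cj g b)"
    "drift b c = e12 (cj g c) / e11 (cj g c) * e21 (cj g b)" for b
    using parabolic_commuting_form(5)[OF g x, of "cj g b"]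
      parabolic_commuting_form(5)[OF g commute_refl, of "cj g b"] by simp_all
  have shift: "drift d' (cj h z) = drift (cj (inverse h) d') z" for z
    by (metis cj_inv_cj(2) drift_cj)
  show ?thesis using assms(3,4) unfolding shift form by simp
qed

lemma drift_nonzero_iff:
  assumes "parabolic c" "commute c x" "\<not> central x"
  shows "drift d x \<noteq> 0 \<longleftrightarrow> drift d c \<noteq> 0" "parabolic x"
proof -
  obtain g where g: "e21 (cj g c) = 0" "e12 (cj g c) \<noteq> 0" "e11 (cj g c) = e22 (cj g c)"
    using parabolic_frame[OF assms(1)] .
  have x: "commute (cj g c) (cj g x)" using assms by simp
  note X = parabolic_commuting_form[OF g x] and C = parabolic_commuting_form[OF g commute_refl]
  have nz: "e11 (cj g x) \<noteq> 0" "e11 (cj g c) \<noteq> 0" "e12 (cj g x) \<noteq> 0"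
    using X(3) C(3) X(6) assms(3) by auto
  have "drift (cj g d) (cj g x) \<noteq> 0 \<longleftrightarrow> drift (cj g d) (cj g c) \<noteq> 0"
    unfolding X(5) C(5) using nz g(2) by simp
  then show "drift d x \<noteq> 0 \<longleftrightarrow> drift d c \<noteq> 0" by simp
  have "(tr (cj g x))\<^sup>2 = 4" unfolding X(4) using X(3) by (simp add: power2_eq_square)
  then show "parabolic x" using assms(3) by (simp add: parabolic_def)
qed

text \<open>This trace bounds the product of two drifts as soon as \<open>d y d\<^sup>-\<^sup>1 x\<close> has finite order.\<close>

lemma trace_conjugate_product:
  assumes "parabolic c" "commute c x" "commute c y"
  shows "tr (cj d y * x) = tr x / 2 * (tr y / 2) * (2 - drift d x * drift d y)"
proof -
  obtain g where g: "e21 (cj g c) = 0" "e12 (cj g c) \<noteq> 0" "e11 (cj g c) = e22 (cj g c)"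
    using parabolic_frame[OF assms(1)] .
  have x: "commute (cj g c) (cj g x)" and y: "commute (cj g c) (cj g y)" using assms by simp_all
  define X Y D where "X = cj g x" and "Y = cj g y" and "D = cj g d"
  note XX = parabolic_commuting_form(1-4)[OF g x, folded X_def] parabolic_commuting_form(5)[OF g x, of D, folded X_def]
  note YY = parabolic_commuting_form(1-4)[OF g y, folded Y_def] parabolic_commuting_form(5)[OF g y, of D, folded Y_def]
  have det: "e11 D * e22 D - e12 D * e21 D = 1" by (rule det_sl2)
  have "tr (cj D Y * X) = 2 * e11 X * e11 Y * (e11 D * e22 D - e12 D * e21 D) - e12 X * e12 Y * (e21 D * e21 D)"
    unfolding cj_def tr_def using XX(1,2) YY(1,2) by (simp add: algebra_simps)
  also have "\<dots> = e11 X * e11 Y * (2 - (e11 X * e11 X * e11 Y * e11 Y) * (e12 X / e11 X * e21 D) * (e12 Y / e11 Y * e21 D))"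
  proof -
    have nz: "e11 X \<noteq> 0" "e11 Y \<noteq> 0" using XX(3) YY(3) by auto
    have "e12 X * e12 Y * (e21 D * e21 D) = (e11 X * e11 X) * (e11 Y * e11 Y) * (e12 X * e12 Y * (e21 D * e21 D))"
      unfolding XX(3) YY(3) by simp
    then show ?thesis unfolding det using nz by (simp add: field_simps)
  qed
  also have "\<dots> = tr X / 2 * (tr Y / 2) * (2 - drift D X * drift D Y)"
    unfolding XX(4,5) YY(4,5) using XX(3) YY(3) by (simp add: mult.assoc)
  finally have "tr (cj D Y * X) = tr X / 2 * (tr Y / 2) * (2 - drift D X * drift D Y)" .
  moreover have "cj D Y * X = cj g (cj d y * x)"
    unfolding X_def Y_def D_def by (simp add: cj_of_cj cj_mult)
  ultimately show ?thesis by (simp add: X_def Y_def D_def)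
qed

lemma drift_not_commute:
  assumes "parabolic c" "drift d c \<noteq> 0"
  shows "\<not> commute c d" "\<not> commute c (cj d c)"
proof -
  obtain g where g: "e21 (cj g c) = 0" "e12 (cj g c) \<noteq> 0" "e11 (cj g c) = e22 (cj g c)"
    using parabolic_frame[OF assms(1)] .
  define C D where "C = cj g c" and "D = cj g d"
  have u: "e21 C = 0" "e12 C \<noteq> 0" "e11 C = e22 C" using g by (simp_all add: C_def)
  have "drift D C \<noteq> 0" using assms(2) by (simp add: C_def D_def)
  then have D: "e21 D \<noteq> 0" using parabolic_commuting_form(5)[OF u commute_refl, of D] by auto
  then have "\<not> commute C D" using commute_unipotent[OF u] by blast
  then show "\<not> commute c d" by (simp add: C_def D_def)
  have "e21 (cj D C) = - (e12 C * e21 D * e21 D)"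
    unfolding cj_def using u by (simp add: algebra_simps)
  then have "\<not> commute C (cj D C)" using commute_unipotent[OF u] D u(2) by simp
  then show "\<not> commute c (cj d c)" by (simp add: C_def D_def cj_of_cj)
qed

lemma not_commute_drift:
  assumes "parabolic c" "\<not> commute c (cj d c)" shows "drift d c \<noteq> 0"
proof
  assume 0: "drift d c = 0"
  obtain g where g: "e21 (cj g c) = 0" "e12 (cj g c) \<noteq> 0" "e11 (cj g c) = e22 (cj g c)"
    using parabolic_frame[OF assms(1)] .
  define C D where "C = cj g c" and "D = cj g d"
  have u: "e21 C = 0" "e12 C \<noteq> 0" "e11 C = e22 C" using g by (simp_all add: C_def)
  have "e11 C \<noteq> 0" using parabolic_commuting_form(3)[OF u commute_refl] by auto
  moreover have "drift D C = 0" using 0 by (simp add: C_def D_def)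
  ultimately have D: "e21 D = 0" using parabolic_commuting_form(5)[OF u commute_refl, of D] u(2) by auto
  have dD: "e11 D * e22 D = 1" using det_sl2[of D] D by simp
  have "e21 (cj D C) = 0" "e11 (cj D C) = e11 C * (e11 D * e22 D)" "e22 (cj D C) = e11 C * (e11 D * e22 D)"
    unfolding cj_def using u D by (simp_all add: algebra_simps)
  then have "commute C (cj D C)" using commute_unipotent[OF u] by simp
  then show False using assms(2) by (simp add: C_def D_def cj_of_cj)
qed

text \<open>The characters \<open>z \<mapsto> exp (s r(z))\<close> for all \<open>s\<close> recover an identity between additive
  quantities from its multiplicative form.\<close>

lemma exp_multiples_eq:
  assumes "\<And>s::complex. exp (s * x) = exp (s * y)" shows "x = y"
proof (rule ccontr)
  assume "x \<noteq> y"
  then have "exp (1 / (x - y) * x - 1 / (x - y) * y) = exp 1"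
    by (simp flip: diff_divide_distrib)
  moreover have "exp (1 / (x - y) * x - 1 / (x - y) * y) = 1" unfolding exp_diff using assms[of "1 / (x - y)"] by simp
  ultimately have "norm (exp (1::complex)) = 1" by simp
  then show False by simp
qed

context quad
begin

text \<open>The mass formula in additive form: each event contributes the translation length of
  \<open>p w\<close>, measured in units of the one of \<open>p\<close>.\<close>

lemma parabolic_sum:
  assumes par: "parabolic p"
    and nz: "\<And>d' t w e'. reach Q [(a, d'), (P, t), (Y, w), (m, e')] \<Longrightarrow> commute t w \<Longrightarrow> drift d' t \<noteq> 0"
    and F: "C.transversal (word_set Q [a, P, Y, m]) F" "\<And>L. L \<in> F \<Longrightarrow> L ! 1 = (P, p)"
  shows "(\<Sum>L\<in>{L \<in> F. commute p (snd (L ! 2))}. 1 + drift (snd (L ! 0)) (snd (L ! 2)) / drift (snd (L ! 0)) p)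
    = of_nat (card F)"
proof -
  \<comment> \<open>In normal form \<open>?r\<close> below is the translation length, an additive character of the centralizer
    of \<open>p\<close>.\<close>
  obtain g where g: "e21 (cj g p) = 0" "e12 (cj g p) \<noteq> 0" "e11 (cj g p) = e22 (cj g p)"
    using parabolic_frame[OF par] .
  let ?w = "\<lambda>L. snd (L ! 2)"
  let ?E = "{L \<in> F. commute p (?w L)}"
  let ?r = "\<lambda>z. e12 (cj g z) / e11 (cj g z)"
  have fin: "finite F" using F(1) unfolding C.transversal_def by blast
  have inf: "\<not> finite_order p" using unipotent_infinite_order[OF g] by simp
  have form: "e21 (cj g z) = 0" "e11 (cj g z) = e22 (cj g z)" "e11 (cj g z) \<noteq> 0" if "commute p z" for z
    using parabolic_commuting_form(1-3)[OF g, of "cj g z"] that by auto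
  have add: "?r (z * w) = ?r z + ?r w" if "commute p z" "commute p w" for z w
    using form[OF that(1)] form[OF that(2)] by (simp add: cj_mult field_simps)
  have "exp (s * (\<Sum>L\<in>?E. ?r p + ?r (?w L))) = exp (s * (of_nat (card F) * ?r p))" for s :: complex
  proof -
    have "(\<Prod>L\<in>F. if commute p (?w L) then exp (s * ?r (p * ?w L)) else 1) = exp (s * ?r p) ^ card F"
    proof (rule mass_formula_four[OF inf _ _ F])
      fix z w assume "commute z p" "commute w p"
      then show "exp (s * ?r (z * w)) = exp (s * ?r z) * exp (s * ?r w)"
        using add[of z w] by (simp add: commute_sym distrib_left exp_add)
    next
      fix z :: sl2 assume "central z"
      then have "central (cj g z)" by simp
      then show "exp (s * ?r z) = 1" by (simp add: central_sl2)
    qed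
    also have "(\<Prod>L\<in>F. if commute p (?w L) then exp (s * ?r (p * ?w L)) else 1) = (\<Prod>L\<in>?E. exp (s * ?r (p * ?w L)))"
      using fin by (simp add: prod.If_cases Int_def)
    also have "\<dots> = exp (\<Sum>L\<in>?E. s * ?r (p * ?w L))" using fin by (simp add: exp_sum)
    also have "(\<Sum>L\<in>?E. s * ?r (p * ?w L)) = s * (\<Sum>L\<in>?E. ?r p + ?r (?w L))"
      unfolding sum_distrib_left using add by (intro sum.cong) auto
    finally have "exp (s * (\<Sum>L\<in>?E. ?r p + ?r (?w L))) = exp (s * ?r p) ^ card F" .
    also have "\<dots> = exp (s * (of_nat (card F) * ?r p))"
      by (metis exp_of_nat_mult mult.left_commute)
    finally show ?thesis .
  qed
  then have sum: "(\<Sum>L\<in>?E. ?r p + ?r (?w L)) = of_nat (card F) * ?r p" by (rule exp_multiples_eq)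
  have rp: "?r p \<noteq> 0" using g(2) form(3)[OF commute_refl] by simp
  have "(\<Sum>L\<in>?E. 1 + drift (snd (L ! 0)) (?w L) / drift (snd (L ! 0)) p) = (\<Sum>L\<in>?E. (?r p + ?r (?w L)) / ?r p)"
  proof (rule sum.cong)
    fix L assume L: "L \<in> ?E"
    then have "L \<in> word_set Q [a, P, Y, m]" using F(1) unfolding C.transversal_def by blast
    then obtain d' w e' where L': "L = [(a, d'), (P, p), (Y, w), (m, e')]" "reach Q L"
      using F(2)[of L] L by (auto elim!: word_setD)
    have pw: "commute p w" using L by (simp add: L'(1))
    have "drift d' p \<noteq> 0" using nz L' pw by blast
    moreover have "drift d' z = ?r z * e21 (cj g d')" if "commute p z" for z
      using parabolic_commuting_form(5)[OF g, of "cj g z" "cj g d'"] that by simp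
    ultimately have "drift d' w / drift d' p = ?r w / ?r p" using pw by simp
    then have "1 + drift d' w / drift d' p = (?r p + ?r w) / ?r p"
      using rp by (metis add_divide_distrib divide_self)
    moreover have "?w L = w" "snd (L ! 0) = d'" by (simp_all add: L'(1))
    ultimately show "1 + drift (snd (L ! 0)) (?w L) / drift (snd (L ! 0)) p = (?r p + ?r (?w L)) / ?r p"
      by simp
  qed simp
  also have "\<dots> = of_nat (card F)" unfolding sum_divide_distrib[symmetric] sum using rp
    by (metis nonzero_mult_div_cancel_right)
  finally show ?thesis .
qed

text \<open>Seen from \<open>y\<close>, each ratio \<open>\<rho>\<close> turns into \<open>1 / \<rho>\<close>, while the sum of \<open>1 + \<rho>\<close> over the
  events is the number of classes in both cases. Hence the differences \<open>\<rho> - 1 / \<rho>\<close> sum up to zero, and not all the \<open>\<rho>\<close> can be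
  less than 1.\<close>

lemma parabolic_pair:
  assumes par: "parabolic p"
    and pos: "\<And>d' t w e'. reach Q [(a, d'), (P, t), (Y, w), (m, e')] \<Longrightarrow> commute t w \<Longrightarrow>
      drift d' t \<noteq> 0 \<and> drift d' w / drift d' t \<in> \<real> \<and> Re (drift d' w / drift d' t) > 0"
  shows "\<exists>d' t w e'. reach Q [(a, d'), (P, t), (Y, w), (m, e')] \<and> commute t w \<and>
    Re (drift d' w / drift d' t) \<ge> 1"
proof (rule ccontr)
  assume not: "\<not> ?thesis"
  interpret sw: quad a l Y P m b xa xl y p xm xb by (rule swapped)
  obtain F G f where F: "C.transversal (word_set Q [a, P, Y, m]) F" "\<And>L. L \<in> F \<Longrightarrow> L ! 1 = (P, p)"
    and G: "C.transversal (word_set Q [a, Y, P, m]) G" "\<And>L. L \<in> G \<Longrightarrow> L ! 1 = (Y, y)"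
    and f: "bij_betw f F G" "\<And>L. L \<in> F \<Longrightarrow> \<exists>d' w e' g. L = [(a, d'), (P, p), (Y, w), (m, e')] \<and> reach Q L \<and>
      f L = [(a, cj g d'), (Y, y), (P, cj g p), (m, cj g e')] \<and> y = cj g (cj p w) \<and>
      (commute y (cj g p) \<longleftrightarrow> commute p w)"
    by (rule two_frames) blast
  have par_y: "parabolic y" using drift_nonzero_iff(2)[OF par comm y_nc] .
  have fin: "finite F" using F(1) unfolding C.transversal_def by blast
  let ?w = "\<lambda>L. snd (L ! 2)"
  let ?E = "{L \<in> F. commute p (?w L)}" and ?H = "{L \<in> G. commute y (?w L)}"
  define \<rho> where "\<rho> L = drift (snd (L ! 0)) (?w L) / drift (snd (L ! 0)) (snd (L ! 1))"
    for L :: "('i \<times> sl2) list"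
  have \<rho>F: "\<rho> L = drift (snd (L ! 0)) (?w L) / drift (snd (L ! 0)) p" if "L \<in> F" for L
    using F(2)[OF that] by (simp add: \<rho>_def)
  have \<rho>G: "\<rho> L = drift (snd (L ! 0)) (?w L) / drift (snd (L ! 0)) y" if "L \<in> G" for L
    using G(2)[OF that] by (simp add: \<rho>_def)
  have sumF: "(\<Sum>L\<in>?E. 1 + \<rho> L) = of_nat (card F)"
    using parabolic_sum[OF par _ F] pos \<rho>F by simp
  have nzY: "drift d' t \<noteq> 0"
    if r: "reach sw.Q [(a, d'), (Y, t), (P, w), (m, e')]" and c: "commute t w" for d' t w e'
  proof -
    have "[(a, d'), (Y, t), (P, w), (m, e')] \<in> word_set Q [a, Y, P, m]"
      using r unfolding word_set_swapped[symmetric] by (simp add: word_set_def)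
    then have "reach Q ([(a, d')] @ (Y, t) # (P, w) # [(m, e')])" by (simp add: word_set_def)
    from reach_swap[OF this c] have "reach Q [(a, d'), (P, w), (Y, t), (m, e')]" by simp
    then have "Re (drift d' t / drift d' w) > 0" using pos commute_sym[OF c] by blast
    then show ?thesis by auto
  qed
  have sumG: "(\<Sum>L\<in>?H. 1 + \<rho> L) = of_nat (card G)"
    using sw.parabolic_sum[OF par_y nzY, unfolded word_set_swapped, OF _ _ G] \<rho>G by simp
  have fL: "f L \<in> G \<and> (commute y (?w (f L)) \<longleftrightarrow> commute p (?w L)) \<and> (commute p (?w L) \<longrightarrow> \<rho> (f L) = 1 / \<rho> L)"
    if L: "L \<in> F" for L
  proof -
    have fG: "f L \<in> G" using f(1) L by (auto simp: bij_betw_def)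
    obtain d' w e' g where L': "L = [(a, d'), (P, p), (Y, w), (m, e')]" and y: "y = cj g (cj p w)"
      and fLe: "f L = [(a, cj g d'), (Y, y), (P, cj g p), (m, cj g e')]"
      and cw: "commute y (cj g p) \<longleftrightarrow> commute p w" using f(2)[OF L] by blast
    have "\<rho> (f L) = 1 / \<rho> L" if "commute p w"
      using that y unfolding \<rho>_def fLe by (simp add: L' cj_self)
    moreover have "?w (f L) = cj g p" "?w L = w" unfolding fLe by (simp_all add: L')
    ultimately show ?thesis using fG cw by simp
  qed
  have "bij_betw f {L \<in> F. commute y (?w (f L))} ?H"
    using f(1) unfolding bij_betw_def by (auto simp: inj_on_def)
  moreover have "{L \<in> F. commute y (?w (f L))} = ?E" using fL by blast
  ultimately have bij: "bij_betw f ?E ?H" by simp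
  have "(\<Sum>L\<in>?H. 1 + \<rho> L) = (\<Sum>L\<in>?E. 1 + 1 / \<rho> L)"
    unfolding sum.reindex_bij_betw[OF bij, symmetric] using fL by (intro sum.cong) auto
  then have "(\<Sum>L\<in>?E. 1 + 1 / \<rho> L) = (\<Sum>L\<in>?E. 1 + \<rho> L)"
    using sumF sumG bij_betw_same_card[OF f(1)] by simp
  then have "(\<Sum>L\<in>?E. \<rho> L - 1 / \<rho> L) = 0" by (simp add: sum.distrib sum_subtractf)
  then have zero: "(\<Sum>L\<in>?E. Re (\<rho> L - 1 / \<rho> L)) = 0" by (metis Re_sum zero_complex.sel(1))
  have neg: "Re (\<rho> L - 1 / \<rho> L) < 0" if L: "L \<in> ?E" for L
  proof -
    have "L \<in> word_set Q [a, P, Y, m]" using F(1) L unfolding C.transversal_def by blast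
    then obtain d' w e' where L': "L = [(a, d'), (P, p), (Y, w), (m, e')]" "reach Q L"
      using F(2)[of L] L by (auto elim!: word_setD)
    have r: "\<rho> L = drift d' w / drift d' p" by (simp add: \<rho>_def L'(1))
    have pw: "commute p w" using L by (simp add: L'(1))
    have "\<rho> L \<in> \<real>" "Re (\<rho> L) > 0" "Re (\<rho> L) < 1"
      using pos[of d' p w e'] not L' pw unfolding r by (auto simp: not_le)
    then obtain s where s: "\<rho> L = of_real s" "0 < s" "s < 1" by (auto elim!: Reals_cases)
    then have "1 / s > 1" by simp
    moreover have "Re (1 / \<rho> L) = 1 / s" unfolding s(1) by (metis Re_complex_of_real of_real_1 of_real_divide)
    moreover have "Re (\<rho> L) = s" using s(1) by simp
    ultimately show ?thesis using s(3) by (simp del: divide_divide_eq_right)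
  qed
  obtain L where "L \<in> F" "commute (snd (L ! 1)) (?w L)" using base_event[OF F(1)] .
  then have "?E \<noteq> {}" using F(2) by auto
  then have "(\<Sum>L\<in>?E. Re (\<rho> L - 1 / \<rho> L)) < (\<Sum>L\<in>?E. 0)"
    using fin neg by (intro sum_strict_mono) auto
  then show False using zero by simp
qed

end

lemma reach_move_left:
  assumes "reach B (us @ cs @ (i, x) # vs)" "\<forall>y\<in>snd ` set cs. commute y x"
  shows "reach B (us @ (i, x) # cs @ vs)"
  using assms
proof (induction cs arbitrary: vs rule: rev_induct)
  case (snoc c cs)
  obtain j y where c: "c = (j, y)" by force
  have "reach B ((us @ cs) @ (j, y) # (i, x) # vs)" using snoc.prems(1) by (simp add: c)
  then have "reach B ((us @ cs) @ (i, x) # (j, y) # vs)" by (rule reach_swap) (use snoc.prems(2) c in simp)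
  then show ?case using snoc.IH[of "(j, y) # vs"] snoc.prems(2) by (simp add: c)
qed simp

lemma reach_permute:
  assumes "reach B (us @ cs @ vs)" "all_commute cs" "mset cs' = mset cs"
  shows "reach B (us @ cs' @ vs)"
  using assms
proof (induction cs' arbitrary: us cs)
  case (Cons c cs')
  obtain i x where c: "c = (i, x)" by force
  have "c \<in> set cs" using Cons.prems(3) by (metis list.set_intros(1) mset_eq_setD)
  then obtain ps qs where cs: "cs = ps @ (i, x) # qs" unfolding c by (meson split_list)
  have "reach B (us @ (i, x) # ps @ qs @ vs)"
    using Cons.prems(1,2) by (intro reach_move_left) (auto simp: cs all_commute_def)
  then have "reach B ((us @ [(i, x)]) @ (ps @ qs) @ vs)" by simp
  moreover have "all_commute (ps @ qs)" using Cons.prems(2) by (auto simp: cs all_commute_def)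
  moreover have "mset cs' = mset (ps @ qs)" using Cons.prems(3) by (simp add: cs c)
  ultimately have "reach B ((us @ [(i, x)]) @ cs' @ vs)" by (rule Cons.IH)
  then show ?case by (simp add: c)
qed simp

lemma parabolic_trace: "parabolic c \<Longrightarrow> tr c = 2 \<or> tr c = - 2"
  unfolding parabolic_def using power2_eq_iff[of "tr c" 2] by simp

text \<open>The products \<open>d x\<close>, \<open>d y\<close> and \<open>d y d\<^sup>-\<^sup>1 x\<close> have finite order by the twisting argument, with \<open>z\<close> and \<open>e\<close> as the
  noncommuting pair elsewhere. The first two make the drifts real; the trace of the third, which is
  less than 2 in absolute value, makes their product positive.\<close>

lemma parabolic_positive:
  assumes fin: "finite_orbit [(a, d), (i, x), (j, y), (k, z), (m, e)]"
    and prod: "d * x * y * z * e = 1"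
    and par: "parabolic x" and comm: "commute x y" "commute x z" and nc: "\<not> central y" "\<not> central z"
    and d: "finite_order d" and nz: "drift d x \<noteq> 0"
  shows "drift d y \<noteq> 0" "drift d y / drift d x \<in> \<real>" "Re (drift d y / drift d x) > 0"
proof -
  let ?B = "[(a, d), (i, x), (j, y), (k, z), (m, e)]"
  have yz: "commute y z" using comm par commute_trans unfolding parabolic_def by blast
  have nzy: "drift d y \<noteq> 0" and nzz: "parabolic y" using drift_nonzero_iff[OF par comm(1) nc(1)] nz by auto
  then show "drift d y \<noteq> 0" by blast
  have "drift d z \<noteq> 0" "parabolic z" using drift_nonzero_iff[OF par comm(2) nc(2)] nz by auto
  then have zd: "\<not> commute z d" using drift_not_commute(1) by blast
  have ze: "\<not> commute z e"
  proof
    assume e: "commute z e"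
    have "d * (x * y * z * e) = 1" using prod by (simp add: mult.assoc)
    then have "inverse d = x * y * z * e" by (rule inv_unique)
    moreover have "commute z (x * y * z * e)"
      using comm yz e by (intro commute_mult) (auto intro: commute_sym)
    ultimately have "commute z (inverse d)" by simp
    from commute_inverse[OF this] zd show False by simp
  qed
  have r1: "reach ?B ([] @ (a, d) # (i, x) # [(j, y), (k, z), (m, e)])" by (simp add: reach.start)
  have "reach ?B ([(a, d)] @ (i, x) # (j, y) # [(k, z), (m, e)])" by (simp add: reach.start)
  from reach_swap[OF this comm(1)]
  have r2: "reach ?B ([] @ (a, d) # (j, y) # [(i, x), (k, z), (m, e)])" by simp
  from reach_twist[OF this]
  have r3: "reach ?B ([(a, cj (d * y) d)] @ (j, cj (d * y) y) # (i, x) # [(k, z), (m, e)])" by simp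
  have f1: "finite_order (d * x)"
    using pair_finite_order[OF fin r1, of z e] drift_not_commute(1)[OF par nz] ze
    by (auto simp: commute_commute)
  have f2: "finite_order (d * y)"
    using pair_finite_order[OF fin r2, of z e] drift_not_commute(1)[OF nzz nzy] ze
    by (auto simp: commute_commute)
  have real: "drift d c \<in> \<real>" if "parabolic c" "finite_order (d * c)" for c
    using finite_order_trace(1)[OF d] finite_order_trace(1)[OF that(2)] parabolic_trace[OF that(1)]
    unfolding drift_def tr_commute[of c d] by auto
  have rx: "drift d x \<in> \<real>" and ry: "drift d y \<in> \<real>" using real par nzz f1 f2 by auto
  then show "drift d y / drift d x \<in> \<real>" by simp
  have y': "cj (d * y) y = cj d y" by (simp add: cj_self flip: cj_cj)
  have "\<not> commute x (cj d y)"
  proof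
    assume "commute x (cj d y)"
    then have "commute y (cj d y)" using commute_trans comm(1) par unfolding parabolic_def by blast
    then show False using drift_not_commute(2)[OF nzz nzy] by simp
  qed
  then have yx: "\<not> commute (cj d y) x" by (simp add: commute_commute)
  have f3: "finite_order (cj d y * x)"
    using pair_finite_order[OF fin r3, of z e] yx ze unfolding y' by auto
  have "\<not> central (cj d y * x)"
  proof
    assume "central (cj d y * x)"
    then have "commute x (cj d y * x)" by (simp add: central_commute)
    then show False using yx by (simp add: commute_mult_iff' commute_commute)
  qed
  then have "\<bar>Re (tr (cj d y * x))\<bar> < 2" using finite_order_trace(2)[OF f3] by blast
  moreover have "tr (cj d y * x) = tr x / 2 * (tr y / 2) * (2 - drift d x * drift d y)"
    by (rule trace_conjugate_product[OF par commute_refl comm(1)])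
  ultimately have less: "\<bar>Re (2 - drift d x * drift d y)\<bar> < 2"
    using parabolic_trace[OF par] parabolic_trace[OF nzz] by auto
  obtain r s where rs: "drift d x = of_real r" "drift d y = of_real s" using rx ry by (auto elim!: Reals_cases)
  then have "r * s > 0" using less by simp
  then have "s / r > 0" by (simp add: zero_less_divide_iff zero_less_mult_iff) (use \<open>r * s > 0\<close> zero_less_mult_iff in blast)
  then show "Re (drift d y / drift d x) > 0" unfolding rs by (simp flip: of_real_divide)
qed

text \<open>The form of \<open>reach_merge\<close> in which the place of the ribbon is known.\<close>

lemma reach_unmerge:
  assumes r: "reach (p @ (i, g * h) # q) (us @ (i, x) # vs)" and dist: "distinct (map fst (p @ (i, g) # (j, h) # q))"
  obtains c where "x = cj c (g * h)" "reach (p @ (i, g) # (j, h) # q) (us @ (i, cj c g) # (j, cj c h) # vs)"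
proof -
  obtain xs ys c where eq: "us @ (i, x) # vs = xs @ (i, cj c (g * h)) # ys"
    and r': "reach (p @ (i, g) # (j, h) # q) (xs @ (i, cj c g) # (j, cj c h) # ys)"
    using reach_merge[OF r dist] by blast
  have "distinct (map fst (us @ (i, x) # vs))" using reach_distinct[OF r] dist by auto
  from split_unique[OF eq this] have "us = xs" "x = cj c (g * h)" "vs = ys" by auto
  then show thesis using that r' by simp
qed

lemma tr_inverse [simp]: "tr (inverse x) = tr x" by (simp add: tr_def)

text \<open>Among all reachable configurations in which the first of the three middle elements commutes with the other two,
  choose one in which the ratio of the second drift to the first is maximal, say for \<open>x\<close>, \<open>y\<close>. Merge \<open>x\<close> and \<open>y\<close> and apply
  \<open>parabolic_pair\<close> to \<open>x y\<close> and the third element. It yields a reachable configuration in which the drift of the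
  third element is at least that of \<open>x y\<close>. As drifts are additive with positive ratios, its ratio to
  the drift of \<open>x\<close> alone is at least 1 more than the maximum.\<close>

lemma no_three_parabolics:
  assumes fin: "finite_orbit [(a, xa), (l, xl), (i1, c1), (i2, c2), (i3, c3), (m, xm), (b, xb)]"
    and dist: "distinct [a, l, i1, i2, i3, m, b]"
    and prod: "xa * xl * c1 * c2 * c3 * xm * xb = 1"
    and nc: "\<not> commute xa xl" "\<not> commute xm xb"
    and par1: "parabolic c1" and comm: "commute c1 c2" "commute c1 c3"
    and nc23: "\<not> central c2" "\<not> central c3"
    and moves: "\<not> commute c1 (cj (xa * xl) c1)"
  shows False
proof -
  let ?B = "[(a, xa), (l, xl), (i1, c1), (i2, c2), (i3, c3), (m, xm), (b, xb)]"
  define d where "d = xa * xl"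
  define e where "e = xm * xb"
  let ?B6 = "[(a, d), (i1, c1), (i2, c2), (i3, c3), (m, xm), (b, xb)]"
  define Q where "Q = [(a, d), (i1, c1), (i2, c2), (i3, c3), (m, e)]"
  have dist': "distinct (map fst Q)" using dist by (auto simp: Q_def)
  have fin6: "finite_orbit ?B6"
    using finite_orbit_merge[of "[]" a xa l xl "[(i1, c1), (i2, c2), (i3, c3), (m, xm), (b, xb)]"] fin dist
    by (simp add: d_def)
  have finQ: "finite_orbit Q"
    using finite_orbit_merge[of "[(a, d), (i1, c1), (i2, c2), (i3, c3)]" m xm b xb "[]"] fin6 dist
    by (simp add: Q_def e_def)
  have prodQ: "lprod Q = 1" using prod by (simp add: Q_def d_def e_def mult.assoc)
  have fd: "finite_order d"
    using pair_finite_order[OF fin, of "[]" a xa l xl "[(i1, c1), (i2, c2), (i3, c3), (m, xm), (b, xb)]" xm xb] nc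
    by (simp add: d_def reach.start)
  have par: "parabolic c2" "parabolic c3" using drift_nonzero_iff(2) par1 comm nc23 by blast+
  define good where "good d' i x j y k z e' \<longleftrightarrow>
    reach Q [(a, d'), (i, x), (j, y), (k, z), (m, e')] \<and> commute x y \<and> commute x z" for d' i x j y k z e'
  \<comment> \<open>Unfolding the outer pairs.\<close>
  have lift: "\<exists>g h. d' = cj g d \<and> e' = cj h e \<and>
      reach ?B [(a, cj g xa), (l, cj g xl), (i, x), (j, y), (k, z), (m, cj h xm), (b, cj h xb)]"
    if "reach Q [(a, d'), (i, x), (j, y), (k, z), (m, e')]" for d' i x j y k z e'
  proof -
    have "reach ([(a, d), (i1, c1), (i2, c2), (i3, c3)] @ (m, xm * xb) # []) ([(a, d'), (i, x), (j, y), (k, z)] @ (m, e') # [])"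
      using that by (simp add: Q_def e_def)
    then obtain h where h: "e' = cj h (xm * xb)"
      "reach ([(a, d), (i1, c1), (i2, c2), (i3, c3)] @ (m, xm) # (b, xb) # [])
        ([(a, d'), (i, x), (j, y), (k, z)] @ (m, cj h xm) # (b, cj h xb) # [])"
      by (rule reach_unmerge[where j = b]) (use dist in auto)
    have "reach ([] @ (a, xa * xl) # [(i1, c1), (i2, c2), (i3, c3), (m, xm), (b, xb)])
        ([] @ (a, d') # [(i, x), (j, y), (k, z), (m, cj h xm), (b, cj h xb)])"
      using h(2) by (simp add: d_def)
    then obtain g where g: "d' = cj g (xa * xl)"
      "reach ([] @ (a, xa) # (l, xl) # [(i1, c1), (i2, c2), (i3, c3), (m, xm), (b, xb)])
        ([] @ (a, cj g xa) # (l, cj g xl) # [(i, x), (j, y), (k, z), (m, cj h xm), (b, cj h xb)])"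
      by (rule reach_unmerge[where j = l]) (use dist in auto)
    then show ?thesis using h(1) by (auto simp: d_def e_def)
  qed
  \<comment> \<open>The sign of each parabolic element, as a function of its label: half the trace is a
    conjugacy invariant.\<close>
  define f where "f i = (if i = i1 then tr c1 else if i = i2 then tr c2 else tr c3) / 2" for i
  have good_entries: "parabolic x \<and> parabolic y \<and> parabolic z \<and> f i = tr x / 2 \<and> f j = tr y / 2 \<and> f k = tr z / 2
      \<and> f i * f j * f k = f i1 * f i2 * f i3"
    if "reach Q [(a, d'), (i, x), (j, y), (k, z), (m, e')]" for d' i x j y k z e'
  proof -
    let ?L = "[(a, d'), (i, x), (j, y), (k, z), (m, e')]"
    have dL: "distinct (map fst ?L)" using reach_distinct[OF that dist'] .
    have ent: "parabolic u \<and> f n = tr u / 2" if u: "(n, u) \<in> set ?L" "n \<noteq> a" "n \<noteq> m" for n u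
    proof -
      obtain g v where "(n, v) \<in> set Q" "u = cj g v"
        using reach_entry[OF \<open>reach Q ?L\<close> u(1)] by blast
      then show ?thesis using u(2,3) par par1 dist by (auto simp: Q_def f_def)
    qed
    have "mset (map fst ?L) = mset (map fst Q)" by (rule reach_labels[OF that])
    then have "{#i, j, k#} = {#i1, i2, i3#}" by (simp add: Q_def add_mset_commute)
    then have "prod_mset (image_mset f {#i, j, k#}) = prod_mset (image_mset f {#i1, i2, i3#})" by simp
    then show ?thesis using ent[of i x] ent[of j y] ent[of k z] dL by (auto simp: mult.assoc)
  qed
  \<comment> \<open>The sum of the three drifts is the drift of \<open>x y z\<close>, and \<open>d' x y z = e'\<^sup>-\<^sup>1\<close>; so the sum is
    the same for all configurations.\<close>
  have sum: "drift d' x + drift d' y + drift d' z = f i1 * f i2 * f i3 * tr e - tr d"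
    if g: "good d' i x j y k z e'" for d' i x j y k z e'
  proof -
    have r: "reach Q [(a, d'), (i, x), (j, y), (k, z), (m, e')]" and c: "commute x y" "commute x z"
      using g by (auto simp: good_def)
    note E = good_entries[OF r]
    have px: "parabolic x" using E by blast
    have tre: "tr e' = tr e" "tr d' = tr d" using lift[OF r] by auto
    have "lprod [(a, d'), (i, x), (j, y), (k, z), (m, e')] = 1" using reach_prod[OF r prodQ] .
    then have "d' * (x * y * z) * e' = 1" by (simp add: mult.assoc)
    then have "inverse (d' * (x * y * z)) = e'" by (rule inv_unique)
    then have t1: "tr (x * y * z * d') = tr e'" by (metis tr_commute tr_inverse)
    have "tr x / 2 = f i" "tr y / 2 = f j" "tr z / 2 = f k" and fs: "f i * f j * f k = f i1 * f i2 * f i3"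
      using E by simp_all
    then have t3: "tr (x * y * z) / 2 = f i * f j * f k"
      using drift_mult(2)[OF px commute_mult[OF commute_refl c(1)] c(2)] drift_mult(2)[OF px commute_refl c(1)]
      by (simp only:)
    have "drift d' x + drift d' y + drift d' z = drift d' (x * y * z)"
      using drift_mult(1)[OF px commute_mult[OF commute_refl c(1)] c(2)] drift_mult(1)[OF px commute_refl c(1)]
      by simp
    also have "\<dots> = f i1 * f i2 * f i3 * tr e - tr d" unfolding drift_def t3 t1 tre fs ..
    finally show ?thesis .
  qed
  have positive: "drift d' y \<noteq> 0 \<and> drift d' y / drift d' x \<in> \<real> \<and> Re (drift d' y / drift d' x) > 0"
    if g: "good d' i x j y k z e'" and nz: "drift d' x \<noteq> 0" for d' i x j y k z e'
  proof -
    have r: "reach Q [(a, d'), (i, x), (j, y), (k, z), (m, e')]" and c: "commute x y" "commute x z"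
      using g by (auto simp: good_def)
    have "lprod [(a, d'), (i, x), (j, y), (k, z), (m, e')] = 1" using reach_prod[OF r prodQ] .
    then have "d' * x * y * z * e' = 1" by (simp add: mult.assoc)
    moreover have "finite_order d'" using lift[OF r] fd by auto
    moreover have "parabolic x" "\<not> central y" "\<not> central z"
      using good_entries[OF r] by (auto simp: parabolic_def)
    ultimately show ?thesis
      using parabolic_positive[OF finite_orbit_reach[OF finQ r]] c nz by blast
  qed
  have exchange: "good d' i x k z j y e'" if "good d' i x j y k z e'" for d' i x j y k z e'
  proof -
    have r: "reach Q ([(a, d'), (i, x)] @ (j, y) # (k, z) # [(m, e')])" and c: "commute x y" "commute x z"
      using that by (auto simp: good_def)
    have "parabolic x" using good_entries r by simp
    then have "commute y z" using c commute_trans unfolding parabolic_def by blast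
    from reach_swap[OF r this] c show ?thesis by (simp add: good_def)
  qed
  have base: "good d i1 c1 i2 c2 i3 c3 e" using comm by (simp add: good_def reach.start flip: Q_def)
  have dc: "drift d c1 \<noteq> 0" using not_commute_drift[OF par1] moves by (simp add: d_def)
  \<comment> \<open>All three drifts have positive ratios at the start, so their sum is not zero.\<close>
  have K: "f i1 * f i2 * f i3 * tr e - tr d \<noteq> 0"
  proof
    assume "f i1 * f i2 * f i3 * tr e - tr d = 0"
    then have "drift d c1 + drift d c2 + drift d c3 = 0" using sum[OF base] by simp
    then have "1 + drift d c2 / drift d c1 + drift d c3 / drift d c1 = 0"
      using dc by (simp add: field_simps)
    then have "Re (1 + drift d c2 / drift d c1 + drift d c3 / drift d c1) = 0" by simp
    moreover have "Re (drift d c2 / drift d c1) > 0" "Re (drift d c3 / drift d c1) > 0"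
      using positive[OF base dc] positive[OF exchange[OF base] dc] by auto
    ultimately show False by simp
  qed
  \<comment> \<open>The three drifts vanish together, but their constant sum does not vanish.\<close>
  have nonzero: "drift d' x \<noteq> 0" if g: "good d' i x j y k z e'" for d' i x j y k z e'
  proof
    assume 0: "drift d' x = 0"
    have r: "reach Q [(a, d'), (i, x), (j, y), (k, z), (m, e')]" and c: "commute x y" "commute x z"
      using g by (auto simp: good_def)
    note E = good_entries[OF r]
    have "drift d' y = 0" "drift d' z = 0"
      using drift_nonzero_iff(1)[of x y d'] drift_nonzero_iff(1)[of x z d'] 0 c E by (auto simp: parabolic_def)
    then show False using sum[OF g] 0 K by simp
  qed
  define \<Omega> where "\<Omega> = {Re (drift d' y / drift d' x) | d' i x j y k z e'. good d' i x j y k z e'}"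
  have "finite \<Omega>"
  proof -
    obtain S where S: "finite S" "\<And>L. reach Q L \<Longrightarrow> \<exists>M\<in>S. \<exists>g. L = cjl g M"
      using finQ unfolding finite_orbit_def by blast
    let ?h = "\<lambda>M. Re (drift (snd (M ! 0)) (snd (M ! 2)) / drift (snd (M ! 0)) (snd (M ! 1)))"
    have "\<Omega> \<subseteq> ?h ` S"
    proof
      fix r assume "r \<in> \<Omega>"
      then obtain d' i x j y k z e' where r: "r = Re (drift d' y / drift d' x)" "good d' i x j y k z e'"
        unfolding \<Omega>_def by blast
      let ?L = "[(a, d'), (i, x), (j, y), (k, z), (m, e')]"
      obtain M g where M: "M \<in> S" "?L = cjl g M" using S(2)[of ?L] r(2) unfolding good_def by blast
      have "M = cjl (inverse g) ?L" unfolding M(2) by simp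
      then have "?h M = r" by (simp add: r(1))
      then show "r \<in> ?h ` S" using M(1) by blast
    qed
    then show ?thesis using S(1) finite_surj by blast
  qed
  moreover have "\<Omega> \<noteq> {}" unfolding \<Omega>_def using base by blast
  ultimately have max: "Max \<Omega> \<in> \<Omega>" "\<And>r. r \<in> \<Omega> \<Longrightarrow> r \<le> Max \<Omega>" by simp_all
  from max(1) obtain d' i x j y k z e' where M: "Max \<Omega> = Re (drift d' y / drift d' x)"
    and g: "good d' i x j y k z e'" unfolding \<Omega>_def mem_Collect_eq by blast
  have r: "reach Q [(a, d'), (i, x), (j, y), (k, z), (m, e')]" and c: "commute x y" "commute x z"
    using g by (auto simp: good_def)
  note E = good_entries[OF r]
  have px: "parabolic x" using E by blast
  obtain u h where uh: "d' = cj u d" "e' = cj h e"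
    "reach ?B [(a, cj u xa), (l, cj u xl), (i, x), (j, y), (k, z), (m, cj h xm), (b, cj h xb)]"
    using lift[OF r] by blast
  let ?B7 = "[(a, cj u xa), (l, cj u xl), (i, x), (j, y), (k, z), (m, cj h xm), (b, cj h xb)]"
  have d7: "distinct (map fst ?B7)" using reach_distinct[OF uh(3)] dist by simp
  have xy: "drift d' (x * y) = drift d' x + drift d' y" using drift_mult(1)[OF px commute_refl c(1)] .
  \<comment> \<open>The ratio of the drifts of \<open>x\<close> and \<open>y\<close> survives any conjugation, even with a different
    \<open>d\<close>.\<close>
  have pos_sum: "drift b' (cj v (x * y)) \<noteq> 0 \<and>
      drift b' (cj v (x * y)) = drift b' (cj v x) * (1 + drift d' y / drift d' x)"
    if "drift b' (cj v x) \<noteq> 0" for b' v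
  proof -
    have "drift b' (cj v (x * y)) = drift b' (cj v x) + drift b' (cj v y)"
      using drift_mult(1)[of "cj v x" "cj v x" "cj v y" b'] px c(1) by (simp add: cj_mult)
    moreover have "drift b' (cj v y) = drift b' (cj v x) * (drift d' y / drift d' x)"
      using drift_ratio[OF px c(1) nonzero[OF g] that] that by (simp add: field_simps)
    ultimately have eq: "drift b' (cj v (x * y)) = drift b' (cj v x) * (1 + drift d' y / drift d' x)"
      by (simp add: distrib_left)
    have "Re (1 + drift d' y / drift d' x) > 0" using positive[OF g nonzero[OF g]] by simp
    then have "1 + drift d' y / drift d' x \<noteq> 0" by (metis less_irrefl zero_complex.sel(1))
    then show ?thesis using eq that by simp
  qed
  have dxy: "drift d' (x * y) \<noteq> 0" using pos_sum[of d' 1, unfolded cj_one(2)] nonzero[OF g] by blast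
  have nxy: "\<not> central (x * y)" using dxy drift_zero_unless by blast
  have xxy: "commute x (x * y)" using c(1) by (simp add: commute_mult_iff)
  have pxy: "parabolic (x * y)" using drift_nonzero_iff(2)[OF px xxy nxy] .
  have cxyz: "commute (x * y) z"
    using commute_trans[OF _ xxy c(2)] px unfolding parabolic_def by blast
  interpret q: quad a l i k m b "cj u xa" "cj u xl" "x * y" z "cj h xm" "cj h xb"
  proof
    have "finite_orbit ?B7" using finite_orbit_reach[OF fin uh(3)] .
    then show "finite_orbit [(a, cj u xa), (l, cj u xl), (i, x * y), (k, z), (m, cj h xm), (b, cj h xb)]"
      using finite_orbit_merge[of "[(a, cj u xa), (l, cj u xl)]" i x j y "[(k, z), (m, cj h xm), (b, cj h xb)]"] d7
      by simp
    show "distinct [a, l, i, k, m, b]" using d7 by auto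
    have "lprod ?B7 = 1" using reach_prod[OF uh(3)] prod by (simp add: mult.assoc)
    then show "cj u xa * cj u xl * (x * y) * z * cj h xm * cj h xb = 1" by (simp add: mult.assoc)
    show "\<not> commute (x * y) (cj (cj u xa * cj u xl) (x * y))"
      using drift_not_commute(2)[OF pxy dxy] unfolding uh(1) d_def cj_mult .
  qed (use nc cxyz nxy E in \<open>auto simp: parabolic_def\<close>)
  have dd: "cj u xa * cj u xl = d'" "cj h xm * cj h xb = e'" unfolding uh(1,2) d_def e_def by (simp_all add: cj_mult)
  have split: "\<exists>v. t = cj v (x * y) \<and> good d'' i (cj v x) j (cj v y) k w e''"
    if r': "reach [(a, d'), (i, x * y), (k, z), (m, e')] [(a, d''), (i, t), (k, w), (m, e'')]"
      and tw: "commute t w" for d'' t w e''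
  proof -
    have "reach ([(a, d')] @ (i, x * y) # [(k, z), (m, e')]) ([(a, d'')] @ (i, t) # [(k, w), (m, e'')])"
      using r' by simp
    then obtain v where v: "t = cj v (x * y)"
      "reach ([(a, d')] @ (i, x) # (j, y) # [(k, z), (m, e')]) ([(a, d'')] @ (i, cj v x) # (j, cj v y) # [(k, w), (m, e'')])"
      by (rule reach_unmerge[where j = j]) (use d7 in auto)
    have "reach Q [(a, d''), (i, cj v x), (j, cj v y), (k, w), (m, e'')]"
      using reach_trans[OF _ r] v(2) by simp
    moreover have "commute t (cj v x)" using xxy v(1) by (simp add: commute_sym)
    then have "commute (cj v x) w" using commute_trans[OF _ _ tw] nxy v(1) by auto
    ultimately show ?thesis using v(1) c(1) by (auto simp: good_def)
  qed
  have Qeq: "q.Q = [(a, d'), (i, x * y), (k, z), (m, e')]"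
    unfolding q.Q_def q.d_def q.e_def dd by simp
  have "\<exists>d'' t w e''. reach q.Q [(a, d''), (i, t), (k, w), (m, e'')] \<and> commute t w \<and>
      Re (drift d'' w / drift d'' t) \<ge> 1"
  proof (rule q.parabolic_pair[OF pxy])
    fix d'' t w e'' assume r': "reach q.Q [(a, d''), (i, t), (k, w), (m, e'')]" and tw: "commute t w"
    obtain v where v: "t = cj v (x * y)" "good d'' i (cj v x) j (cj v y) k w e''"
      using split[OF r'[unfolded Qeq] tw] by blast
    let ?x = "cj v x" and ?s = "drift d' y / drift d' x"
    have nz: "drift d'' ?x \<noteq> 0" by (rule nonzero[OF v(2)])
    have t: "drift d'' t = drift d'' ?x * (1 + ?s)" "drift d'' t \<noteq> 0"
      using pos_sum[OF nz] v(1) by auto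
    have "drift d'' w / drift d'' ?x \<in> \<real>" "Re (drift d'' w / drift d'' ?x) > 0"
      using positive[OF exchange[OF v(2)] nz] by auto
    then obtain r1 where r1: "drift d'' w / drift d'' ?x = of_real r1" "r1 > 0" by (auto elim!: Reals_cases)
    have "?s \<in> \<real>" "Re ?s > 0" using positive[OF g nonzero[OF g]] by auto
    then obtain r2 where r2: "?s = of_real r2" "r2 > 0" by (auto elim!: Reals_cases)
    have "drift d'' w / drift d'' t = (drift d'' w / drift d'' ?x) / (1 + ?s)"
      unfolding t(1) by simp
    also have "\<dots> = of_real (r1 / (1 + r2))" unfolding r1 r2 by simp
    finally have wt: "drift d'' w / drift d'' t = of_real (r1 / (1 + r2))" .
    show "drift d'' t \<noteq> 0 \<and> drift d'' w / drift d'' t \<in> \<real> \<and> Re (drift d'' w / drift d'' t) > 0"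
      unfolding wt using t(2) r1(2) r2(2) by (simp del: of_real_divide)
  qed
  then obtain d'' t w e'' where r': "reach q.Q [(a, d''), (i, t), (k, w), (m, e'')]"
    and tw: "commute t w" and big: "Re (drift d'' w / drift d'' t) \<ge> 1" by blast
  obtain v where v: "t = cj v (x * y)" "good d'' i (cj v x) j (cj v y) k w e''"
    using split[OF r'[unfolded Qeq] tw] by blast
  let ?x = "cj v x" and ?s = "drift d' y / drift d' x"
  have nz: "drift d'' ?x \<noteq> 0" by (rule nonzero[OF v(2)])
  have t: "drift d'' t = drift d'' ?x * (1 + ?s)" "drift d'' t \<noteq> 0"
    using pos_sum[OF nz] v(1) by auto
  have s: "?s \<in> \<real>" "Re ?s > 0" using positive[OF g nonzero[OF g]] by auto
  then obtain s' where s': "?s = of_real s'" "s' > 0" by (auto elim!: Reals_cases)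
  have "drift d'' w / drift d'' ?x = drift d'' w / drift d'' t * (1 + ?s)"
    using t nz by simp
  also have "1 + ?s = of_real (1 + s')" using s'(1) by simp
  finally have "Re (drift d'' w / drift d'' ?x) = Re (drift d'' w / drift d'' t) * (1 + s')"
    by (simp only: Re_complex_of_real times_complex.sel Im_complex_of_real)
  also have "\<dots> \<ge> 1 * (1 + s')" using big s'(2) by (intro mult_right_mono) auto
  finally have "Re (drift d'' w / drift d'' ?x) > Max \<Omega>" using s' by (simp add: M)
  moreover have "Re (drift d'' w / drift d'' ?x) \<in> \<Omega>"
    unfolding \<Omega>_def using exchange[OF v(2)] by blast
  ultimately show False using max(2) by fastforce
qed

section \<open>Five commuting elements\<close>

lemma root_of_unity_divide: "root_of_unity z \<Longrightarrow> root_of_unity w \<Longrightarrow> root_of_unity (z / w)"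
  unfolding divide_inverse by (intro root_of_unity_mult root_of_unity_inverse)

lemma root_of_unity_nz: "root_of_unity z \<Longrightarrow> z \<noteq> 0"
  by (auto simp: root_of_unity_def power_0_left)

lemma root_of_unity_cancel:
  "root_of_unity w \<Longrightarrow> root_of_unity (z * w) \<longleftrightarrow> root_of_unity z"
proof
  assume w: "root_of_unity w" and zw: "root_of_unity (z * w)"
  have eq: "z * w * inverse w = z" using root_of_unity_nz[OF w] by simp
  show "root_of_unity z" using root_of_unity_mult[OF zw root_of_unity_inverse[OF w]] unfolding eq .
qed (rule root_of_unity_mult)

text \<open>Modulo roots of unity, \<open>x = y = v\<close> and \<open>z = v\<^sup>\<plusminus>\<^sup>1\<close>, so \<open>x y z\<close> and \<open>x y / z\<close> are \<open>v\<close> and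
  \<open>v\<^sup>3\<close> in some order.\<close>

lemma two_equal_classes:
  assumes nz: "x \<noteq> 0" "y \<noteq> 0" "z \<noteq> 0" "v \<noteq> 0" and v: "\<not> root_of_unity v"
    and xy: "root_of_unity (x / v)" "root_of_unity (y / v)"
    and z: "root_of_unity (z / v) \<or> root_of_unity (z * v)"
    and step: "\<not> root_of_unity (x * y) \<Longrightarrow> root_of_unity (x * y * z) \<or> root_of_unity (x * y / z)"
  shows False
proof -
  have pow: "\<not> root_of_unity (v ^ k)" if "k > 0" for k
    using v root_of_unity_power that by blast
  let ?q = "x / v * (y / v)"
  have q: "root_of_unity ?q" using xy by (rule root_of_unity_mult)
  have "x * y = v ^ 2 * ?q" using nz by (simp add: power2_eq_square)
  moreover have "\<not> root_of_unity (v ^ 2 * ?q)" using root_of_unity_cancel[OF q, of "v ^ 2"] pow[of 2] by simp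
  ultimately have "\<not> root_of_unity (x * y)" by metis
  then have s: "root_of_unity (x * y * z) \<or> root_of_unity (x * y / z)" by (rule step)
  show False
    using z
  proof
    assume z: "root_of_unity (z / v)"
    have "x * y * z = v ^ 3 * (?q * (z / v))" "x * y / z = v ^ 1 * (?q / (z / v))"
      using nz by (simp_all add: power3_eq_cube field_simps)
    moreover have "\<not> root_of_unity (v ^ 3 * (?q * (z / v)))" "\<not> root_of_unity (v ^ 1 * (?q / (z / v)))"
      using root_of_unity_cancel[OF root_of_unity_mult[OF q z], of "v ^ 3"] pow[of 3]
        root_of_unity_cancel[OF root_of_unity_divide[OF q z], of "v ^ 1"] pow[of 1] by simp_all
    ultimately show False using s by metis
  next
    assume z: "root_of_unity (z * v)"
    have "x * y * z = v ^ 1 * (?q * (z * v))" "x * y / z = v ^ 3 * (?q / (z * v))"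
      using nz by (simp_all add: power3_eq_cube field_simps)
    moreover have "\<not> root_of_unity (v ^ 1 * (?q * (z * v)))" "\<not> root_of_unity (v ^ 3 * (?q / (z * v)))"
      using root_of_unity_cancel[OF root_of_unity_mult[OF q z], of "v ^ 1"] pow[of 1]
        root_of_unity_cancel[OF root_of_unity_divide[OF q z], of "v ^ 3"] pow[of 3] by simp_all
    ultimately show False using s by metis
  qed
qed

text \<open>Among three of the numbers some two have a product \<open>u\<close> of infinite order, since otherwise the
  square of the number \<open>r i\<^sub>0\<close> of infinite order would be a root of unity. Modulo roots of unity, each of the
  remaining three numbers is \<open>u\<close> or \<open>u\<^sup>-\<^sup>1\<close>; two of them are equal, which \<open>two_equal_classes\<close>
  excludes.\<close>

lemma five_eigenvalues:
  fixes r :: "nat \<Rightarrow> complex"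
  assumes nz: "\<And>i. i < 5 \<Longrightarrow> r i \<noteq> 0" and i0: "i0 < 5" and inf: "\<not> root_of_unity (r i0)"
    and step: "\<And>i j k. i < 5 \<Longrightarrow> j < 5 \<Longrightarrow> k < 5 \<Longrightarrow> distinct [i, j, k] \<Longrightarrow> \<not> root_of_unity (r i * r j) \<Longrightarrow>
      root_of_unity (r i * r j * r k) \<or> root_of_unity (r i * r j / r k)"
  shows False
proof -
  have "card ({..<5} - {i0} :: nat set) = 4" using i0 by simp
  then obtain i1 i2 where i12: "i1 \<in> {..<5} - {i0}" "i2 \<in> {..<5} - {i0}" "i1 \<noteq> i2"
    by (metis card_le_Suc0_iff_eq finite_Diff finite_lessThan numeral_le_one_iff semiring_norm(69) One_nat_def)
  have "\<exists>j k. j < 5 \<and> k < 5 \<and> j \<noteq> k \<and> \<not> root_of_unity (r j * r k)"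
  proof (rule ccontr)
    assume "\<not> ?thesis"
    then have pairs: "root_of_unity (r i0 * r i1)" "root_of_unity (r i0 * r i2)" "root_of_unity (r i1 * r i2)"
      using i0 i12 by auto
    have "root_of_unity (r i0 * r i1 * (r i0 * r i2) / (r i1 * r i2))"
      by (rule root_of_unity_divide[OF root_of_unity_mult[OF pairs(1,2)] pairs(3)])
    moreover have "r i0 * r i1 * (r i0 * r i2) / (r i1 * r i2) = r i0 ^ 2"
      using nz[of i1] nz[of i2] i12 by (simp add: power2_eq_square)
    ultimately have "root_of_unity (r i0 ^ 2)" by (simp only:)
    then show False using inf root_of_unity_power[of 2 "r i0"] by simp
  qed
  then obtain j k where jk: "j < 5" "k < 5" "j \<noteq> k" and u: "\<not> root_of_unity (r j * r k)" by blast
  have "card ({..<5} - {j, k} :: nat set) = 3" using jk by simp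
  then obtain x y z where xyz: "{..<5} - {j, k} = {x, y, z}" "x \<noteq> y" "x \<noteq> z" "y \<noteq> z"
    by (auto simp: card_3_iff)
  have in5: "x < 5" "y < 5" "z < 5" "distinct [j, k, x]" "distinct [j, k, y]" "distinct [j, k, z]"
    using xyz jk by auto
  let ?u = "r j * r k"
  have nzu: "?u \<noteq> 0" using nz jk by simp
  have cls: "root_of_unity (r i / ?u) \<or> root_of_unity (r i * ?u)" if i: "i < 5" "distinct [j, k, i]" for i
  proof -
    have "root_of_unity (?u * r i) \<or> root_of_unity (?u / r i)" using step[OF jk(1,2) i u] .
    then show ?thesis using root_of_unity_inverse[of "?u / r i"] by (auto simp: mult.commute)
  qed
  have clash: False
    if "distinct [i, i', i'']" "i < 5" "i' < 5" "i'' < 5" "distinct [j, k, i'']"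
      "root_of_unity (r i / ?u) \<and> root_of_unity (r i' / ?u) \<or> root_of_unity (r i * ?u) \<and> root_of_unity (r i' * ?u)"
    for i i' i''
    using that(6)
  proof
    assume "root_of_unity (r i / ?u) \<and> root_of_unity (r i' / ?u)"
    then show False
      using two_equal_classes[of "r i" "r i'" "r i''" ?u] nz that nzu u cls[of i''] step[of i i' i''] by blast
  next
    assume a: "root_of_unity (r i * ?u) \<and> root_of_unity (r i' * ?u)"
    have "\<not> root_of_unity (inverse ?u)" using u root_of_unity_inverse[of "inverse ?u"] by auto
    then show False
      using two_equal_classes[of "r i" "r i'" "r i''" "inverse ?u"] nz that nzu cls[of i''] step[of i i' i''] a
      by (auto simp: divide_inverse)
  qed
  show False
    using cls[OF in5(1,4)] cls[OF in5(2,5)] cls[OF in5(3,6)] clash[of x y z] clash[of x z y] clash[of y z x]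
      xyz(2-4) in5 by auto
qed

text \<open>The outer elements \<open>x\<^sub>a\<close> and \<open>x\<^sub>b\<close> are inverse to each other up to an element
  of the centralizer of \<open>t\<close>.\<close>

lemma ends_do_not_commute:
  fixes t xa xb :: "'g::ct_grp"
  assumes prod: "xa * lprod cs * xb = 1" and cs: "\<forall>x\<in>snd ` set cs. commute t x"
    and t: "\<not> central t" and moves: "\<not> commute t (cj xa t)" and x: "commute t x" "\<not> central x"
  shows "\<not> commute xa x" "\<not> commute x xb"
proof -
  have ta: "\<not> commute t xa"
  proof
    assume "commute t xa"
    then have "cj xa t = t" by (simp add: cj_self commute_sym)
    then show False using moves by simp
  qed
  have trans: "commute t y" if "commute x y" for y
    using commute_trans[OF x(2) commute_sym[OF x(1)] that] .
  show "\<not> commute xa x" using trans ta commute_sym by blast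
  have c: "commute t (lprod cs)" using cs by (induction cs) (auto intro: commute_mult)
  show "\<not> commute x xb"
  proof
    assume "commute x xb"
    then have "commute t (inverse (lprod cs * xb))" using trans c by (intro commute_inverse commute_mult)
    moreover have "inverse (lprod cs * xb) = xa"
      using inv_unique[of xa "lprod cs * xb"] prod by (simp add: mult.assoc) (metis inv_inv)
    ultimately show False using ta by simp
  qed
qed

text \<open>Merging two of the five elements and absorbing two others into the outer pairs leaves a
  four-tuple to which \<open>diagonal_pair\<close> applies. All choices together are the hypothesis of
  \<open>five_eigenvalues\<close>.\<close>

lemma five_diagonal:
  fixes t :: sl2
  assumes fin: "finite_orbit ((a, xa) # cs @ [(b, xb)])" and dist: "distinct (map fst ((a, xa) # cs @ [(b, xb)]))"
    and prod: "xa * lprod cs * xb = 1" and comm: "\<forall>x\<in>snd ` set cs. commute t x"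
    and nc: "\<forall>x\<in>snd ` set cs. \<not> central x" and len: "length cs = 5" and t: "t \<in> snd ` set cs" "\<not> finite_order t"
    and moves: "\<not> commute t (cj xa t)" and diag: "e21 t = 0" "e12 t = 0"
  shows False
proof -
  have tc: "\<not> central t" using t(2) central_finite_order by blast
  have ne: "e11 t \<noteq> e22 t" using tc diag by (auto simp: central_sl2)
  have dg: "e21 x = 0" "e12 x = 0" if "x \<in> snd ` set cs" for x
    using comm that commute_diagonal[OF diag ne] by auto
  have ac: "all_commute cs" unfolding all_commute_def using comm commute_trans[OF tc] by blast
  define l where "l n = fst (cs ! n)" for n
  define x where "x n = snd (cs ! n)" for n
  have cs: "cs ! n = (l n, x n)" "(l n, x n) \<in> set cs" "x n \<in> snd ` set cs" if "n < 5" for n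
    using that len nth_mem[of n cs] by (auto simp: l_def x_def image_iff)
  define r where "r n = e11 (x n)" for n
  have dx: "e21 (x n) = 0" "e12 (x n) = 0" "commute t (x n)" "\<not> central (x n)" if "n < 5" for n
    using dg comm nc cs(3)[OF that] by auto
  have r: "r n * e22 (x n) = 1" if "n < 5" for n using det_sl2[of "x n"] dx[OF that] by (simp add: r_def)
  have r_nz: "r n \<noteq> 0" if "n < 5" for n using r[OF that] by auto
  have step: "root_of_unity (r j * r k * r i) \<or> root_of_unity (r j * r k / r i)"
    if jki: "j < 5" "k < 5" "i < 5" "distinct [j, k, i]" and inf: "\<not> root_of_unity (r j * r k)" for j k i
  proof -
    have "card ({..<5} - {j, k, i} :: nat set) = 2" using jki by simp
    then obtain u m where um: "{..<5} - {j, k, i} = {u, m}" "u \<noteq> m" by (auto simp: card_2_iff)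
    have um': "u \<in> {..<5} - {j, k, i}" "m \<in> {..<5} - {j, k, i}" unfolding um(1) by (rule insertI1, rule insertI2[OF singletonI])
    then have um5: "u < 5" "m < 5" and d5: "distinct [u, j, k, i, m]" using um(2) jki(4) by auto
    have "set [u, j, k, i, m] = {u, m} \<union> {j, k, i}"
      by auto
    also have "{u, m} \<union> {j, k, i} = {..<5}" 
      using Un_Diff_cancel2[of "{..<5}" "{j, k, i}"] jki(1-3) unfolding um(1) by (simp add: insert_absorb)
    finally have s5: "set [u, j, k, i, m] = {..<5}" .
    let ?ix = "[u, j, k, i, m]"
    have "mset ?ix = mset [0..<5]" 
      using set_eq_iff_mset_eq_distinct[OF d5 distinct_upt[of 0 5]] unfolding s5 set_upt atLeast0LessThan by simp
    then have "mset (map ((!) cs) ?ix) = mset (map ((!) cs) [0..<5])" by (metis mset_map)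
    also have "map ((!) cs) [0..<5] = cs" using map_nth[of cs] len by simp
    finally have ms: "mset (map ((!) cs) ?ix) = mset cs" .
    let ?cs = "map ((!) cs) ?ix"
    have cs': "?cs = [(l u, x u), (l j, x j), (l k, x k), (l i, x i), (l m, x m)]"
      using cs(1) um5 jki by simp
    have "reach ((a, xa) # cs @ [(b, xb)]) ([(a, xa)] @ cs @ [(b, xb)])" by (simp add: reach.start)
    from reach_permute[OF this ac ms]
    have rr: "reach ((a, xa) # cs @ [(b, xb)]) ((a, xa) # ?cs @ [(b, xb)])" by simp
    let ?B7 = "[(a, xa), (l u, x u)] @ (l j, x j) # (l k, x k) # [(l i, x i), (l m, x m), (b, xb)]"
    have B7: "(a, xa) # ?cs @ [(b, xb)] = ?B7" unfolding cs' by simp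
    have fin7: "finite_orbit ?B7" using finite_orbit_reach[OF fin rr] unfolding B7 .
    have dist7: "distinct (map fst ?B7)" using reach_distinct[OF rr dist] unfolding B7 .
    have "lprod ((a, xa) # cs @ [(b, xb)]) = 1" using prod by (simp add: mult.assoc)
    from reach_prod[OF rr this] have prod7: "xa * x u * x j * x k * x i * x m * xb = 1"
      unfolding B7 by (simp add: mult.assoc)
    have fo: "\<not> finite_order (x j * x k)"
      using inf diagonal_finite_order[of "x j * x k"] dx jki by (simp add: r_def)
    interpret quad a "l u" "l j" "l i" "l m" b xa "x u" "x j * x k" "x i" "x m" xb
    proof
      show "finite_orbit [(a, xa), (l u, x u), (l j, x j * x k), (l i, x i), (l m, x m), (b, xb)]"
        using finite_orbit_merge[OF fin7 dist7] by simp
      show "distinct [a, l u, l j, l i, l m, b]" using dist7 by auto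
      show "xa * x u * (x j * x k) * x i * x m * xb = 1" using prod7 by (simp add: mult.assoc)
      show "\<not> commute xa (x u)" "\<not> commute (x m) xb"
        using ends_do_not_commute[OF prod comm tc moves] dx um5 by blast+
      show "commute (x j * x k) (x i)"
        using commute_trans[OF tc dx(3) dx(3)] jki by (intro commute_mult') auto
      show nc: "\<not> central (x j * x k)" using fo central_finite_order by blast
      show "\<not> central (x i)" using dx jki by blast
      have tp: "commute t (x j * x k)" using dx(3) jki by (intro commute_mult) auto
      have "cj (xa * x u) (x j * x k) = cj xa (x j * x k)"
        using commute_trans[OF tc dx(3)[OF um5(1)] tp] by (simp add: cj_self flip: cj_cj)
      then show "\<not> commute (x j * x k) (cj (xa * x u) (x j * x k))"
        using moves_transfer[OF moves tc tp nc] by simp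
    qed
    have "finite_order (x j * x k * x i) \<or> finite_order (x j * x k * inverse (x i))"
      by (rule diagonal_pair) (use dx jki fo in auto)
    moreover have "e22 (x i) = 1 / r i" using r[OF jki(3)] r_nz[OF jki(3)] by (simp add: field_simps)
    ultimately show ?thesis
      using diagonal_finite_order[of "x j * x k * x i"] diagonal_finite_order[of "x j * x k * inverse (x i)"] dx jki
      by (simp add: r_def)
  qed
  obtain n0 where n0: "n0 < 5" "x n0 = t" using t(1) len by (auto simp: x_def in_set_conv_nth image_iff)
  have "\<not> root_of_unity (r n0)" using t(2) diagonal_finite_order[OF diag] n0 by (simp add: r_def)
  then show False using five_eigenvalues[of r n0] r_nz n0 step by blast
qed

lemma five_parabolic:
  fixes t :: sl2
  assumes fin: "finite_orbit ((a, xa) # cs @ [(b, xb)])" and dist: "distinct (map fst ((a, xa) # cs @ [(b, xb)]))"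
    and prod: "xa * lprod cs * xb = 1" and comm: "\<forall>x\<in>snd ` set cs. commute t x"
    and nc: "\<forall>x\<in>snd ` set cs. \<not> central x" and len: "length cs = 5" and t: "t \<in> snd ` set cs" "parabolic t"
    and moves: "\<not> commute t (cj xa t)"
  shows False
proof -
  have tc: "\<not> central t" using t(2) by (simp add: parabolic_def)
  have ac: "all_commute cs" unfolding all_commute_def using comm commute_trans[OF tc] by blast
  obtain i where "(i, t) \<in> set cs" using t(1) by auto
  then obtain ps qs where "cs = ps @ (i, t) # qs" by (meson split_list)
  then have ms: "mset cs = mset ((i, t) # ps @ qs)" and len4: "length (ps @ qs) = 4" using len by auto
  have "length (ps @ qs) = Suc (Suc (Suc (Suc 0)))" using len4 by simp
  then obtain z1 z2 z3 z4 where z: "ps @ qs = [z1, z2, z3, z4]"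
    unfolding length_Suc_conv length_0_conv by metis
  obtain l1 x1 l2 x2 l3 x3 l4 x4 where "z1 = (l1, x1)" "z2 = (l2, x2)" "z3 = (l3, x3)" "z4 = (l4, x4)"
    by (metis surj_pair)
  with z have pq: "ps @ qs = [(l1, x1), (l2, x2), (l3, x3), (l4, x4)]" by simp
  let ?cs = "[(l1, x1), (i, t), (l2, x2), (l3, x3), (l4, x4)]"
  have ms': "mset ?cs = mset cs" unfolding ms pq by simp
  have set: "set ?cs = set cs" using ms' mset_eq_setD by blast
  have x: "x1 \<in> snd ` set cs" "x2 \<in> snd ` set cs" "x3 \<in> snd ` set cs" "x4 \<in> snd ` set cs"
    unfolding set[symmetric] by auto
  have "reach ((a, xa) # cs @ [(b, xb)]) ([(a, xa)] @ cs @ [(b, xb)])" by (simp add: reach.start)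
  from reach_permute[OF this ac ms']
  have rr: "reach ((a, xa) # cs @ [(b, xb)]) [(a, xa), (l1, x1), (i, t), (l2, x2), (l3, x3), (l4, x4), (b, xb)]"
    by simp
  have "lprod ((a, xa) # cs @ [(b, xb)]) = 1" using prod by (simp add: mult.assoc)
  from reach_prod[OF rr this] have prod7: "xa * x1 * t * x2 * x3 * x4 * xb = 1" by (simp add: mult.assoc)
  have "commute x1 t" using comm x(1) commute_sym by blast
  then have "cj (xa * x1) t = cj xa t" by (simp add: cj_self flip: cj_cj)
  then show False
    using no_three_parabolics[OF finite_orbit_reach[OF fin rr] _ prod7 _ _ t(2)] x comm nc moves
      reach_distinct[OF rr dist] ends_do_not_commute[OF prod comm tc moves] by simp
qed

text \<open>Commuting elements beyond the fifth are absorbed into the left outer element, which keeps its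
  action on \<open>t\<close>.\<close>

lemma many_commuting:
  fixes t :: sl2
  assumes "finite_orbit ((a, xa) # cs @ [(b, xb)])" "distinct (map fst ((a, xa) # cs @ [(b, xb)]))"
    and "xa * lprod cs * xb = 1" "\<forall>x\<in>snd ` set cs. commute t x"
    and "\<forall>x\<in>snd ` set cs. \<not> central x" "length cs \<ge> 5" "(i, t) \<in> set cs" "\<not> finite_order t"
    and "\<not> commute t (cj xa t)"
  shows False
  using assms
proof (induction "length cs" arbitrary: cs xa rule: less_induct)
  case less
  have tc: "\<not> central t" using less.prems(8) central_finite_order by blast
  have ts: "t \<in> snd ` set cs" using less.prems(7) by force
  show ?case
  proof (cases "length cs = 5")
    case True
    from tc show False
    proof (cases rule: sl2_normal_form)
      case (diagonal g)
      let ?cs = "cjl g cs"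
      have r: "reach ((a, xa) # cs @ [(b, xb)]) (cjl g ((a, xa) # cs @ [(b, xb)]))"
        by (intro reach.conj reach.start)
      have im: "snd ` set ?cs = cj g ` snd ` set cs" by (auto simp: cjl_def image_image split_def)
      have "cj g xa * lprod ?cs * cj g xb = 1" using less.prems(3) by (simp add: lprod_cjl flip: cj_mult)
      moreover have "finite_orbit ((a, cj g xa) # ?cs @ [(b, cj g xb)])"
        using finite_orbit_reach[OF less.prems(1) r] by simp
      moreover have "distinct (map fst ((a, cj g xa) # ?cs @ [(b, cj g xb)]))" using less.prems(2) by simp
      moreover have "\<not> commute (cj g t) (cj (cj g xa) (cj g t))" using less.prems(9) by (simp add: cj_of_cj)
      ultimately show False
        using five_diagonal[of a "cj g xa" ?cs b "cj g xb" "cj g t"] im less.prems(4,5,8) True ts diagonal by auto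
    next
      case (unipotent g)
      have "e11 (cj g t) * e11 (cj g t) = 1" using det_sl2[of "cj g t"] unipotent by simp
      then have "(tr (cj g t))\<^sup>2 = 4" using unipotent by (simp add: tr_def power2_eq_square algebra_simps)
      then have "parabolic t" using tc by (simp add: parabolic_def)
      then show False by (rule five_parabolic[OF less.prems(1-5) True ts _ less.prems(9)])
    qed
  next
    case False
    obtain ps qs where "cs = ps @ (i, t) # qs" using less.prems(7) by (meson split_list)
    then have ms: "mset cs = mset ((i, t) # ps @ qs)" and len: "length cs = Suc (length (ps @ qs))" by auto
    have "ps @ qs \<noteq> []" using len less.prems(6) by fastforce
    then obtain l x rest where pq: "ps @ qs = (l, x) # rest" by (metis list.exhaust surj_pair)
    let ?cs = "(i, t) # rest"
    have ac: "all_commute cs" unfolding all_commute_def using less.prems(4) commute_trans[OF tc] by blast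
    have ms': "mset ((l, x) # ?cs) = mset cs" unfolding ms pq by simp
    then have set: "set ((l, x) # ?cs) = set cs" using mset_eq_setD by blast
    then have sub: "snd ` set ?cs \<subseteq> snd ` set cs" and xin: "x \<in> snd ` set cs" by (metis set_subset_Cons image_mono, force)
    have "reach ((a, xa) # cs @ [(b, xb)]) ([(a, xa)] @ cs @ [(b, xb)])" by (simp add: reach.start)
    from reach_permute[OF this ac ms']
    have r: "reach ((a, xa) # cs @ [(b, xb)]) ([] @ (a, xa) # (l, x) # (?cs @ [(b, xb)]))" by simp
    have d: "distinct (map fst ([] @ (a, xa) # (l, x) # (?cs @ [(b, xb)])))"
      using reach_distinct[OF r less.prems(2)] .
    have fin: "finite_orbit ((a, xa * x) # ?cs @ [(b, xb)])"
      using finite_orbit_merge[OF finite_orbit_reach[OF less.prems(1) r] d] by simp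
    have "lprod ((a, xa) # cs @ [(b, xb)]) = 1" using less.prems(3) by (simp add: mult.assoc)
    from reach_prod[OF r this] have prod: "xa * x * lprod ?cs * xb = 1" by (simp add: mult.assoc)
    have "commute x t" using less.prems(4) xin commute_sym by blast
    then have "cj (xa * x) t = cj xa t" by (simp add: cj_self flip: cj_cj)
    then have "\<not> commute t (cj (xa * x) t)" using less.prems(9) by simp
    moreover have "length ?cs < length cs" "length ?cs \<ge> 5" using len pq False less.prems(6) by auto
    moreover have "distinct (map fst ((a, xa * x) # ?cs @ [(b, xb)]))" using d by simp
    moreover have "\<forall>y\<in>snd ` set ?cs. commute t y" "\<forall>y\<in>snd ` set ?cs. \<not> central y"
      using sub less.prems(4,5) by blast+
    moreover have "(i, t) \<in> set ?cs" by simp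
    ultimately show False
      using less.hyps[of ?cs "xa * x"] fin prod less.prems(8) by metis
  qed
qed

text \<open>With more than six elements, the commuting block has at least five members. By the density
  hypothesis, some member of the tuple conjugates \<open>t\<close> out of its centralizer. The members of the block do
  not, so one of the two ends does, and then both do because the total product is 1.\<close>

theorem braid_orbit_bound:
  fixes B :: "('i \<times> sl2) list"
  assumes fin: "finite_orbit B" and dist: "distinct (map fst B)" and prod: "lprod B = 1"
    and nc: "\<forall>x\<in>snd ` set B. \<not> central x" and T: "(T, t) \<in> set B" "\<not> finite_order t"
    and dense: "\<And>L c. reach B L \<Longrightarrow> \<not> central c \<Longrightarrow> \<exists>x\<in>snd ` set L. \<not> commute c (cj x c)"
  shows "length B \<le> 6"
proof (rule ccontr)
  assume len: "\<not> length B \<le> 6"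
  have tc: "\<not> central t" using T(2) central_finite_order by blast
  have nac: "\<not> all_commute B"
  proof
    assume ac: "all_commute B"
    obtain x where x: "x \<in> snd ` set B" "\<not> commute t (cj x t)" using dense[OF reach.start tc] by blast
    have "t \<in> snd ` set B" using T(1) by force
    then have "commute x t" using ac x(1) unfolding all_commute_def by blast
    then show False using x(2) by (simp add: cj_self)
  qed
  obtain a xa cs b xb t' where r: "reach B ((a, xa) # cs @ [(b, xb)])" and t': "(T, t') \<in> set cs" "\<not> finite_order t'"
    and comm: "\<forall>y\<in>snd ` set cs. commute t' y"
    using commuting_block[OF fin dist prod nac T(1) _ T(2)] len by auto
  have tc': "\<not> central t'" using t'(2) central_finite_order by blast
  have p: "xa * lprod cs * xb = 1" using reach_prod[OF r prod] by (simp add: mult.assoc)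
  have nc': "\<forall>x\<in>snd ` set cs. \<not> central x"
  proof
    fix x assume "x \<in> snd ` set cs"
    then obtain i where "(i, x) \<in> set cs" by auto
    then have "(i, x) \<in> set ((a, xa) # cs @ [(b, xb)])" by simp
    then obtain g y where "(i, y) \<in> set B" "x = cj g y" using reach_entry[OF r] by blast
    then show "\<not> central x" using nc by force
  qed
  have c: "commute t' (lprod cs)" using comm by (induction cs) (auto intro: commute_mult)
  have moves: "\<not> commute t' (cj xa t')"
  proof
    assume xa: "commute t' (cj xa t')"
    have "xb = inverse (xa * lprod cs)" using p by (simp add: inv_unique)
    then have "cj xb t' = cj (inverse (lprod cs)) (cj (inverse xa) t')" by (simp add: inv_mult cj_cj)
    moreover have "commute (cj (inverse xa) t') (cj (inverse xa) (cj xa t'))" using xa unfolding commute_cj .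
    then have "commute (cj (inverse (lprod cs)) (cj (inverse xa) t')) (cj (inverse (lprod cs)) t')" by simp
    moreover have "cj (inverse (lprod cs)) t' = t'" using c by (simp add: cj_self commute_inverse' commute_sym)
    ultimately have xb: "commute t' (cj xb t')" by (simp add: commute_sym)
    have "commute t' (cj x t')" if "x \<in> snd ` set cs" for x
    proof -
      have "commute x t'" using comm that commute_sym by blast
      then show ?thesis by (simp add: cj_self)
    qed
    then have "commute t' (cj x t')" if "x \<in> snd ` set ((a, xa) # cs @ [(b, xb)])" for x
      using that xa xb by auto
    then show False using dense[OF r tc'] by blast
  qed
  have "length cs \<ge> 5" using reach_length[OF r] len by simp
  then show False
    using many_commuting[OF finite_orbit_reach[OF fin r] reach_distinct[OF r dist] p comm nc' _ t' moves] by blast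
qed

section \<open>Monodromy tuples and the mapping class group\<close>

definition mat_of :: "sl2 \<Rightarrow> complex^2^2" where
  "mat_of x = (\<chi> i j. if i = 1 then if j = 1 then e11 x else e12 x else if j = 1 then e21 x else e22 x)"

lemma mat_of_entries [simp]:
  "mat_of x $ 1 $ 1 = e11 x" "mat_of x $ 1 $ 2 = e12 x" "mat_of x $ 2 $ 1 = e21 x" "mat_of x $ 2 $ 2 = e22 x"
  by (simp_all add: mat_of_def)

lemma mat_of_inj: "mat_of x = mat_of y \<longleftrightarrow> x = y"
  by (auto simp: vec_eq_iff forall_2 sl2_eq_iff)

lemma mat_of_image: "range mat_of = carrier SL2C"
proof (intro equalityI subsetI)
  fix A assume "A \<in> range mat_of"
  then show "A \<in> carrier SL2C" using det_sl2 by (auto simp: SL2C_simps det_2)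
next
  fix A assume "A \<in> carrier SL2C"
  then have "A$1$1 * A$2$2 - A$1$2 * A$2$1 = 1" by (simp add: SL2C_simps det_2)
  then have "A = mat_of (mk (A$1$1) (A$1$2) (A$2$1) (A$2$2))"
    by (simp add: vec_eq_iff forall_2 mk_entries)
  then show "A \<in> range mat_of" by blast
qed

lemma mat_of_carrier [simp]: "mat_of x \<in> carrier SL2C" using mat_of_image by blast

lemma mat_of_one: "mat_of 1 = \<one>\<^bsub>SL2C\<^esub>"
  by (simp add: vec_eq_iff forall_2 SL2C_simps mat_def)

lemma mat_of_mult: "mat_of (x * y) = mat_of x \<otimes>\<^bsub>SL2C\<^esub> mat_of y"
  by (simp add: vec_eq_iff forall_2 SL2C_simps matrix_matrix_mult_def sum_2)

lemma mat_of_inverse: "mat_of (inverse x) = inv\<^bsub>SL2C\<^esub> (mat_of x)"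
  by (rule SL2C.inv_equality[symmetric]) (simp_all flip: mat_of_mult mat_of_one)

lemma mat_of_cj: "mat_of (cj g x) = mat_of g \<otimes>\<^bsub>SL2C\<^esub> mat_of x \<otimes>\<^bsub>SL2C\<^esub> inv\<^bsub>SL2C\<^esub> (mat_of g)"
  by (simp add: cj_def mat_of_mult mat_of_inverse)

lemma mat_of_power: "mat_of (x ^ k) = mat_of x [^]\<^bsub>SL2C\<^esub> (k :: nat)"
proof (induction k)
  case (Suc k)
  have "mat_of (x ^ Suc k) = mat_of (x ^ k) \<otimes>\<^bsub>SL2C\<^esub> mat_of x" by (simp only: power_Suc2 mat_of_mult)
  then show ?case using Suc by simp
qed (simp add: mat_of_one)

lemma mat_of_central: "central x \<Longrightarrow> mat_of x = mat (e11 x)"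
  by (simp add: vec_eq_iff forall_2 central_sl2 mat_def)

lemma tuple_prod_mat_of: "tuple_prod SL2C (map mat_of xs) = mat_of (prod_list xs)"
  by (induction xs) (simp_all add: tuple_prod_def mat_of_one mat_of_mult)

text \<open>In normal form, the matrix with rows \<open>(1, 1)\<close> and \<open>(1, 2)\<close> conjugates \<open>c\<close> out of its
  centralizer.\<close>

lemma conjugates_not_all_commute:
  fixes c :: sl2
  assumes "\<not> central c"
  shows "\<exists>x. \<not> commute c (cj x c)"
proof -
  have "\<exists>g x. \<not> commute (cj g c) (cj x (cj g c))"
    using assms
  proof (cases rule: sl2_normal_form)
    case (diagonal g)
    let ?c = "cj g c" and ?x = "mk 1 1 1 2"
    have "\<not> commute ?c (cj ?x ?c)"
    proof
      assume "commute ?c (cj ?x ?c)"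
      then have "e12 (?c * cj ?x ?c) = e12 (cj ?x ?c * ?c)" by (simp add: commute_def)
      then have "(e11 ?c - e22 ?c) * (e11 ?c - e22 ?c) = 0"
        using diagonal(1,2) unfolding cj_def[of ?x] by (simp add: mk_entries algebra_simps)
      then show False using diagonal(3) by simp
    qed
    then show ?thesis by blast
  next
    case (unipotent g)
    let ?c = "cj g c" and ?x = "mk 1 1 1 2"
    have "\<not> commute ?c (cj ?x ?c)"
    proof
      assume "commute ?c (cj ?x ?c)"
      then have "e11 (?c * cj ?x ?c) = e11 (cj ?x ?c * ?c)" by (simp add: commute_def)
      then have "e12 ?c * e12 ?c = 0"
        using unipotent(1,3) unfolding cj_def[of ?x] by (simp add: mk_entries algebra_simps)
      then show False using unipotent(2) by simp
    qed
    then show ?thesis by blast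
  qed
  then obtain g x where gx: "\<not> commute (cj g c) (cj x (cj g c))" by blast
  have "cj x (cj g c) = cj g (cj (inverse g * x * g) c)" by (simp add: cj_cj mult.assoc)
  then show ?thesis using gx by auto
qed

lemma matrix_polynomials_diff:
  assumes "p \<in> matrix_polynomials" "q \<in> matrix_polynomials"
  shows "(\<lambda>A. p A - q A) \<in> matrix_polynomials"
proof -
  have "(\<lambda>A. p A + - 1 * q A) \<in> matrix_polynomials" by (intro matrix_polynomials.intros assms)
  then show ?thesis by simp
qed

text \<open>The condition that \<open>x c x\<^sup>-\<^sup>1\<close> commutes with \<open>c\<close> is polynomial in the entries of
  \<open>x\<close>, since the inverse is the adjugate.\<close>

lemma conjugator_closed:
  "zariski_closed (mat_of ` {x. commute c (cj x c)})"
proof -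
  let ?n11 = "\<lambda>A::complex^2^2. (A$1$1 * e11 c + A$1$2 * e21 c) * A$2$2 - (A$1$1 * e12 c + A$1$2 * e22 c) * A$2$1"
  let ?n12 = "\<lambda>A::complex^2^2. (A$1$1 * e12 c + A$1$2 * e22 c) * A$1$1 - (A$1$1 * e11 c + A$1$2 * e21 c) * A$1$2"
  let ?n21 = "\<lambda>A::complex^2^2. (A$2$1 * e11 c + A$2$2 * e21 c) * A$2$2 - (A$2$1 * e12 c + A$2$2 * e22 c) * A$2$1"
  let ?n22 = "\<lambda>A::complex^2^2. (A$2$1 * e12 c + A$2$2 * e22 c) * A$1$1 - (A$2$1 * e11 c + A$2$2 * e21 c) * A$1$2"
  let ?p1 = "\<lambda>A::complex^2^2. e12 c * ?n21 A - ?n12 A * e21 c"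
  let ?p2 = "\<lambda>A::complex^2^2. e11 c * ?n12 A + e12 c * ?n22 A - (?n11 A * e12 c + ?n12 A * e22 c)"
  let ?p3 = "\<lambda>A::complex^2^2. e21 c * ?n11 A + e22 c * ?n21 A - (?n21 A * e11 c + ?n22 A * e21 c)"
  have eq: "commute c (cj x c) \<longleftrightarrow> (\<forall>p\<in>{?p1, ?p2, ?p3}. p (mat_of x) = 0)" for x
  proof -
    have n: "e11 (cj x c) = ?n11 (mat_of x)" "e12 (cj x c) = ?n12 (mat_of x)"
      "e21 (cj x c) = ?n21 (mat_of x)" "e22 (cj x c) = ?n22 (mat_of x)"
      by (simp_all add: cj_def)
    show ?thesis unfolding commute_def sl2_eq_iff sl2_entries(5-8) n by (auto simp: mult.commute)
  qed
  have pol: "{?p1, ?p2, ?p3} \<subseteq> matrix_polynomials"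
    by (simp only: insert_subset empty_subsetI simp_thms)
      (intro conjI matrix_polynomials_diff matrix_polynomials.intros)
  obtain P where P: "P \<subseteq> matrix_polynomials" "\<And>x. commute c (cj x c) \<longleftrightarrow> (\<forall>p\<in>P. p (mat_of x) = 0)"
    by (rule that[OF pol eq])
  then have "mat_of ` {x. commute c (cj x c)} = {A \<in> carrier SL2C. \<forall>p\<in>P. p A = 0}"
    unfolding mat_of_image[symmetric] by blast
  then show ?thesis unfolding zariski_closed_def using P(1) by blast
qed

text \<open>If every generator conjugates \<open>c\<close> into its centralizer, so does the whole group generated, by
  transitivity of commutation, and so does its Zariski closure. But not all of \<open>SL\<^sub>2\<close> does.\<close>

lemma dense_moves:
  assumes dense: "zariski_dense (generate SL2C (mat_of ` X))" and c: "\<not> central c"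
  shows "\<exists>x\<in>X. \<not> commute c (cj x c)"
proof (rule ccontr)
  assume "\<not> ?thesis"
  then have X: "commute c (cj x c)" if "x \<in> X" for x using that by blast
  let ?W = "mat_of ` {x. commute c (cj x c)}"
  have mult: "commute c (cj (x * y) c)" if xy: "commute c (cj x c)" "commute c (cj y c)" for x y
  proof -
    have "commute (cj x c) (cj x (cj y c))" using xy(2) by simp
    moreover have "commute (cj x c) c" using xy(1) by (rule commute_sym)
    moreover have "\<not> central (cj x c)" using c by simp
    ultimately show ?thesis using commute_trans unfolding cj_cj by blast
  qed
  have inverse: "commute c (cj (inverse x) c)" if "commute c (cj x c)" for x
  proof -
    have "commute (cj (inverse x) c) (cj (inverse x) (cj x c))" unfolding commute_cj by (rule that)
    then show ?thesis unfolding cj_inv_cj by (rule commute_sym)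
  qed
  have "A \<in> ?W" if "A \<in> generate SL2C (mat_of ` X)" for A
    using that
  proof induction
    case one
    have "commute c (cj 1 c)" by simp
    then show ?case using mat_of_one by (metis (mono_tags) image_eqI mem_Collect_eq)
  next
    case (incl A) then show ?case using X by blast
  next
    case (inv A)
    then obtain x where "A = mat_of x" "x \<in> X" by blast
    then show ?case using inverse[OF X] mat_of_inverse by (metis (mono_tags) image_eqI mem_Collect_eq)
  next
    case (eng A B)
    then obtain x y where "A = mat_of x" "B = mat_of y" "commute c (cj x c)" "commute c (cj y c)" by blast
    then show ?case using mult mat_of_mult by (metis (mono_tags) image_eqI mem_Collect_eq)
  qed
  then have "zariski_closure (generate SL2C (mat_of ` X)) \<subseteq> ?W"
    unfolding zariski_closure_def using conjugator_closed by blast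
  then have "range mat_of \<subseteq> ?W" using dense unfolding zariski_dense_def mat_of_image by blast
  then have "commute c (cj x c)" for x 
    using inj_image_mem_iff[of mat_of x "{x. commute c (cj x c)}"] by (auto simp: inj_def mat_of_inj)
  then show False using conjugates_not_all_commute[OF c] by blast
qed

abbreviation mats :: "('i \<times> sl2) list \<Rightarrow> (complex^2^2) list" where
  "mats L \<equiv> map mat_of (map snd L)"

lemma mats_cjl: "mats (cjl g L) = conj_tuple SL2C (mat_of g) (mats L)"
  by (auto simp: conj_tuple_def cjl_def mat_of_cj)

lemma mats_over:
  "mats (xs @ (j, cj g h) # (i, g) # ys) = braid_move SL2C (length xs) (mats (xs @ (i, g) # (j, h) # ys))"
  using SL2C.braid_move_append[of "mats xs" "length xs" "mat_of g" "mat_of h" "mats ys"]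
  by (simp add: mat_of_cj)

lemma mats_under:
  "mats (xs @ (j, h) # (i, cj (inverse h) g) # ys) = SL2C.unbraid_move (length xs) (mats (xs @ (i, g) # (j, h) # ys))"
  using SL2C.unbraid_move_append[of "mats xs" "length xs" "mat_of g" "mat_of h" "mats ys"]
  by (simp add: mat_of_cj mat_of_inverse)

lemma mcg_orbit_start: "x \<in> X_space n \<Longrightarrow> x \<in> mcg_orbit n x"
proof -
  assume x: "x \<in> X_space n"
  have "\<one>\<^bsub>BijGroup (X_space n)\<^esub> \<in> carrier (mcg_perms n)"
    unfolding mcg_perms_def carrier_subgroup_generated by (rule generate.one)
  moreover have "\<one>\<^bsub>BijGroup (X_space n)\<^esub> x = x" using x by (simp add: BijGroup_def)
  ultimately show ?thesis unfolding mcg_orbit_def orbit_def by (metis (mono_tags, lifting) mem_Collect_eq)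
qed

lemma mcg_orbit_apply:
  assumes x: "x \<in> X_space n" and y: "y \<in> mcg_orbit n x" and \<psi>: "\<psi> \<in> carrier (mcg_perms n)"
  shows "\<psi> y \<in> mcg_orbit n x"
proof -
  let ?G = "BijGroup (X_space n)"
  interpret G: group ?G by (rule group_BijGroup)
  obtain \<phi> where \<phi>: "\<phi> \<in> carrier (mcg_perms n)" "y = \<phi> x" using y unfolding mcg_orbit_def orbit_def by blast
  have sub: "carrier (mcg_perms n) \<subseteq> carrier ?G"
    unfolding mcg_perms_def by (rule G.carrier_subgroup_generated_subset)
  have "\<psi> \<otimes>\<^bsub>?G\<^esub> \<phi> \<in> carrier (mcg_perms n)"
    using \<phi>(1) \<psi> unfolding mcg_perms_def carrier_subgroup_generated by (intro generate.eng)
  moreover have "(\<psi> \<otimes>\<^bsub>?G\<^esub> \<phi>) x = \<psi> y"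
    using sub \<phi> \<psi> x by (auto simp: BijGroup_def compose_def)
  ultimately show ?thesis unfolding mcg_orbit_def orbit_def by (metis (mono_tags, lifting) mem_Collect_eq)
qed

lemma sigma_in_mcg_perms:
  assumes "Suc i < n"
  shows "sigma n i \<in> carrier (mcg_perms n)" "inv\<^bsub>BijGroup (X_space n)\<^esub> (sigma n i) \<in> carrier (mcg_perms n)"
  using assms sigma_in_BijGroup[OF assms] unfolding mcg_perms_def carrier_subgroup_generated
  by (auto intro: generate.incl generate.inv)

lemma sigma_class:
  assumes "Suc i < n" "As \<in> dense_tuples n"
  shows "sigma n i (conj_rel n `` {As}) = conj_rel n `` {braid_move SL2C i As}"
    and "(inv\<^bsub>BijGroup (X_space n)\<^esub> (sigma n i)) (conj_rel n `` {As}) = conj_rel n `` {SL2C.unbraid_move i As}"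
proof -
  have cl: "sigma n i (conj_rel n `` {As}) = conj_rel n `` {braid_move SL2C i As}" if "As \<in> dense_tuples n" for As
    using braid_move_class[OF assms(1) that] that by (simp add: sigma_def X_space_def quotientI)
  show "sigma n i (conj_rel n `` {As}) = conj_rel n `` {braid_move SL2C i As}" using cl assms(2) .
  let ?u = "SL2C.unbraid_move i As"
  have u: "?u \<in> dense_tuples n" using unbraid_move_dense_tuples assms by blast
  have "braid_move SL2C i ?u = As" using assms by (intro SL2C.unbraid_braid) (auto simp: dense_tuples_def)
  then have s: "sigma n i (conj_rel n `` {?u}) = conj_rel n `` {As}" using cl[OF u] by simp
  have X: "conj_rel n `` {?u} \<in> X_space n" "conj_rel n `` {As} \<in> X_space n"
    using u assms(2) by (simp_all add: X_space_def quotientI)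
  have b: "sigma n i \<in> Bij (X_space n)" using sigma_in_BijGroup[OF assms(1)] by (simp add: BijGroup_def)
  then have "inj_on (sigma n i) (X_space n)" by (simp add: Bij_def bij_betw_def)
  then have "inv_into (X_space n) (sigma n i) (conj_rel n `` {As}) = conj_rel n `` {?u}"
    using inv_into_f_f[OF _ X(1)] s by metis
  then show "(inv\<^bsub>BijGroup (X_space n)\<^esub> (sigma n i)) (conj_rel n `` {As}) = conj_rel n `` {?u}"
    using inv_BijGroup[OF b] X(2) by simp
qed

text \<open>Braid moves of tuples induce the generators of the mapping class group and their inverses on
  classes. Simultaneous conjugations are collected in \<open>g\<close>, so that only tuples \<open>M\<close> obtained by braid moves
  have to be shown to be Zariski dense.\<close>

lemma reach_mcg_orbit:
  assumes "reach B L" "mats B \<in> dense_tuples n"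
  shows "\<exists>g M. L = cjl g M \<and> mats M \<in> dense_tuples n \<and>
    conj_rel n `` {mats M} \<in> mcg_orbit n (conj_rel n `` {mats B})"
proof -
  let ?x = "conj_rel n `` {mats B}"
  have x: "?x \<in> X_space n" using assms(2) by (simp add: X_space_def quotientI)
  have split: "\<exists>xs' g' h' ys'. M = xs' @ (i, g') # (j, h') # ys' \<and> xs = cjl k xs' \<and> g = cj k g' \<and>
      h = cj k h' \<and> ys = cjl k ys'"
    if "xs @ (i, g) # (j, h) # ys = cjl k M" for xs ys :: "('a \<times> sl2) list" and i j g h k M
  proof -
    have "M = cjl (inverse k) (xs @ (i, g) # (j, h) # ys)" unfolding that by simp
    then have "M = cjl (inverse k) xs @ (i, cj (inverse k) g) # (j, cj (inverse k) h) # cjl (inverse k) ys"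
      by simp
    then show ?thesis by (metis cjl_inv(2) cj_inv_cj(2))
  qed
  show ?thesis
    using assms(1)
  proof induction
    case start
    show ?case using mcg_orbit_start[OF x] assms(2) by (metis cjl_one)
  next
    case (over xs i g j h ys)
    then obtain k M where M: "xs @ (i, g) # (j, h) # ys = cjl k M" "mats M \<in> dense_tuples n"
        "conj_rel n `` {mats M} \<in> mcg_orbit n ?x" by blast
    then obtain xs' g' h' ys' where s: "M = xs' @ (i, g') # (j, h') # ys'" "xs = cjl k xs'" "g = cj k g'"
        "h = cj k h'" "ys = cjl k ys'" using split by metis
    let ?M = "xs' @ (j, cj g' h') # (i, g') # ys'"
    have i: "Suc (length xs') < n" using M(2) unfolding s by (auto simp: dense_tuples_def)
    have "mats ?M = braid_move SL2C (length xs') (mats M)" unfolding s by (rule mats_over)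
    moreover note braid_move_dense_tuples[OF i M(2)] sigma_class(1)[OF i M(2)]
      mcg_orbit_apply[OF x M(3) sigma_in_mcg_perms(1)[OF i]]
    ultimately have "mats ?M \<in> dense_tuples n" "conj_rel n `` {mats ?M} \<in> mcg_orbit n ?x" by metis+
    moreover have "xs @ (j, cj g h) # (i, g) # ys = cjl k ?M" unfolding s by (simp add: cj_of_cj)
    ultimately show ?case by metis
  next
    case (under xs i g j h ys)
    then obtain k M where M: "xs @ (i, g) # (j, h) # ys = cjl k M" "mats M \<in> dense_tuples n"
        "conj_rel n `` {mats M} \<in> mcg_orbit n ?x" by blast
    then obtain xs' g' h' ys' where s: "M = xs' @ (i, g') # (j, h') # ys'" "xs = cjl k xs'" "g = cj k g'"
        "h = cj k h'" "ys = cjl k ys'" using split by metis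
    let ?M = "xs' @ (j, h') # (i, cj (inverse h') g') # ys'"
    have i: "Suc (length xs') < n" using M(2) unfolding s by (auto simp: dense_tuples_def)
    have "mats ?M = SL2C.unbraid_move (length xs') (mats M)" unfolding s by (rule mats_under)
    moreover note unbraid_move_dense_tuples[OF i M(2)] sigma_class(2)[OF i M(2)]
      mcg_orbit_apply[OF x M(3) sigma_in_mcg_perms(2)[OF i]]
    ultimately have "mats ?M \<in> dense_tuples n" "conj_rel n `` {mats ?M} \<in> mcg_orbit n ?x" by metis+
    moreover have "xs @ (j, h) # (i, cj (inverse h) g) # ys = cjl k ?M"
      unfolding s by (simp add: cj_of_cj flip: cj_inv)
    ultimately show ?case by metis
  next
    case (conj L g)
    then show ?case by (metis cjl_cjl)
  qed
qed

text \<open>Up to conjugation, a reachable tuple is determined by its class in the orbit and the order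
  of its labels, hence finitely many representatives suffice.\<close>

lemma finite_mcg_orbit_imp:
  fixes B :: "('i \<times> sl2) list"
  assumes dense: "mats B \<in> dense_tuples n" and fin: "finite (mcg_orbit n (conj_rel n `` {mats B}))"
  shows "finite_orbit B"
proof -
  let ?O = "mcg_orbit n (conj_rel n `` {mats B})"
  let ?labels = "{ls. set ls \<subseteq> fst ` set B \<and> length ls = length B}"
  define rep where "rep C = map (inv_into UNIV mat_of) (SOME As. As \<in> C)" for C :: "(complex^2^2) list set"
  define S where "S = (\<lambda>(C, ls). zip ls (rep C)) ` (?O \<times> ?labels)"
  have "finite ?labels" by (rule finite_lists_length_eq) simp
  then have "finite S" unfolding S_def using fin by (intro finite_imageI finite_cartesian_product)
  moreover have "\<exists>M\<in>S. \<exists>g. L = cjl g M" if L: "reach B L" for L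
  proof -
    obtain g M where M: "L = cjl g M" "mats M \<in> dense_tuples n" "conj_rel n `` {mats M} \<in> ?O"
      using reach_mcg_orbit[OF L dense] by blast
    let ?C = "conj_rel n `` {mats M}"
    have "mats M \<in> ?C" using equiv_class_self[OF equiv_conj_rel M(2)] .
    then have "(SOME As. As \<in> ?C) \<in> ?C" by (rule someI)
    then obtain A where A: "A \<in> carrier SL2C" "(SOME As. As \<in> ?C) = conj_tuple SL2C A (mats M)"
      by (auto simp: conj_rel_def)
    obtain h where "A = mat_of h" using A(1) unfolding mat_of_image[symmetric] by blast
    then have "(SOME As. As \<in> ?C) = mats (cjl h M)" using A(2) by (simp only: mats_cjl)
    moreover have "inv_into UNIV mat_of (mat_of x) = x" for x
      using mat_of_inj by (simp add: inj_def inv_f_f)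
    ultimately have "rep ?C = map snd (cjl h M)" unfolding rep_def by (simp add: map_idI)
    then have "zip (map fst M) (rep ?C) = cjl h M" by (metis cjl_simps(4) zip_map_fst_snd)
    then have "cjl h M = (\<lambda>(C, ls). zip ls (rep C)) (?C, map fst M)" by simp
    moreover have "map fst M \<in> ?labels"
      using reach_labels[OF L] reach_length[OF L] mset_eq_setD unfolding M(1) by fastforce
    ultimately have "cjl h M \<in> S" unfolding S_def using M(3)
      by (intro image_eqI[OF _ SigmaI[of ?C _ "map fst M"]]) simp_all
    moreover have "L = cjl (g * inverse h) (cjl h M)" by (simp add: M(1) cjl_cjl mult.assoc)
    ultimately show ?thesis by blast
  qed
  ultimately show ?thesis unfolding finite_orbit_def by blast
qed

theorem corollary1p1p8:
  fixes n :: nat and \<rho> :: "nat word set \<Rightarrow> complex^2^2"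
  assumes rep: "\<rho> \<in> hom (pi1_sphere n) SL2C"
    and dense: "zariski_dense (\<rho> ` carrier (pi1_sphere n))"
    and non_scalar: "\<forall>i<n. \<forall>c. \<rho> (loop n i) \<noteq> mat c"
    and infinite_order:
      "\<exists>i<n. \<forall>k::nat. k > 0 \<longrightarrow> \<rho> (loop n i) [^]\<^bsub>SL2C\<^esub> k \<noteq> \<one>\<^bsub>SL2C\<^esub>"
    and finite_orbit: "finite (mcg_orbit n (rep_class n \<rho>))"
  shows "n \<le> 6"
proof -
  let ?As = "monodromy_tuple n \<rho>"
  have len: "length ?As = n" and nth: "\<And>i. i < n \<Longrightarrow> ?As ! i = \<rho> (loop n i)"
    by (simp_all add: monodromy_tuple_def)
  have "?As \<in> dense_tuples n"
    using monodromy_tuple_carrier[OF rep] monodromy_tuple_prod[OF rep] monodromy_tuple_generate[OF rep] dense len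
    by (simp add: dense_tuples_def)
  moreover have "?As \<in> lists (range mat_of)" using monodromy_tuple_carrier[OF rep] by (auto simp: mat_of_image)
  then obtain xs where xs: "?As = map mat_of xs" unfolding lists_image by blast
  define B where "B = zip [0..<n] xs"
  have lxs: "length xs = n" using len xs by simp
  then have sB: "map snd B = xs" and fB: "map fst B = [0..<n]" by (simp_all add: B_def)
  have mB: "mats B = ?As" unfolding sB xs ..
  ultimately have dB: "mats B \<in> dense_tuples n" by simp
  have set: "snd ` set B = set xs" using sB by (metis set_map)
  have x: "mat_of (xs ! i) = \<rho> (loop n i)" if "i < n" for i using nth[OF that] that lxs unfolding xs by simp
  have fin: "finite_orbit B"
    using finite_mcg_orbit_imp[OF dB] finite_orbit unfolding rep_class_def mB by blast
  have dist: "distinct (map fst B)" by (simp add: fB)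
  have "mat_of (lprod B) = mat_of 1"
    using monodromy_tuple_prod[OF rep] unfolding xs tuple_prod_mat_of mat_of_one lprod_def sB .
  then have prod: "lprod B = 1" by (simp add: mat_of_inj)
  have nc: "\<forall>x\<in>snd ` set B. \<not> central x"
  proof
    fix y assume "y \<in> snd ` set B"
    then obtain i where "i < n" "y = xs ! i" unfolding set using lxs by (metis in_set_conv_nth)
    then show "\<not> central y" using non_scalar x mat_of_central by metis
  qed
  obtain i where i: "i < n" "\<And>k::nat. k > 0 \<Longrightarrow> \<rho> (loop n i) [^]\<^bsub>SL2C\<^esub> k \<noteq> \<one>\<^bsub>SL2C\<^esub>"
    using infinite_order by blast
  have "B ! i = (i, xs ! i)" "i < length B" using i(1) lxs by (simp_all add: B_def)
  then have T: "(i, xs ! i) \<in> set B" by (metis nth_mem)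
  have inf: "\<not> finite_order (xs ! i)"
    unfolding finite_order_def using i x[OF i(1)] mat_of_power mat_of_one by metis
  have moves: "\<exists>x\<in>snd ` set L. \<not> commute c (cj x c)" if L: "reach B L" and c: "\<not> central c" for L c
  proof -
    obtain g M where M: "L = cjl g M" "mats M \<in> dense_tuples n" using reach_mcg_orbit[OF L dB] by blast
    have "zariski_dense (generate SL2C (mat_of ` (snd ` set M)))" 
      using M(2) unfolding dense_tuples_def mem_Collect_eq set_map by blast
    moreover have "\<not> central (cj (inverse g) c)" using c by simp
    ultimately obtain y where y: "y \<in> snd ` set M" "\<not> commute (cj (inverse g) c) (cj y (cj (inverse g) c))"
      using dense_moves by blast
    have "\<not> commute (cj g (cj (inverse g) c)) (cj g (cj y (cj (inverse g) c)))" unfolding commute_cj by (rule y(2))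
    moreover have "cj g (cj y (cj (inverse g) c)) = cj (cj g y) c"
      using cj_of_cj[of g y "cj (inverse g) c"] unfolding cj_inv_cj by (rule HOL.sym)
    ultimately have "\<not> commute c (cj (cj g y) c)" unfolding cj_inv_cj by metis
    moreover have "cj g y \<in> snd ` set L" using y(1) unfolding M(1) cjl_def by force
    ultimately show ?thesis by blast
  qed
  have "length B \<le> 6" by (rule braid_orbit_bound[OF fin dist prod nc T inf moves])
  then show ?thesis by (simp add: B_def lxs)
qed

end
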